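(* Let $d=2$. For any $\varepsilon>0$, the set of odd positive integers $n$ such that $$\mathsf{W}_n\big(\Gamma\text{ closes}\big)\le n^{-1/2+\varepsilon}$$ has limiting density equal to one.
   Context: A walk of length $n$ in $\mathbb{Z}^d$ is a map $\gamma:\{0,\dots,n\}\to\mathbb{Z}^d$ with $\|\gamma(i+1)-\gamma(i)\|=1$ (Euclidean norm) for each $i$; it is self-avoiding if it is injective. $\mathrm{SAW}_n$ is the set of self-avoiding walks of length $n$ with $\gamma(0)=0$, $\mathsf{W}_n$ is the uniform probability law on $\mathrm{SAW}_n$, and $\Gamma$ denotes the random walk with this law. A walk $\gamma\in\mathrm{SAW}_n$ closes if $\|\gamma(n)\|=1$. The limit supremum density of a set $A$ of odd integers is $\limsup_n n^{-1}|A\cap[0,2n]|$; the limit infimum density is the corresponding $\liminf$. When the two are equal, the common value is called the limiting density. *)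

theory Defs
  imports "HOL-Probability.Probability"
begin

text \<open>The integer lattice of dimension \<open>d\<close> is the type \<open>int ^ 'd\<close>.  Since \<open>int\<close> is not a real
  normed space, the Euclidean norm is taken after embedding the lattice into \<open>real ^ 'd\<close>.\<close>

definition lattice_norm :: "int ^ 'd::finite \<Rightarrow> real" where
  "lattice_norm v = norm ((\<chi> k. real_of_int (v $ k)) :: real ^ 'd)"

text \<open>A map on \<open>{0..n}\<close> is represented by the function on \<open>nat\<close> that is \<open>undefined\<close> outside
  \<open>{0..n}\<close>, so that distinct maps correspond to distinct functions and are counted once.\<close>

definition is_walk :: "nat \<Rightarrow> (nat \<Rightarrow> int ^ 'd::finite) \<Rightarrow> bool" where
  "is_walk n \<gamma> \<longleftrightarrow> \<gamma> \<in> extensional {0..n} \<and> (\<forall>i<n. lattice_norm (\<gamma> (Suc i) - \<gamma> i) = 1)"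

definition self_avoiding :: "nat \<Rightarrow> (nat \<Rightarrow> int ^ 'd::finite) \<Rightarrow> bool" where
  "self_avoiding n \<gamma> \<longleftrightarrow> inj_on \<gamma> {0..n}"

definition SAW :: "nat \<Rightarrow> (nat \<Rightarrow> int ^ 'd::finite) set" where
  "SAW n = {\<gamma>. is_walk n \<gamma> \<and> self_avoiding n \<gamma> \<and> \<gamma> 0 = 0}"

definition closes :: "nat \<Rightarrow> (nat \<Rightarrow> int ^ 'd::finite) \<Rightarrow> bool" where
  "closes n \<gamma> \<longleftrightarrow> lattice_norm (\<gamma> n) = 1"

text \<open>\<open>pmf_of_set\<close> is the uniform law only on finite nonempty sets; see \<open>finite_SAW\<close> and
  \<open>SAW_nonempty\<close> below.\<close>

definition saw_law :: "nat \<Rightarrow> (nat \<Rightarrow> int ^ 'd::finite) pmf" where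
  "saw_law n = pmf_of_set (SAW n)"

lemma abs_component_le_lattice_norm: "real_of_int \<bar>v $ k\<bar> \<le> lattice_norm v"
  using component_le_norm_cart[of "(\<chi> k. real_of_int (v $ k))" k]
  by (simp add: lattice_norm_def)

lemma SAW_component_bound:
  assumes "\<gamma> \<in> SAW n" "i \<le> n"
  shows "\<bar>\<gamma> i $ k\<bar> \<le> int i"
  using assms(2)
proof (induction i)
  case 0
  then show ?case using assms(1) by (simp add: SAW_def)
next
  case (Suc i)
  have "lattice_norm (\<gamma> (Suc i) - \<gamma> i) = 1"
    using assms(1) Suc.prems by (simp add: SAW_def is_walk_def)
  then have "\<bar>(\<gamma> (Suc i) - \<gamma> i) $ k\<bar> \<le> 1"
    using abs_component_le_lattice_norm[of "\<gamma> (Suc i) - \<gamma> i" k] by linarith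
  then show ?case using Suc by simp
qed

lemma finite_SAW: "finite (SAW n :: (nat \<Rightarrow> int ^ 'd::finite) set)"
proof (rule finite_subset)
  let ?B = "vec_lambda ` ((UNIV :: 'd set) \<rightarrow>\<^sub>E {- int n..int n})"
  show "finite ({0..n} \<rightarrow>\<^sub>E ?B)"
    by (intro finite_PiE finite_imageI) auto
  show "SAW n \<subseteq> {0..n} \<rightarrow>\<^sub>E ?B"
  proof
    fix \<gamma> :: "nat \<Rightarrow> int ^ 'd" assume \<gamma>: "\<gamma> \<in> SAW n"
    have "\<gamma> i \<in> ?B" if "i \<le> n" for i
    proof (rule image_eqI)
      show "\<gamma> i = vec_lambda (vec_nth (\<gamma> i))" by simp
      have "- int n \<le> \<gamma> i $ k \<and> \<gamma> i $ k \<le> int n" for k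
        using SAW_component_bound[OF \<gamma> that, of k] that by linarith
      then show "vec_nth (\<gamma> i) \<in> UNIV \<rightarrow>\<^sub>E {- int n..int n}" by auto
    qed
    moreover have "\<gamma> \<in> extensional {0..n}" using \<gamma> by (simp add: SAW_def is_walk_def)
    ultimately show "\<gamma> \<in> {0..n} \<rightarrow>\<^sub>E ?B" by (auto simp: PiE_def)
  qed
qed

lemma SAW_nonempty: "(SAW n :: (nat \<Rightarrow> int ^ 'd::finite) set) \<noteq> {}"
proof -
  obtain k :: 'd where True by simp
  define \<gamma> :: "nat \<Rightarrow> int ^ 'd" where "\<gamma> = restrict (\<lambda>i. axis k (int i)) {0..n}"
  have "lattice_norm (\<gamma> (Suc i) - \<gamma> i) = 1" if "i < n" for i
  proof -
    have "(\<chi> j. real_of_int ((\<gamma> (Suc i) - \<gamma> i) $ j)) = (axis k 1 :: real ^ 'd)"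
      using that by (simp add: \<gamma>_def vec_eq_iff axis_def)
    then show ?thesis by (simp add: lattice_norm_def)
  qed
  moreover have "inj_on \<gamma> {0..n}"
    by (auto simp: \<gamma>_def inj_on_def axis_eq_axis)
  moreover have "\<gamma> 0 = 0" by (simp add: \<gamma>_def vec_eq_iff axis_def)
  ultimately have "\<gamma> \<in> SAW n"
    by (simp add: SAW_def is_walk_def self_avoiding_def \<gamma>_def)
  then show ?thesis by blast
qed

text \<open>These densities are meant for sets of odd integers: the interval \<open>{0..2 * n}\<close> contains
  exactly \<open>n\<close> odd numbers.\<close>

definition limsup_density :: "nat set \<Rightarrow> ereal" where
  "limsup_density A = limsup (\<lambda>n. ereal (real (card (A \<inter> {0..2 * n})) / real n))"

definition liminf_density :: "nat set \<Rightarrow> ereal" where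
  "liminf_density A = liminf (\<lambda>n. ereal (real (card (A \<inter> {0..2 * n})) / real n))"

definition has_limiting_density :: "nat set \<Rightarrow> real \<Rightarrow> bool" where
  "has_limiting_density A \<delta> \<longleftrightarrow> limsup_density A = ereal \<delta> \<and> liminf_density A = ereal \<delta>"

end

theory Submission
  imports Defs "HOL-Real_Asymp.Real_Asymp"
begin

text \<open>Write \<open>p n\<close> for the number of polygons of length \<open>n\<close>, \<open>\<mu>\<close> for the connective constant and
  \<open>u n = p n / \<mu> ^ n\<close>. Since there are at least \<open>\<mu> ^ n\<close> walks of length \<open>n\<close>, the closing probability is
  at most of order \<open>n * u (n + 1)\<close>, and one has to show that \<open>u n\<close> exceeds \<open>n powr (\<epsilon> - 3 / 2)\<close>
  only on a set of density zero.

  Two polygons of lengths \<open>j, k \<ge> N\<close>, at least as tall as wide, can be placed at about \<open>sqrt N\<close>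
  vertical offsets, moved horizontally towards each other until they nearly touch, and joined there
  by a neck of width one, at the cost of 16 extra vertices. The two polygons can be recovered from the
  joined polygon and the position of the neck up to finitely many choices. So \<open>sqrt N\<close> times the sum of
  \<open>u j * u k\<close> over all such \<open>j, k\<close> with \<open>j + k + 16 = n\<close> is at most a constant times \<open>u n\<close> times the
  average number of necks.

  That number is logarithmic. Cut a polygon at its bottom and top vertex into two strands. The strands
  run side by side through every neck, in the same order, and can be exchanged there by
  crossing the neck. Every set of \<open>m\<close> necks thus gives a pair of strands of total length \<open>n + 2 * m\<close>,
  from which the polygon and the set can be recovered because the crossings are what the strands share.
  Placed on top of each other the strands form a bridge, and there are at most \<open>\<mu> ^ (n + 1)\<close>
  bridges of length \<open>n\<close>. Hence the proportion of polygons with many necks decays exponentially in the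
  number of necks.

  Finally, if \<open>u n \<ge> M powr (\<kappa> - 3 / 2)\<close> for a positive proportion of the \<open>n\<close> of order \<open>M\<close>, then
  the convolution inequality gives the same with \<open>5 / 4 * \<kappa>\<close> instead of \<open>\<kappa>\<close>. Iterating contradicts
  the bound \<open>u n \<le> (n + 2) * \<mu> ^ 2\<close>.\<close>

section \<open>Walks and bridges\<close>

type_synonym pt = "int \<times> int"

definition adj :: "pt \<Rightarrow> pt \<Rightarrow> bool" where
  "adj p q \<longleftrightarrow> \<bar>fst p - fst q\<bar> + \<bar>snd p - snd q\<bar> = 1"

definition lpath :: "pt list \<Rightarrow> bool" where
  "lpath xs \<longleftrightarrow> distinct xs \<and> successively adj xs"

abbreviation translate :: "pt \<Rightarrow> pt list \<Rightarrow> pt list" where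
  "translate v \<equiv> map ((+) v)"

definition saw_lists :: "nat \<Rightarrow> pt list set" where
  "saw_lists n = {xs. lpath xs \<and> length xs = Suc n \<and> hd xs = 0}"

text \<open>The two extreme rows may be visited at other times than at the two ends, so bridges
  cannot simply be glued at a common vertex; \<open>stack\<close> separates them by a vertical
  step.\<close>

definition bridges :: "nat \<Rightarrow> pt list set" where
  "bridges n = {xs \<in> saw_lists n. \<forall>q\<in>set xs. 0 \<le> snd q \<and> snd q \<le> snd (last xs)}"

lemma adj_sym: "adj p q \<longleftrightarrow> adj q p"
  by (auto simp: adj_def)

lemma adj_translate [simp]: "adj (v + p) (v + q) \<longleftrightarrow> adj p q"
  by (auto simp: adj_def)

lemma lpath_translate [simp]: "lpath (translate v xs) \<longleftrightarrow> lpath xs"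
  by (auto simp: lpath_def distinct_map successively_map inj_on_def)

lemma successively_adj_converse [simp]: "successively (\<lambda>p q. adj q p) xs \<longleftrightarrow> successively adj xs"
  by (intro successively_cong) (auto simp: adj_sym)

lemma lpath_rev [simp]: "lpath (rev xs) \<longleftrightarrow> lpath xs"
  by (simp add: lpath_def)

lemma lpath_append_iff:
  "lpath (xs @ ys) \<longleftrightarrow> lpath xs \<and> lpath ys \<and> set xs \<inter> set ys = {} \<and>
     (xs = [] \<or> ys = [] \<or> adj (last xs) (hd ys))"
  by (auto simp: lpath_def successively_append_iff)

lemma plus_comp_plus [simp]: "(+) v \<circ> (+) w = (+) (v + w :: pt)"
  by (auto simp: add.assoc)

lemma plus_0_eq_id [simp]: "(+) (0 :: pt) = id"
  by auto

lemma path_coordinate_bound: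
  assumes "successively adj xs" "i < length xs"
  shows "\<bar>fst (xs ! i) - fst (hd xs)\<bar> \<le> int i \<and> \<bar>snd (xs ! i) - snd (hd xs)\<bar> \<le> int i"
  using assms(2)
proof (induction i)
  case 0
  then show ?case by (cases xs) auto
next
  case (Suc i)
  then have "adj (xs ! i) (xs ! Suc i)"
    using assms(1) by (simp add: successively_conv_nth)
  then show ?case using Suc by (auto simp: adj_def)
qed

lemma finite_paths: "finite {xs. successively adj xs \<and> length xs = n \<and> hd xs = v}"
proof (rule finite_subset)
  let ?B = "{fst v - int n..fst v + int n} \<times> {snd v - int n..snd v + int n}"
  show "finite {xs. set xs \<subseteq> ?B \<and> length xs = n}"
    by (intro finite_lists_length_eq) auto
  show "{xs. successively adj xs \<and> length xs = n \<and> hd xs = v} \<subseteq> {xs. set xs \<subseteq> ?B \<and> length xs = n}"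
  proof clarsimp
    fix xs a b assume *: "successively adj xs" "(a, b) \<in> set xs" "n = length xs" "v = hd xs"
    then obtain i where "i < length xs" "xs ! i = (a, b)" by (auto simp: in_set_conv_nth)
    with path_coordinate_bound[OF *(1), of i] *
    show "fst (hd xs) - int (length xs) \<le> a \<and> a \<le> fst (hd xs) + int (length xs) \<and>
       snd (hd xs) - int (length xs) \<le> b \<and> b \<le> snd (hd xs) + int (length xs)" by auto
  qed
qed

lemma finite_saw_lists [simp]: "finite (saw_lists n)"
  by (rule finite_subset[OF _ finite_paths[of "Suc n" 0]]) (auto simp: saw_lists_def lpath_def)

lemma finite_bridges [simp]: "finite (bridges n)"
  by (rule finite_subset[of _ "saw_lists n"]) (auto simp: bridges_def)

section \<open>Cutting walks and stacking bridges\<close>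

lemma card_saw_lists_add:
  "card (saw_lists (m + n)) \<le> card (saw_lists m) * card (saw_lists n)"
proof -
  define f where "f xs = (take (Suc m) xs, translate (- (xs ! m)) (drop m xs))" for xs :: "pt list"
  have "inj_on f (saw_lists (m + n))"
  proof (rule inj_onI)
    fix xs ys assume xs: "xs \<in> saw_lists (m + n)" and ys: "ys \<in> saw_lists (m + n)" and eq: "f xs = f ys"
    have t: "take (Suc m) xs = take (Suc m) ys" using eq by (simp add: f_def)
    then have nm: "xs ! m = ys ! m" by (metis lessI nth_take)
    have "translate (xs ! m) (snd (f xs)) = translate (xs ! m) (snd (f ys))" using eq by simp
    then have d: "drop m xs = drop m ys" by (simp add: f_def nm comp_def)
    have "take m xs = take m ys" using t by (metis min.absorb1 le_SucI order_refl take_take)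
    then show "xs = ys" using d by (metis append_take_drop_id)
  qed
  moreover have "f xs \<in> saw_lists m \<times> saw_lists n" if xs: "xs \<in> saw_lists (m + n)" for xs
  proof -
    have len: "length xs = Suc (m + n)" and p: "lpath xs" and h: "hd xs = 0"
      using xs by (auto simp: saw_lists_def)
    have "lpath (take (Suc m) xs)" "lpath (drop m xs)"
      using p by (metis append_take_drop_id lpath_append_iff)+
    moreover have "hd (translate (- (xs ! m)) (drop m xs)) = 0"
      using len by (simp add: hd_map hd_drop_conv_nth)
    ultimately show ?thesis using len h by (simp add: f_def saw_lists_def)
  qed
  ultimately have "card (saw_lists (m + n)) \<le> card (saw_lists m \<times> saw_lists n)"
    by (intro card_inj_on_le[of f] image_subsetI finite_cartesian_product) simp_all
  then show ?thesis by (simp add: card_cartesian_product)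
qed

text \<open>The step \<open>(0, 1)\<close> puts the copy of \<open>ys\<close> strictly above
  \<open>xs\<close>. This makes the vertex sets disjoint and costs one additional edge.\<close>

definition stack :: "pt list \<Rightarrow> pt list \<Rightarrow> pt list" where
  "stack xs ys = xs @ translate (last xs + (0, 1)) ys"

lemma stack_bridge:
  assumes "xs \<in> bridges k" "ys \<in> bridges l"
  shows "stack xs ys \<in> bridges (Suc (k + l))"
proof -
  have ne: "xs \<noteq> []" "ys \<noteq> []" using assms by (auto simp: bridges_def saw_lists_def)
  have x: "lpath xs" "length xs = Suc k" "hd xs = 0" and xb: "\<And>q. q \<in> set xs \<Longrightarrow> 0 \<le> snd q \<and> snd q \<le> snd (last xs)"
    and y: "lpath ys" "length ys = Suc l" "hd ys = 0" and yb: "\<And>q. q \<in> set ys \<Longrightarrow> 0 \<le> snd q \<and> snd q \<le> snd (last ys)"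
    using assms by (auto simp: bridges_def saw_lists_def)
  have "set xs \<inter> set (translate (last xs + (0, 1)) ys) = {}"
  proof -
    have "snd (last xs + (0, 1) + q) > snd p" if "q \<in> set ys" "p \<in> set xs" for p q
      using xb[OF that(2)] yb[OF that(1)] by simp
    then show ?thesis by (metis (no_types, lifting) disjoint_iff imageE less_irrefl list.set_map)
  qed
  moreover have "adj (last xs) (hd (translate (last xs + (0, 1)) ys))"
    using ne y by (simp add: hd_map adj_def)
  ultimately have "lpath (stack xs ys)"
    using x y by (simp add: stack_def lpath_append_iff del: set_map)
  moreover have l: "last (stack xs ys) = last xs + (0, 1) + last ys"
    using ne by (simp add: stack_def last_map)
  moreover have "0 \<le> snd q \<and> snd q \<le> snd (last (stack xs ys))" if "q \<in> set (stack xs ys)" for q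
    using that xb[of q] xb[of "last xs"] yb[of "last ys"] ne unfolding l
    by (auto simp: stack_def) (use yb in force)+
  ultimately show ?thesis using x y ne by (auto simp: bridges_def saw_lists_def stack_def)
qed

lemma stack_inj:
  assumes "stack xs ys = stack xs' ys'" "length xs = length xs'"
  shows "xs = xs' \<and> ys = ys'"
proof -
  have "xs = xs'" "translate (last xs + (0, 1)) ys = translate (last xs' + (0, 1)) ys'"
    using assms by (auto simp: stack_def)
  moreover have "inj ((+) (last xs + (0, 1)))" by (auto simp: inj_on_def)
  ultimately show ?thesis by (metis inj_map_eq_map)
qed

lemma card_bridges_mult:
  "card (bridges k) * card (bridges l) \<le> card (bridges (Suc (k + l)))"
proof -
  have "card (bridges k \<times> bridges l) \<le> card (bridges (Suc (k + l)))"
  proof (rule card_inj_on_le)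
    show "inj_on (\<lambda>(xs, ys). stack xs ys) (bridges k \<times> bridges l)"
      by (rule inj_onI) (auto simp: bridges_def saw_lists_def dest!: stack_inj)
  qed (auto intro: stack_bridge)
  then show ?thesis by (simp add: card_cartesian_product)
qed

lemma bridges_0: "bridges 0 = {[0]}"
  by (auto simp: bridges_def saw_lists_def lpath_def length_Suc_conv zero_prod_def)

lemma card_bridges_pos: "card (bridges n) > 0"
proof (induction n)
  case (Suc n)
  then show ?case using card_bridges_mult[of n 0] by (simp add: bridges_0)
qed (simp add: bridges_0)

lemma card_saw_lists_pos: "card (saw_lists n) > 0"
proof -
  have "card (bridges n) \<le> card (saw_lists n)" by (rule card_mono) (auto simp: bridges_def)
  then show ?thesis using card_bridges_pos[of n] by simp
qed

text \<open>\<open>m\<close> bridges with \<open>k\<close> edges each and the \<open>m - 1\<close>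
  steps between them have \<open>m * Suc k - 1\<close> edges together.\<close>

lemma card_bridges_power:
  "m > 0 \<Longrightarrow> card (bridges k) ^ m \<le> card (bridges (m * Suc k - 1))"
proof (induction m)
  case (Suc m)
  show ?case
  proof (cases "m = 0")
    case False
    have "card (bridges k) ^ Suc m \<le> card (bridges k) * card (bridges (m * Suc k - 1))"
      using Suc False by simp
    also have "\<dots> \<le> card (bridges (Suc (k + (m * Suc k - 1))))" by (rule card_bridges_mult)
    also have "Suc (k + (m * Suc k - 1)) = Suc m * Suc k - 1" using False by (cases m) auto
    finally show ?thesis .
  qed simp
qed simp

lemma card_saw_lists_power: "m > 0 \<Longrightarrow> card (saw_lists (m * n)) \<le> card (saw_lists n) ^ m"
proof (induction m)
  case (Suc m)
  show ?case
  proof (cases "m = 0")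
    case False
    have "card (saw_lists (Suc m * n)) \<le> card (saw_lists n) * card (saw_lists (m * n))"
      using card_saw_lists_add[of n "m * n"] by simp
    also have "\<dots> \<le> card (saw_lists n) * card (saw_lists n) ^ m" using Suc False by simp
    finally show ?thesis by simp
  qed simp
qed simp

text \<open>Stack \<open>m\<close> bridges of length \<open>k\<close> and cut the result into
  \<open>k + 1\<close> walks of length \<open>m\<close>.\<close>

lemma card_bridges_le_saw_lists:
  assumes "m > 0"
  shows "card (bridges k) ^ m \<le> card (saw_lists m) ^ Suc k"
proof -
  have "card (bridges k) ^ m \<le> card (bridges (m * Suc k - 1))"
    using assms by (rule card_bridges_power)
  \<comment> \<open>Stacking a one-vertex bridge on top supplies the single edge missing to a
    multiple of \<open>m\<close>.\<close>
  also have "\<dots> \<le> card (bridges (Suc (m * Suc k - 1)))"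
    using card_bridges_mult[of "m * Suc k - 1" 0] by (simp add: bridges_0)
  also have "Suc (m * Suc k - 1) = Suc k * m" using assms by (cases m) (auto simp: mult.commute)
  also have "card (bridges (Suc k * m)) \<le> card (saw_lists (Suc k * m))"
    by (rule card_mono) (auto simp: bridges_def)
  also have "\<dots> \<le> card (saw_lists m) ^ Suc k" by (rule card_saw_lists_power) simp
  finally show ?thesis .
qed

section \<open>The connective constant\<close>

text \<open>Defining the connective constant as an infimum avoids Fekete's lemma: the lower bound on the
  number of walks is immediate and the upper bound on the number of bridges follows from
  \<open>card_bridges_le_saw_lists\<close>.\<close>

definition connective :: real where
  "connective = (INF m\<in>{0<..}. root m (real (card (saw_lists m))))"

lemma connective_ge_1: "connective \<ge> 1"
  unfolding connective_def
proof (rule cINF_greatest)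
  fix m :: nat assume "m \<in> {0<..}"
  then have "root m 1 \<le> root m (real (card (saw_lists m)))"
    using card_saw_lists_pos[of m] by (intro real_root_le_mono) (auto simp: Suc_le_eq)
  then show "1 \<le> root m (real (card (saw_lists m)))" using \<open>m \<in> _\<close> by simp
qed auto

lemma connective_power_le: "connective ^ m \<le> real (card (saw_lists m))"
proof (cases "m = 0")
  case True
  then show ?thesis using card_saw_lists_pos[of 0] by simp
next
  case False
  have "connective \<le> root m (real (card (saw_lists m)))"
    unfolding connective_def using False
    by (intro cINF_lower bdd_belowI2[of _ 0]) auto
  then have "connective ^ m \<le> root m (real (card (saw_lists m))) ^ m"
    using connective_ge_1 by (intro power_mono) auto
  then show ?thesis using False by simp
qed

text \<open>Taking roots of orders \<open>m\<close> and \<open>k + 1\<close> in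
  \<open>card_bridges_le_saw_lists\<close> bounds a quantity independent of \<open>m\<close> by
  every term of the infimum.\<close>

lemma card_bridges_le: "real (card (bridges k)) \<le> connective ^ Suc k"
proof -
  have "root (Suc k) (real (card (bridges k))) \<le> connective"
    unfolding connective_def
  proof (rule cINF_greatest)
    fix m :: nat assume "m \<in> {0<..}"
    then have m: "m > 0" by simp
    have "real (card (bridges k)) ^ m \<le> real (card (saw_lists m)) ^ Suc k"
      using card_bridges_le_saw_lists[OF m, of k] by (metis of_nat_le_iff of_nat_power)
    then have "root m (root (Suc k) (real (card (bridges k)) ^ m)) \<le> root m (root (Suc k) (real (card (saw_lists m)) ^ Suc k))"
      using m by (intro real_root_le_mono) auto
    also have "root (Suc k) (real (card (saw_lists m)) ^ Suc k) = real (card (saw_lists m))"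
      by (intro real_root_power_cancel) auto
    also have "root m (root (Suc k) (real (card (bridges k)) ^ m)) = root (Suc k) (real (card (bridges k)))"
      using m by (simp add: real_root_power real_root_power_cancel)
    finally show "root (Suc k) (real (card (bridges k))) \<le> root m (real (card (saw_lists m)))" .
  qed auto
  then have "root (Suc k) (real (card (bridges k))) ^ Suc k \<le> connective ^ Suc k"
    by (intro power_mono) auto
  then show ?thesis by (metis of_nat_0_le_iff real_root_pow_pos2 zero_less_Suc)
qed

section \<open>Polygons\<close>

text \<open>The first vertex is not repeated at the end, so the length of the list is the number of
  edges. The bound 4 excludes two neighbours traversed back and forth.\<close>

definition lpolygon :: "pt list \<Rightarrow> bool" where
  "lpolygon xs \<longleftrightarrow> lpath xs \<and> 4 \<le> length xs \<and> adj (last xs) (hd xs)"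

text \<open>Lexicographic order with the row first: the least vertex is the leftmost one of the
  lowest row, the greatest the rightmost one of the highest row.\<close>

definition low :: "pt \<Rightarrow> pt \<Rightarrow> bool" where
  "low p q \<longleftrightarrow> snd p < snd q \<or> snd p = snd q \<and> fst p \<le> fst q"

definition min_first :: "pt list \<Rightarrow> bool" where
  "min_first xs \<longleftrightarrow> (\<forall>q\<in>set xs. low (hd xs) q)"

text \<open>Every unrooted polygon has exactly two representatives in this set, one for each
  orientation.\<close>

definition polygons :: "nat \<Rightarrow> pt list set" where
  "polygons n = {xs. lpolygon xs \<and> length xs = n \<and> hd xs = 0 \<and> min_first xs}"

definition closed_walks :: "nat \<Rightarrow> pt list set" where
  "closed_walks n = {xs. lpolygon xs \<and> length xs = n \<and> hd xs = 0}"

definition spread :: "(pt \<Rightarrow> int) \<Rightarrow> pt list \<Rightarrow> int" where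
  "spread f xs = Max (f ` set xs) - Min (f ` set xs)"

definition tall_polygons :: "nat \<Rightarrow> pt list set" where
  "tall_polygons n = {xs \<in> polygons n. spread fst xs \<le> spread snd xs}"

text \<open>A normal form under rotation and translation. The choice is immaterial for polygons,
  whose lowest vertex is unique. The orientation is not normalised, so decoding has to try a list
  and its reverse.\<close>

definition canon :: "pt list \<Rightarrow> pt list" where
  "canon xs = (let ys = rotate (SOME i. min_first (rotate i xs)) xs in translate (- hd ys) ys)"

lemma lpolygon_rotate1 [simp]: "lpolygon (rotate1 xs) \<longleftrightarrow> lpolygon xs"
proof (cases xs)
  case (Cons a ys)
  have "lpath (a # ys) \<longleftrightarrow> lpath ys \<and> a \<notin> set ys \<and> (ys = [] \<or> adj a (hd ys))"
    using lpath_append_iff[of "[a]" ys] by (auto simp: lpath_def)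
  moreover have "lpath (ys @ [a]) \<longleftrightarrow> lpath ys \<and> a \<notin> set ys \<and> (ys = [] \<or> adj (last ys) a)"
    using lpath_append_iff[of ys "[a]"] by (auto simp: lpath_def)
  ultimately show ?thesis using Cons by (cases "ys = []") (auto simp: lpolygon_def)
qed simp

lemma lpolygon_rotate [simp]: "lpolygon (rotate i xs) \<longleftrightarrow> lpolygon xs"
  by (induction i) simp_all

lemma lpolygon_rev [simp]: "lpolygon (rev xs) \<longleftrightarrow> lpolygon xs"
  by (auto simp: lpolygon_def hd_rev last_rev adj_sym)

lemma lpath_map:
  assumes "\<And>p q. adj (f p) (f q) \<longleftrightarrow> adj p q" "inj f"
  shows "lpath (map f xs) \<longleftrightarrow> lpath xs"
  using assms by (auto simp: lpath_def distinct_map successively_map inj_on_def)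

lemma lpolygon_map:
  assumes "\<And>p q. adj (f p) (f q) \<longleftrightarrow> adj p q" "inj f"
  shows "lpolygon (map f xs) \<longleftrightarrow> lpolygon xs"
  using assms by (cases "xs = []")
    (auto simp: lpolygon_def lpath_def distinct_map successively_map hd_map last_map inj_on_def)

lemma lpolygon_translate [simp]: "lpolygon (translate v xs) \<longleftrightarrow> lpolygon xs"
  by (rule lpolygon_map) (auto simp: inj_on_def)

lemma low_antisym: "low p q \<Longrightarrow> low q p \<Longrightarrow> p = q"
  by (auto simp: low_def prod_eq_iff)

lemma low_translate [simp]: "low (v + p) (v + q) \<longleftrightarrow> low p q"
  by (auto simp: low_def)

lemma min_first_translate [simp]: "min_first (translate v xs) \<longleftrightarrow> min_first xs"
  by (cases xs) (auto simp: min_first_def)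

lemma ex_low:
  assumes "finite S" "S \<noteq> {}"
  shows "\<exists>p\<in>S. \<forall>q\<in>S. low p q"
  using assms
proof (induction rule: finite_ne_induct)
  case (insert a F)
  then obtain p where "p \<in> F" "\<forall>q\<in>F. low p q" by blast
  then show ?case by (cases "low p a") (auto simp: low_def)+
qed (auto simp: low_def)

lemma ex_rotate_min_first:
  assumes "xs \<noteq> []"
  shows "\<exists>i<length xs. min_first (rotate i xs)"
proof -
  obtain p where p: "p \<in> set xs" "\<forall>q\<in>set xs. low p q" using ex_low[of "set xs"] assms by auto
  then obtain i where "i < length xs" "xs ! i = p" by (auto simp: in_set_conv_nth)
  then show ?thesis using p assms
    by (auto simp: min_first_def hd_rotate_conv_nth intro!: exI[of _ i])
qed

lemma min_first_rotate_unique: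
  assumes "distinct xs" "xs \<noteq> []" "min_first (rotate i xs)" "min_first (rotate j xs)"
  shows "rotate i xs = rotate j xs"
proof -
  have "hd (rotate i xs) = hd (rotate j xs)"
    using assms hd_in_set[of "rotate i xs"] hd_in_set[of "rotate j xs"]
    by (intro low_antisym) (auto simp: min_first_def)
  then have "xs ! (i mod length xs) = xs ! (j mod length xs)"
    using assms by (simp add: hd_rotate_conv_nth)
  then have "i mod length xs = j mod length xs"
    using assms by (simp add: nth_eq_iff_index_eq)
  then show ?thesis by (metis rotate_conv_mod)
qed

lemma min_first_rotate_eq:
  assumes "distinct xs" "min_first xs" "min_first (rotate i xs)"
  shows "rotate i xs = xs"
  using min_first_rotate_unique[of xs i 0] assms by (cases "xs = []") auto

lemma polygonsD:
  assumes "xs \<in> polygons n"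
  shows "lpolygon xs" "length xs = n" "hd xs = 0" "min_first xs" "xs \<noteq> []" "distinct xs" "lpath xs" "4 \<le> n"
  using assms by (auto simp: polygons_def lpolygon_def lpath_def)

lemma canon_rotate_translate:
  assumes "xs \<in> polygons n"
  shows "canon (translate v (rotate i xs)) = xs"
proof -
  note xs = polygonsD[OF assms]
  let ?zs = "translate v (rotate i xs)"
  define j where "j = (SOME j. min_first (rotate j ?zs))"
  have "\<exists>j. min_first (rotate j ?zs)" using ex_rotate_min_first[of ?zs] xs by auto
  then have "min_first (rotate j ?zs)" unfolding j_def by (rule someI_ex)
  then have "min_first (translate v (rotate (j + i) xs))" by (simp add: rotate_map rotate_rotate)
  then have "rotate (j + i) xs = xs" using xs by (intro min_first_rotate_eq) auto
  then have "rotate j ?zs = translate v xs" by (simp add: rotate_map rotate_rotate)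
  then show ?thesis using xs unfolding canon_def j_def[symmetric]
    by (simp add: Let_def hd_map)
qed

lemma finite_closed_walks [simp]: "finite (closed_walks n)"
  by (rule finite_subset[OF _ finite_paths[of n 0]]) (auto simp: closed_walks_def lpath_def lpolygon_def)

lemma finite_polygons [simp]: "finite (polygons n)"
  by (rule finite_subset[OF _ finite_closed_walks[of n]]) (auto simp: closed_walks_def polygons_def)

lemma finite_tall_polygons [simp]: "finite (tall_polygons n)"
  by (simp add: tall_polygons_def)

lemma canon_in_polygons:
  assumes "lpolygon xs"
  shows "canon xs \<in> polygons (length xs)" "\<exists>i v. canon xs = translate v (rotate i xs)"
proof -
  define j where "j = (SOME j. min_first (rotate j xs))"
  have ne: "xs \<noteq> []" using assms by (auto simp: lpolygon_def)
  have "\<exists>j. min_first (rotate j xs)" using ex_rotate_min_first[of xs] ne by auto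
  then have "min_first (rotate j xs)" unfolding j_def by (rule someI_ex)
  moreover have c: "canon xs = translate (- hd (rotate j xs)) (rotate j xs)"
    by (simp add: canon_def Let_def j_def)
  ultimately show "canon xs \<in> polygons (length xs)" using assms ne
    by (simp add: polygons_def hd_map)
  show "\<exists>i v. canon xs = translate v (rotate i xs)" using c by blast
qed

text \<open>A closed walk is a polygon together with the position at which it starts. Both sides
  count the two orientations separately, so no factor 2 appears.\<close>

lemma card_closed_walks_le: "card (closed_walks n) \<le> n * card (polygons n)"
proof -
  define g where "g = (\<lambda>(j, ys). translate (- hd (rotate j ys)) (rotate j ys) :: pt list)"
  have "xs \<in> g ` ({1..n} \<times> polygons n)" if xs: "xs \<in> closed_walks n" for xs
  proof -
    have p: "lpolygon xs" "length xs = n" "hd xs = 0" "xs \<noteq> []"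
      using xs by (auto simp: closed_walks_def lpolygon_def)
    then obtain i where i: "i < n" "min_first (rotate i xs)" using ex_rotate_min_first by blast
    define v where "v = hd (rotate i xs)"
    define ys where "ys = translate (- v) (rotate i xs)"
    have "ys \<in> polygons n" using p i by (simp add: polygons_def ys_def v_def hd_map)
    moreover have r: "rotate (n - i) ys = translate (- v) xs"
      using i p by (simp add: ys_def rotate_map rotate_rotate)
    moreover have "g (n - i, ys) = xs"
      using p by (simp add: g_def r hd_map)
    ultimately show ?thesis using i by (intro image_eqI[of _ _ "(n - i, ys)"]) auto
  qed
  then have "card (closed_walks n) \<le> card (g ` ({1..n} \<times> polygons n))"
    by (intro card_mono) auto
  also have "\<dots> \<le> card ({1..n} \<times> polygons n)" by (rule card_image_le) simp
  finally show ?thesis by (simp add: card_cartesian_product)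
qed

lemma spread_translate:
  assumes "\<And>p q. f (p + q) = f p + f q" "xs \<noteq> []"
  shows "spread f (translate v xs) = spread f xs"
proof -
  have "f ` set (translate v xs) = (+) (f v) ` (f ` set xs)"
    using assms by (auto simp: image_image)
  moreover have "Max ((+) (f v) ` (f ` set xs)) = f v + Max (f ` set xs)"
    using assms(2) by (intro mono_Max_commute[symmetric]) (auto simp: mono_def)
  moreover have "Min ((+) (f v) ` (f ` set xs)) = f v + Min (f ` set xs)"
    using assms(2) by (intro mono_Min_commute[symmetric]) (auto simp: mono_def)
  ultimately show ?thesis by (simp add: spread_def)
qed

text \<open>Exchanging the coordinates maps the remaining polygons injectively to tall ones:
  exchanging them again and normalising gives the polygon back.\<close>

lemma card_polygons_le_tall: "card (polygons n) \<le> 2 * card (tall_polygons n)"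
proof -
  let ?flat = "polygons n - tall_polygons n"
  have "xs \<in> (\<lambda>ys. canon (map prod.swap ys)) ` tall_polygons n" if xs: "xs \<in> ?flat" for xs
  proof -
    have X: "xs \<in> polygons n" using xs by simp
    note x = polygonsD[OF X]
    have "lpolygon (map prod.swap xs)" using x
      by (subst lpolygon_map) (auto simp: adj_def inj_on_def)
    from canon_in_polygons[OF this] x obtain i v where
      c: "canon (map prod.swap xs) \<in> polygons n" "canon (map prod.swap xs) = translate v (rotate i (map prod.swap xs))"
      by auto
    have ne: "rotate i (map prod.swap xs) \<noteq> []" using x by simp
    have "spread fst (map prod.swap xs) = spread snd xs" "spread snd (map prod.swap xs) = spread fst xs"
      by (simp_all add: spread_def image_image)
    then have "spread fst (canon (map prod.swap xs)) = spread snd xs"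
      "spread snd (canon (map prod.swap xs)) = spread fst xs"
      unfolding c(2) spread_translate[OF fst_add ne] spread_translate[OF snd_add ne]
      by (simp_all add: spread_def)
    then have "canon (map prod.swap xs) \<in> tall_polygons n"
      using xs c by (auto simp: tall_polygons_def)
    moreover have "map prod.swap (canon (map prod.swap xs)) = translate (prod.swap v) (rotate i xs)"
      unfolding c(2) by (simp add: rotate_map prod_eq_iff)
    then have "canon (map prod.swap (canon (map prod.swap xs))) = xs"
      using canon_rotate_translate[OF X] by simp
    ultimately show ?thesis by (metis image_eqI)
  qed
  then have "card ?flat \<le> card ((\<lambda>ys. canon (map prod.swap ys)) ` tall_polygons n)"
    by (intro card_mono) auto
  also have "\<dots> \<le> card (tall_polygons n)" by (rule card_image_le) simp
  finally have "card ?flat \<le> card (tall_polygons n)" .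
  moreover have "card (polygons n) = card ?flat + card (tall_polygons n)"
    by (subst card_Un_disjoint[symmetric]) (auto intro!: arg_cong[of _ _ card] simp: tall_polygons_def)
  ultimately show ?thesis by simp
qed

text \<open>The lowest row is 0, so the maximum is the height. The \<open>n\<close> distinct
  vertices lie in a box with at most \<open>height + 1\<close> columns and exactly
  \<open>height + 1\<close> rows.\<close>

lemma tall_height:
  assumes "xs \<in> tall_polygons n"
  shows "real n \<le> (real_of_int (Max (snd ` set xs)) + 1)\<^sup>2"
proof -
  have X: "xs \<in> polygons n" using assms by (simp add: tall_polygons_def)
  note x = polygonsD[OF X]
  let ?h = "Max (snd ` set xs)" and ?a = "Min (fst ` set xs)" and ?b = "Max (fst ` set xs)"
  have "0 \<in> snd ` set xs" using x hd_in_set[of xs] by (metis image_eqI snd_zero)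
  then have m: "Min (snd ` set xs) = 0"
    using x by (intro Min_eqI) (auto simp: min_first_def low_def)
  then have h: "?b - ?a \<le> ?h" using assms by (simp add: tall_polygons_def spread_def)
  have "set xs \<subseteq> {?a..?b} \<times> {0..?h}"
  proof
    fix p assume p: "p \<in> set xs"
    then have "?a \<le> fst p" "fst p \<le> ?b" "Min (snd ` set xs) \<le> snd p" "snd p \<le> ?h"
      by (intro Min_le Max_ge; simp)+
    then show "p \<in> {?a..?b} \<times> {0..?h}" using m by (cases p) auto
  qed
  then have "card (set xs) \<le> card ({?a..?b} \<times> {0..?h})" by (intro card_mono) auto
  then have "n \<le> nat (?b - ?a + 1) * nat (?h + 1)"
    using x by (simp add: card_cartesian_product distinct_card)
  also have "\<dots> \<le> nat (?h + 1) * nat (?h + 1)" using h by (intro mult_mono) auto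
  finally have "real n \<le> real (nat (?h + 1)) * real (nat (?h + 1))"
    by (metis of_nat_le_iff of_nat_mult)
  moreover have "?h \<ge> 0" using \<open>0 \<in> snd ` set xs\<close> by (intro Max_ge) auto
  ultimately show ?thesis by (simp add: power2_eq_square)
qed

section \<open>From walks as functions to walks as lists\<close>

definition coords :: "nat \<Rightarrow> (nat \<Rightarrow> int ^ 2) \<Rightarrow> pt list" where
  "coords n \<gamma> = map (\<lambda>i. (\<gamma> i $ 1, \<gamma> i $ 2)) [0..<Suc n]"

lemma lattice_norm_eq_1_iff:
  "lattice_norm (v :: int ^ 2) = 1 \<longleftrightarrow> \<bar>v $ 1\<bar> + \<bar>v $ 2\<bar> = 1"
proof -
  have "lattice_norm v = sqrt (real_of_int ((v $ 1)\<^sup>2 + (v $ 2)\<^sup>2))"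
    by (simp add: lattice_norm_def norm_vec_def L2_set_def sum_2)
  then have "lattice_norm v = 1 \<longleftrightarrow> (v $ 1)\<^sup>2 + (v $ 2)\<^sup>2 = 1"
    by (simp del: of_int_add of_int_power)
  also have "\<dots> \<longleftrightarrow> \<bar>v $ 1\<bar> + \<bar>v $ 2\<bar> = 1"
  proof
    assume *: "(v $ 1)\<^sup>2 + (v $ 2)\<^sup>2 = 1"
    have "\<bar>a\<bar> \<le> a\<^sup>2" for a :: int
      using mult_right_mono[of 1 "\<bar>a\<bar>" "\<bar>a\<bar>"] by (cases "a = 0") (auto simp: power2_eq_square)
    from this[of "v $ 1"] this[of "v $ 2"] * have "\<bar>v $ 1\<bar> + \<bar>v $ 2\<bar> \<le> 1" by linarith
    moreover have "v $ 1 \<noteq> 0 \<or> v $ 2 \<noteq> 0" using * by auto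
    ultimately show "\<bar>v $ 1\<bar> + \<bar>v $ 2\<bar> = 1" by linarith
  next
    assume "\<bar>v $ 1\<bar> + \<bar>v $ 2\<bar> = 1"
    then have "v $ 1 = 0 \<and> (v $ 2 = 1 \<or> v $ 2 = - 1) \<or> v $ 2 = 0 \<and> (v $ 1 = 1 \<or> v $ 1 = - 1)"
      by linarith
    then show "(v $ 1)\<^sup>2 + (v $ 2)\<^sup>2 = 1" by auto
  qed
  finally show ?thesis .
qed

lemma bij_coords: "bij_betw (coords n) (SAW n) (saw_lists n)"
proof (rule bij_betwI)
  let ?g = "\<lambda>xs. restrict (\<lambda>i. vector [fst (xs ! i), snd (xs ! i)] :: int ^ 2) {0..n}"
  have nth: "coords n \<gamma> ! i = (\<gamma> i $ 1, \<gamma> i $ 2)" if "i \<le> n" for \<gamma> i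
    using that by (simp add: coords_def del: upt_Suc)
  have eqv: "x = y \<longleftrightarrow> x $ 1 = y $ 1 \<and> x $ 2 = y $ 2" for x y :: "int ^ 2"
    by (simp add: vec_eq_iff forall_2)
  show "coords n \<in> SAW n \<rightarrow> saw_lists n"
  proof
    fix \<gamma> :: "nat \<Rightarrow> int ^ 2" assume \<gamma>: "\<gamma> \<in> SAW n"
    have "distinct (coords n \<gamma>)"
      using \<gamma> by (auto simp: SAW_def self_avoiding_def coords_def distinct_map inj_on_def eqv less_Suc_eq_le simp del: upt_Suc)
    moreover have "successively adj (coords n \<gamma>)"
      using \<gamma> unfolding successively_conv_nth
      by (auto simp: SAW_def is_walk_def lattice_norm_eq_1_iff nth adj_def coords_def abs_minus_commute less_Suc_eq_le simp del: upt_Suc)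
    moreover have "hd (coords n \<gamma>) = 0"
      using \<gamma> by (simp add: coords_def SAW_def hd_map zero_prod_def del: upt_Suc)
    ultimately show "coords n \<gamma> \<in> saw_lists n"
      by (simp add: saw_lists_def lpath_def coords_def)
  qed
  show "?g \<in> saw_lists n \<rightarrow> SAW n"
  proof
    fix xs assume xs: "xs \<in> saw_lists n"
    then have len: "length xs = Suc n" "distinct xs" "hd xs = 0"
      and s: "\<And>i. i < n \<Longrightarrow> adj (xs ! i) (xs ! Suc i)"
      by (auto simp: saw_lists_def lpath_def successively_conv_nth)
    have "inj_on (?g xs) {0..n}"
    proof (rule inj_onI)
      fix i j assume ij: "i \<in> {0..n}" "j \<in> {0..n}" "?g xs i = ?g xs j"
      then have "xs ! i = xs ! j" by (intro prod_eqI) (auto simp: eqv)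
      then show "i = j" using ij len by (simp add: nth_eq_iff_index_eq)
    qed
    moreover have "xs ! 0 = 0" using len by (cases xs) auto
    ultimately show "?g xs \<in> SAW n"
      using s by (auto simp: SAW_def is_walk_def self_avoiding_def lattice_norm_eq_1_iff adj_def eqv abs_minus_commute)
  qed
  show "?g (coords n \<gamma>) = \<gamma>" if "\<gamma> \<in> SAW n" for \<gamma>
  proof
    fix i show "?g (coords n \<gamma>) i = \<gamma> i"
      using that by (cases "i \<le> n") (auto simp: nth eqv SAW_def is_walk_def extensional_def)
  qed
  show "coords n (?g xs) = xs" if "xs \<in> saw_lists n" for xs
    using that by (intro nth_equalityI) (auto simp: saw_lists_def nth coords_def simp del: upt_Suc)
qed

text \<open>A closing walk with \<open>n\<close> edges is a closed walk on \<open>n + 1\<close>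
  vertices, and \<open>n \<ge> 3\<close> gives the four vertices of a polygon. The denominator is
  bounded below by \<open>connective_power_le\<close>.\<close>

lemma prob_closes_le:
  assumes "n \<ge> 3"
  shows "measure_pmf.prob (saw_law n :: (nat \<Rightarrow> int ^ 2) pmf) {\<gamma>. closes n \<gamma>}
           \<le> real (Suc n) * real (card (polygons (Suc n))) / connective ^ n"
proof -
  let ?S = "SAW n :: (nat \<Rightarrow> int ^ 2) set"
  note b = bij_coords[of n]
  have "coords n ` (?S \<inter> {\<gamma>. closes n \<gamma>}) \<subseteq> closed_walks (Suc n)"
  proof clarify
    fix \<gamma> :: "nat \<Rightarrow> int ^ 2" assume \<gamma>: "\<gamma> \<in> SAW n" "closes n \<gamma>"
    have "coords n \<gamma> \<in> saw_lists n" using b \<gamma> by (auto simp: bij_betw_def)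
    moreover have "last (coords n \<gamma>) = (\<gamma> n $ 1, \<gamma> n $ 2)" by (simp add: coords_def)
    then have "adj (last (coords n \<gamma>)) 0" using \<gamma>(2)
      by (simp add: closes_def lattice_norm_eq_1_iff adj_def)
    ultimately show "coords n \<gamma> \<in> closed_walks (Suc n)"
      using assms by (auto simp: closed_walks_def saw_lists_def lpolygon_def)
  qed
  then have "card (coords n ` (?S \<inter> {\<gamma>. closes n \<gamma>})) \<le> card (closed_walks (Suc n))"
    by (intro card_mono) auto
  moreover have "card (coords n ` (?S \<inter> {\<gamma>. closes n \<gamma>})) = card (?S \<inter> {\<gamma>. closes n \<gamma>})"
    using b by (intro card_image) (auto simp: bij_betw_def intro: inj_on_subset)
  ultimately have 1: "card (?S \<inter> {\<gamma>. closes n \<gamma>}) \<le> Suc n * card (polygons (Suc n))"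
    using card_closed_walks_le[of "Suc n"] by linarith
  have 2: "card ?S = card (saw_lists n)" using b by (rule bij_betw_same_card)
  have "measure_pmf.prob (saw_law n :: (nat \<Rightarrow> int ^ 2) pmf) {\<gamma>. closes n \<gamma>}
      = real (card (?S \<inter> {\<gamma>. closes n \<gamma>})) / real (card ?S)"
    unfolding saw_law_def by (rule measure_pmf_of_set[OF SAW_nonempty finite_SAW])
  also have "\<dots> \<le> (real (Suc n) * real (card (polygons (Suc n)))) / connective ^ n"
    unfolding 2 using 1 connective_power_le[of n] connective_ge_1
    by (intro frac_le) (simp_all del: mult_Suc of_nat_Suc flip: of_nat_mult)
  finally show ?thesis .
qed

section \<open>Opening a polygon\<close>

text \<open>The orbit of a list under the dihedral group: equality of cyclic lists up to
  orientation.\<close>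

definition dih :: "pt list \<Rightarrow> pt list \<Rightarrow> bool" where
  "dih xs ys \<longleftrightarrow> (\<exists>i. ys = rotate i xs) \<or> (\<exists>i. ys = rotate i (rev xs))"

text \<open>An edge of the cycle, expressed by the fact that removing it leaves a path from one end
  to the other. This is the form in which the surgeries use it.\<close>

definition cedge :: "pt list \<Rightarrow> pt \<Rightarrow> pt \<Rightarrow> bool" where
  "cedge xs p q \<longleftrightarrow> (\<exists>ms. dih xs (p # ms @ [q]))"

definition trim :: "nat \<Rightarrow> nat \<Rightarrow> 'a list \<Rightarrow> 'a list" where
  "trim a b xs = take (length xs - a - b) (drop a xs)"

text \<open>Recovers a polygon, up to the choice of its first vertex and of its orientation, from the
  path into which it is opened below; \<open>c\<close> distinguishes the shapes of the surgery.\<close>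

definition unopen :: "bool \<Rightarrow> nat \<Rightarrow> pt list \<Rightarrow> pt list" where
  "unopen r c P = (let Q = (if r then rev P else P) in
     if c = 0 then trim 4 4 Q
     else if c = 1 then trim 3 5 Q
     else trim 4 5 Q @ [hd (trim 4 5 Q) - (1, 0)])"

text \<open>The polygon \<open>xs\<close> is turned into a path \<open>P\<close> that ends with two parallel strands leaving to the
  right in the rows \<open>y\<close> and \<open>y + 1\<close>, where \<open>x\<close> is the last occupied column of \<open>xs\<close>. The column \<open>e\<close>
  depends on the shape of the surgery so that exactly 8 vertices are added in all cases.\<close>

definition opened :: "pt list \<Rightarrow> int \<Rightarrow> int \<Rightarrow> int \<Rightarrow> pt list \<Rightarrow> bool" where
  "opened xs x y e P \<longleftrightarrow> lpath P \<and> hd P = (e, y) \<and> last P = (e, y + 1) \<and>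
     length P = length xs + 8 \<and> x + 3 \<le> e \<and> e \<le> x + 5 \<and>
     (\<forall>p\<in>set P. p \<in> set xs \<or> snd p \<in> {y, y + 1} \<and> x < fst p \<and> fst p \<le> e \<or>
        snd p \<in> {y - 1, y + 2} \<and> x < fst p \<and> fst p \<le> x + 2 \<and> (x, snd p) \<in> set xs) \<and>
     (\<forall>q\<in>set xs. q \<in> set P \<or> snd q \<in> {y - 1, y + 2}) \<and>
     (\<exists>r. \<exists>c<3. dih xs (unopen r c P))"

lemma adj_iff:
  "adj (a, b) q \<longleftrightarrow> q = (a + 1, b) \<or> q = (a - 1, b) \<or> q = (a, b + 1) \<or> q = (a, b - 1)"
  by (cases q) (auto simp: adj_def abs_if)

lemma trim_append [simp]: "length pre = a \<Longrightarrow> length suf = b \<Longrightarrow> trim a b (pre @ xs @ suf) = xs"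
  by (simp add: trim_def)

section \<open>Cyclic lists up to rotation and reversal\<close>

lemma ex_rotate_inverse: "\<exists>j. rotate j (rotate i xs) = xs"
proof (cases "xs = []")
  case False
  then have "length xs * i - i + i = length xs * i" by (cases xs) auto
  then have "rotate (length xs * i - i) (rotate i xs) = rotate (length xs * i) xs"
    by (simp add: rotate_rotate)
  also have "\<dots> = xs" by (subst rotate_conv_mod) simp
  finally show ?thesis by blast
qed simp

lemma ex_rev_rotate: "\<exists>j. rev (rotate i xs) = rotate j (rev xs)"
proof (cases "xs = []")
  case False
  have "rotate (length xs - i mod length xs) (rev xs) = rev (rotate i xs)"
  proof (cases "i mod length xs = 0")
    case True
    then have "rotate i xs = xs" using rotate_conv_mod[of i xs] by simp
    moreover have "rotate (length xs) (rev xs) = rev xs" using rotate_conv_mod[of "length xs" "rev xs"] by simp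
    ultimately show ?thesis using True by simp
  next
    case F: False
    then have "(length xs - i mod length xs) mod length xs = length xs - i mod length xs"
      using False by (intro mod_less) auto
    moreover have "length xs - (length xs - i mod length xs) = i mod length xs"
      using False by (simp add: less_imp_le)
    ultimately show ?thesis by (simp add: rotate_rev rotate_conv_mod[of i xs])
  qed
  then show ?thesis by metis
qed simp

lemma dih_refl [simp]: "dih xs xs"
  unfolding dih_def by (metis rotate0 id_apply)

lemma dih_rotate: "dih xs ys \<Longrightarrow> dih xs (rotate i ys)"
  unfolding dih_def by (metis rotate_rotate)

lemma dih_rev: "dih xs ys \<Longrightarrow> dih xs (rev ys)"
  unfolding dih_def using ex_rev_rotate by (metis rev_rev_ident)

lemma dih_sym: "dih xs ys \<Longrightarrow> dih ys xs"
  unfolding dih_def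
proof (elim disjE exE)
  fix i assume "ys = rotate i xs"
  then show "(\<exists>i. xs = rotate i ys) \<or> (\<exists>i. xs = rotate i (rev ys))"
    using ex_rotate_inverse[of i xs] by metis
next
  fix i assume "ys = rotate i (rev xs)"
  then obtain j where "rotate j ys = rev xs" using ex_rotate_inverse by blast
  then have "xs = rev (rotate j ys)" by simp
  then show "(\<exists>i. xs = rotate i ys) \<or> (\<exists>i. xs = rotate i (rev ys))"
    using ex_rev_rotate[of j ys] by metis
qed

lemma dih_trans: "dih xs ys \<Longrightarrow> dih ys zs \<Longrightarrow> dih xs zs"
  using dih_rotate dih_rev unfolding dih_def[of ys] by blast

lemma dih_set: "dih xs ys \<Longrightarrow> set ys = set xs"
  and dih_length: "dih xs ys \<Longrightarrow> length ys = length xs"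
  and dih_lpolygon: "dih xs ys \<Longrightarrow> lpolygon ys \<longleftrightarrow> lpolygon xs"
  by (auto simp: dih_def)

lemma dih_map: "dih xs ys \<Longrightarrow> dih (map f xs) (map f ys)"
  unfolding dih_def by (metis rotate_map rev_map)

lemma dih_swap_ends: "dih xs (ys @ zs) \<Longrightarrow> dih xs (zs @ ys)"
  using dih_rotate[of xs "ys @ zs" "length ys"] by (simp add: rotate_append)

lemma cedge_sym: "cedge xs p q \<Longrightarrow> cedge xs q p"
  unfolding cedge_def using dih_rev by fastforce

lemma dih_neighbours:
  assumes "lpolygon xs" "w \<in> set xs"
  obtains a b ms where "dih xs (w # a # ms @ [b])" "adj w a" "adj b w" "ms \<noteq> []"
proof -
  obtain i where i: "i < length xs" "xs ! i = w" using assms(2) by (auto simp: in_set_conv_nth)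
  define zs where "zs = rotate i xs"
  have d: "dih xs zs" by (auto simp: zs_def dih_def)
  have p: "lpolygon zs" using assms by (simp add: zs_def)
  have "hd zs = w" using i hd_rotate_conv_nth[of xs i] by (fastforce simp: zs_def)
  moreover obtain w' a zs' where "zs = w' # a # zs'" "length zs' \<ge> 2"
    using p by (cases zs; cases "tl zs") (auto simp: lpolygon_def)
  ultimately have z: "zs = w # a # zs'" "length zs' \<ge> 2" by auto
  then have "zs' \<noteq> []" by auto
  then obtain ms b where z': "zs' = ms @ [b]" by (metis rev_exhaust)
  then have "ms \<noteq> []" using z by auto
  have "adj w a" "adj b w" using p z z' by (auto simp: lpolygon_def lpath_def)
  with that d z z' \<open>ms \<noteq> []\<close> show thesis by blast
qed

lemma lpolygon_cedge_cases:
  assumes "lpolygon xs" "w \<in> set xs"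
  obtains a b where "cedge xs w a" "cedge xs w b" "a \<noteq> b" "adj w a" "adj w b" "a \<in> set xs" "b \<in> set xs"
proof -
  obtain a b ms where *: "dih xs (w # a # ms @ [b])" "adj w a" "adj b w" "ms \<noteq> []"
    using dih_neighbours[OF assms] .
  have "cedge xs w b" unfolding cedge_def using * by (metis append_Cons)
  moreover have "dih xs (a # (ms @ [b]) @ [w])"
    using dih_swap_ends[of xs "[w]" "a # ms @ [b]"] * by simp
  then have "cedge xs w a" unfolding cedge_def by (metis cedge_sym cedge_def)
  moreover have "a \<noteq> b" using * dih_lpolygon[OF *(1)] assms by (auto simp: lpolygon_def lpath_def)
  moreover have "a \<in> set xs" "b \<in> set xs" using dih_set[OF *(1)] by auto
  ultimately show thesis using that * by (metis adj_sym)
qed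

lemma cedge_mem: "cedge xs p q \<Longrightarrow> p \<in> set xs \<and> q \<in> set xs"
  unfolding cedge_def using dih_set by fastforce

text \<open>A list with distinct entries has exactly one rotation with a given head. So the cycle
  can be written with \<open>w\<close> first in only two ways, one for each orientation, and the
  last entry is then one of the two neighbours of \<open>w\<close>.\<close>

lemma cedge_distinct3:
  assumes "lpolygon xs" "cedge xs w a" "cedge xs w b" "cedge xs w c" "a \<noteq> b"
  shows "c = a \<or> c = b"
proof -
  have "w \<in> set xs" using assms(2) dih_set by (fastforce simp: cedge_def)
  then obtain p q ms where *: "dih xs (w # p # ms @ [q])" using dih_neighbours[OF assms(1)] by metis
  have d: "distinct (w # p # ms @ [q])" using dih_lpolygon[OF *] assms(1) by (auto simp: lpolygon_def lpath_def)
  have "z = p \<or> z = q" if "cedge xs w z" for z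
  proof -
    from that obtain ns where ns: "dih xs (w # ns @ [z])" unfolding cedge_def by blast
    let ?L = "w # p # ms @ [q]" and ?N = "w # ns @ [z]"
    have dd: "dih ?L ?N" using dih_sym[OF *] ns by (rule dih_trans)
    have hdr: "rotate i zs = zs" if "distinct zs" "zs \<noteq> []" "hd (rotate i zs) = hd zs" for zs :: "pt list" and i
    proof -
      have "zs ! (i mod length zs) = zs ! 0" using that hd_rotate_conv_nth[of zs i] hd_conv_nth[of zs] by simp
      then have "i mod length zs = 0" using that by (simp add: nth_eq_iff_index_eq)
      then show ?thesis by (subst rotate_conv_mod) simp
    qed
    from dd consider i where "?N = rotate i ?L" | i where "?N = rotate i (rev ?L)" by (auto simp: dih_def)
    then show ?thesis
    proof cases
      case 1
      then have "rotate i ?L = ?L" using d by (intro hdr) (auto simp flip: 1)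
      then have "last ?N = last ?L" using 1 by simp
      then show ?thesis by simp
    next
      case 2
      let ?R = "[w] @ q # rev ms @ [p]"
      have "rev ?L = (q # rev ms @ [p]) @ [w]" by simp
      then have r: "rotate (length (q # rev ms @ [p])) (rev ?L) = ?R" by (metis rotate_append)
      obtain j where "rotate j ?R = rev ?L" using r ex_rotate_inverse by metis
      then have N: "?N = rotate (i + j) ?R" using 2 by (metis rotate_rotate)
      have "distinct ?R" using d by auto
      moreover have "hd (rotate (i + j) ?R) = hd ?R" unfolding N[symmetric] by simp
      ultimately have "rotate (i + j) ?R = ?R" by (intro hdr) auto
      then have "last ?N = last ?R" using N by simp
      then show ?thesis by simp
    qed
  qed
  from this[OF assms(2)] this[OF assms(3)] this[OF assms(4)] assms(5) show ?thesis by blast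
qed

lemma core_lpath:
  assumes "lpolygon xs" "dih xs (cs @ ds)"
  shows "lpath cs" "set cs \<subseteq> set xs" "length cs + length ds = length xs"
proof -
  have "lpolygon (cs @ ds)" using assms dih_lpolygon by blast
  then show "lpath cs" by (simp add: lpolygon_def lpath_append_iff)
  show "set cs \<subseteq> set xs" using dih_set[OF assms(2)] by auto
  show "length cs + length ds = length xs" using dih_length[OF assms(2)] by simp
qed

section \<open>The four surgeries\<close>

context
  fixes xs :: "pt list" and x y :: int
  assumes poly: "lpolygon xs"
    and clear: "\<And>p. p \<in> set xs \<Longrightarrow> snd p \<in> {y, y + 1} \<Longrightarrow> fst p \<le> x"
begin

lemma clear_iff: "x < c \<Longrightarrow> (c, y) \<notin> set xs" "x < c \<Longrightarrow> (c, y + 1) \<notin> set xs"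
  using clear by fastforce+

text \<open>Remove the edge and continue both of its ends straight to the right by four
  vertices.\<close>

lemma open_vertical_edge:
  assumes "cedge xs (x, y) (x, y + 1)"
  shows "\<exists>e P. opened xs x y e P"
proof -
  obtain ms where d: "dih xs ((x, y) # ms @ [(x, y + 1)])" using assms unfolding cedge_def by blast
  define cs where "cs = (x, y) # ms @ [(x, y + 1)]"
  have cs: "lpath cs" "set cs \<subseteq> set xs" "length cs = length xs" "hd cs = (x, y)" "last cs = (x, y + 1)" "cs \<noteq> []"
    using core_lpath[OF poly, of cs "[]"] d by (auto simp: cs_def)
  let ?pre = "[(x + 4, y), (x + 3, y), (x + 2, y), (x + 1, y)]"
  let ?suf = "[(x + 1, y + 1), (x + 2, y + 1), (x + 3, y + 1), (x + 4, y + 1)]"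
  let ?P = "?pre @ cs @ ?suf"
  have cs': "x < a \<Longrightarrow> (a, y) \<notin> set cs" "x < a \<Longrightarrow> (a, y + 1) \<notin> set cs" for a
    using cs(2) clear_iff by blast+
  have "lpath ?P"
    unfolding lpath_append_iff using cs(1,4-) cs'
    by (auto simp: lpath_def adj_def)
  moreover have "dih xs (unopen False 0 ?P)" using d cs by (simp add: unopen_def cs_def del: append.simps)
  moreover have "set xs = set cs" using dih_set[OF d] by (simp add: cs_def)
  ultimately have "opened xs x y (x + 4) ?P"
    unfolding opened_def using cs by (auto intro!: exI[of _ False] exI[of _ 0])
  then show ?thesis by blast
qed

text \<open>Remove a horizontal edge just below the free rows and lead its ends up: the right end
  turns into row \<open>y\<close>, the left end climbs to row \<open>y + 1\<close> and passes over
  it. This adds 3 and 5 vertices.\<close>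

lemma open_upward:
  assumes "cedge xs (c, y - 1) (d, y - 1)" "c = x + 1 \<or> c = x + 2" "d = c + 1"
  shows "\<exists>e P. opened xs x y e P"
proof -
  have "cedge xs (c + 1, y - 1) (c, y - 1)" using assms(1) cedge_sym unfolding assms(3) by blast
  then obtain ms where d: "dih xs ((c + 1, y - 1) # ms @ [(c, y - 1)])" unfolding cedge_def assms(3) by blast
  define cs where "cs = (c + 1, y - 1) # ms @ [(c, y - 1)]"
  have cs: "lpath cs" "set cs \<subseteq> set xs" "length cs = length xs" "hd cs = (c + 1, y - 1)" "last cs = (c, y - 1)" "cs \<noteq> []"
    using core_lpath[OF poly, of cs "[]"] d by (auto simp: cs_def)
  let ?pre = "[(c + 3, y), (c + 2, y), (c + 1, y)]"
  let ?suf = "[(c, y), (c, y + 1), (c + 1, y + 1), (c + 2, y + 1), (c + 3, y + 1)]"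
  let ?P = "?pre @ cs @ ?suf"
  have xc: "x < c" "c \<le> x + 2" using assms(2) by auto
  have cs': "c \<le> a \<Longrightarrow> (a, y) \<notin> set cs" "c \<le> a \<Longrightarrow> (a, y + 1) \<notin> set cs" for a
    using cs(2) clear_iff[of a] xc by auto
  have "lpath ?P"
    unfolding lpath_append_iff using cs(1,4-) cs'
    by (auto simp: lpath_def adj_def)
  moreover have "dih xs (unopen False 1 ?P)" using d cs by (simp add: unopen_def cs_def del: append.simps)
  moreover have "set xs = set cs" using dih_set[OF d] by (simp add: cs_def)
  ultimately have "opened xs x y (c + 3) ?P"
    unfolding opened_def using cs xc by (auto intro!: exI[of _ False] exI[of _ 1])
  then show ?thesis by blast
qed

text \<open>The upper end of the removed edge moves right and climbs to row \<open>y + 1\<close>;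
  the lower end passes below it through the two free vertices of row \<open>y - 1\<close> and then
  rises to row \<open>y\<close>.\<close>

lemma open_downward_edge:
  assumes "cedge xs (x, y) (x, y - 1)" "(x + 1, y - 1) \<notin> set xs" "(x + 2, y - 1) \<notin> set xs"
  shows "\<exists>e P. opened xs x y e P"
proof -
  have "cedge xs (x, y - 1) (x, y)" using assms cedge_sym by blast
  then obtain ms where d: "dih xs ((x, y - 1) # ms @ [(x, y)])" unfolding cedge_def by blast
  define cs where "cs = (x, y - 1) # ms @ [(x, y)]"
  have cs: "lpath cs" "set cs \<subseteq> set xs" "length cs = length xs" "hd cs = (x, y - 1)" "last cs = (x, y)" "cs \<noteq> []"
    using core_lpath[OF poly, of cs "[]"] d by (auto simp: cs_def)
  let ?pre = "[(x + 3, y), (x + 2, y), (x + 2, y - 1), (x + 1, y - 1)]"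
  let ?suf = "[(x + 1, y), (x + 1, y + 1), (x + 2, y + 1), (x + 3, y + 1)]"
  let ?P = "?pre @ cs @ ?suf"
  have cs': "x < a \<Longrightarrow> (a, y) \<notin> set cs" "x < a \<Longrightarrow> (a, y + 1) \<notin> set cs" for a
    using cs(2) clear_iff by blast+
  have "lpath ?P"
    unfolding lpath_append_iff using cs(1,4-) cs' assms(2,3) cs(2)[THEN subsetD, of "(x + 1, y - 1)"] cs(2)[THEN subsetD, of "(x + 2, y - 1)"]
    by (auto simp: lpath_def adj_def)
  moreover have "dih xs (unopen False 0 ?P)" using d cs by (simp add: unopen_def cs_def del: append.simps)
  moreover have "set xs = set cs" using dih_set[OF d] by (simp add: cs_def)
  moreover have "(x, y - 1) \<in> set xs" using dih_set[OF d] by auto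
  ultimately have "opened xs x y (x + 3) ?P"
    unfolding opened_def using cs by (auto intro!: exI[of _ False] exI[of _ 0])
  then show ?thesis by blast
qed

text \<open>The only surgery that deletes a vertex, namely \<open>(x, y - 1)\<close>.\<close>

lemma open_corner:
  assumes "cedge xs (x, y - 1) (x, y)" "cedge xs (x, y - 1) (x + 1, y - 1)" "(x + 2, y - 1) \<notin> set xs"
  shows "\<exists>e P. opened xs x y e P"
proof -
  let ?w = "(x, y - 1)"
  have w: "?w \<in> set xs" using assms(1) dih_set by (fastforce simp: cedge_def)
  obtain a b ms where *: "dih xs (?w # a # ms @ [b])" using dih_neighbours[OF poly w] by metis
  have "cedge xs ?w b" unfolding cedge_def using * by (metis append_Cons)
  moreover have s: "dih xs ((a # ms @ [b]) @ [?w])" using dih_swap_ends[of xs "[?w]" "a # ms @ [b]"] * by simp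
  then have "cedge xs a ?w" unfolding cedge_def by (metis append_Cons)
  then have "cedge xs ?w a" by (rule cedge_sym)
  moreover have "a \<noteq> b" using dih_lpolygon[OF *] poly by (auto simp: lpolygon_def lpath_def)
  ultimately have ab: "a \<in> {(x, y), (x + 1, y - 1)}" "b \<in> {(x, y), (x + 1, y - 1)}" "a \<noteq> b"
    using cedge_distinct3[OF poly assms(1,2)] by auto
  \<comment> \<open>Choose the orientation in which the rest of the polygon runs from the right
    neighbour of the corner to its upper neighbour.\<close>
  obtain ns where d: "dih xs (((x + 1, y - 1) # ns @ [(x, y)]) @ [?w])"
  proof (cases "a = (x, y)")
    case False
    then show thesis using that s ab by auto
  next
    case True
    then have b: "b = (x + 1, y - 1)" using ab by auto
    have "dih xs (rev (?w # a # ms @ [b]))" using * by (rule dih_rev)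
    then show thesis using that[of "rev ms"] True b by simp
  qed
  define cs where "cs = (x + 1, y - 1) # ns @ [(x, y)]"
  have D: "dih xs (cs @ [?w])" using d by (simp add: cs_def)
  have cs: "lpath cs" "set cs \<subseteq> set xs" "length cs + 1 = length xs" "hd cs = (x + 1, y - 1)" "last cs = (x, y)" "cs \<noteq> []"
    using core_lpath[OF poly D] by (auto simp: cs_def)
  let ?pre = "[(x + 4, y), (x + 3, y), (x + 2, y), (x + 2, y - 1)]"
  let ?suf = "[(x + 1, y), (x + 1, y + 1), (x + 2, y + 1), (x + 3, y + 1), (x + 4, y + 1)]"
  let ?P = "?pre @ cs @ ?suf"
  have cs': "x < a \<Longrightarrow> (a, y) \<notin> set cs" "x < a \<Longrightarrow> (a, y + 1) \<notin> set cs" for a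
    using cs(2) clear_iff by blast+
  have "lpath ?P"
    unfolding lpath_append_iff using cs(1,4-) cs' assms(3) cs(2)[THEN subsetD, of "(x + 2, y - 1)"]
    by (auto simp: lpath_def adj_def)
  moreover have "trim 4 5 ?P = cs" by (intro trim_append) simp_all
  then have "dih xs (unopen False 2 ?P)" using D cs by (simp add: unopen_def del: append.simps)
  moreover have "set xs = insert ?w (set cs)" using dih_set[OF D] by simp
  ultimately have "opened xs x y (x + 4) ?P"
    unfolding opened_def using cs by (auto intro!: exI[of _ False] exI[of _ 2])
  then show ?thesis by blast
qed

text \<open>With nothing to the right and no edge upwards, \<open>(x, y)\<close> has its edges to
  the left and down. If row \<open>y - 1\<close> has a horizontal edge starting in column
  \<open>x + 1\<close> or \<open>x + 2\<close>, the polygon is opened there. Otherwise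
  \<open>(x + 2, y - 1)\<close> is free, since it could only have a neighbour below. If
  \<open>(x + 1, y - 1)\<close> is free as well, the downward edge is opened; if not, that vertex
  must be joined to \<open>(x, y - 1)\<close>, which is then a corner.\<close>

lemma open_lower:
  assumes v: "(x, y) \<in> set xs" and up: "\<not> cedge xs (x, y) (x, y + 1)"
  shows "\<exists>e P. opened xs x y e P"
proof -
  have right: "(x + 1, y) \<notin> set xs" "(x + 2, y) \<notin> set xs" using clear_iff by auto
  have down: "cedge xs (x, y) (x, y - 1)"
  proof -
    obtain a b where "cedge xs (x, y) a" "cedge xs (x, y) b" "a \<noteq> b" "adj (x, y) a" "adj (x, y) b" "a \<in> set xs" "b \<in> set xs"
      using lpolygon_cedge_cases[OF poly v] .
    moreover have "a = (x, y - 1) \<or> a = (x - 1, y)" "b = (x, y - 1) \<or> b = (x - 1, y)"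
      using calculation up right unfolding adj_iff by blast+
    ultimately show ?thesis by metis
  qed
  consider "cedge xs (x + 1, y - 1) (x + 2, y - 1) \<or> cedge xs (x + 2, y - 1) (x + 3, y - 1)"
    | "\<not> cedge xs (x + 1, y - 1) (x + 2, y - 1)" "\<not> cedge xs (x + 2, y - 1) (x + 3, y - 1)" by blast
  then show ?thesis
  proof cases
    case 1
    then show ?thesis
    proof
      assume "cedge xs (x + 1, y - 1) (x + 2, y - 1)"
      then show ?thesis by (rule open_upward) simp_all
    next
      assume "cedge xs (x + 2, y - 1) (x + 3, y - 1)"
      then show ?thesis by (rule open_upward) simp_all
    qed
  next
    case 2
    have q2: "(x + 2, y - 1) \<notin> set xs"
    proof
      assume "(x + 2, y - 1) \<in> set xs"
      then obtain a b where "cedge xs (x + 2, y - 1) a" "cedge xs (x + 2, y - 1) b" "a \<noteq> b"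
        "adj (x + 2, y - 1) a" "adj (x + 2, y - 1) b" "a \<in> set xs" "b \<in> set xs"
        using lpolygon_cedge_cases[OF poly] by metis
      moreover have "a = (x + 2, y - 2)" "b = (x + 2, y - 2)"
        using calculation 2 right cedge_sym[of xs "(x + 2, y - 1)" "(x + 1, y - 1)"]
        unfolding adj_iff by (auto simp: algebra_simps)
      ultimately show False by simp
    qed
    show ?thesis
    proof (cases "(x + 1, y - 1) \<in> set xs")
      case False
      then show ?thesis using open_downward_edge down q2 by blast
    next
      case True
      then obtain a b where "cedge xs (x + 1, y - 1) a" "cedge xs (x + 1, y - 1) b" "a \<noteq> b"
        "adj (x + 1, y - 1) a" "adj (x + 1, y - 1) b" "a \<in> set xs" "b \<in> set xs"
        using lpolygon_cedge_cases[OF poly] by metis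
      moreover have "a = (x + 1, y - 2) \<or> a = (x, y - 1)" "b = (x + 1, y - 2) \<or> b = (x, y - 1)"
        using calculation q2 right unfolding adj_iff by (auto simp: algebra_simps)
      ultimately have "cedge xs (x, y - 1) (x + 1, y - 1)" using cedge_sym by metis
      then show ?thesis using open_corner down q2 cedge_sym by blast
    qed
  qed
qed

end

text \<open>Reflection in the line between the rows \<open>y\<close> and \<open>y + 1\<close>
  exchanges the two ends of the path, so the path is reversed and the flag of \<open>unopen\<close>
  is negated.\<close>

lemma opened_reflect:
  assumes "opened (map (\<lambda>p. (fst p, 2 * y + 1 - snd p)) xs) x y e P" and len: "4 \<le> length xs"
  shows "\<exists>P. opened xs x y e P"
proof -
  define f :: "pt \<Rightarrow> pt" where "f = (\<lambda>p. (fst p, 2 * y + 1 - snd p))"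
  have ff [simp]: "f (f p) = p" and fst_f [simp]: "fst (f p) = fst p"
    and snd_f [simp]: "snd (f p) = 2 * y + 1 - snd p" for p
    by (simp_all add: f_def)
  have mff [simp]: "map f (map f zs) = zs" for zs by (induction zs) auto
  have inj: "inj f" by (metis ff injI)
  have mem: "q \<in> set (map f zs) \<longleftrightarrow> f q \<in> set zs" for q zs
    by (metis ff image_iff list.set_map)
  have o: "lpath P" "hd P = (e, y)" "last P = (e, y + 1)" "length P = length xs + 8" "x + 3 \<le> e" "e \<le> x + 5"
    and sub: "\<And>p. p \<in> set P \<Longrightarrow> p \<in> set (map f xs) \<or> snd p \<in> {y, y + 1} \<and> x < fst p \<and> fst p \<le> e \<or>
        snd p \<in> {y - 1, y + 2} \<and> x < fst p \<and> fst p \<le> x + 2 \<and> (x, snd p) \<in> set (map f xs)"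
    and sup: "\<And>q. q \<in> set (map f xs) \<Longrightarrow> q \<in> set P \<or> snd q \<in> {y - 1, y + 2}"
    using assms unfolding opened_def f_def[symmetric] by (auto simp del: set_map)
  obtain r c where rc: "c < 3" "dih (map f xs) (unopen r c P)"
    using assms unfolding opened_def f_def[symmetric] by blast
  let ?Q = "rev (map f P)"
  have ne: "P \<noteq> []" using o by auto
  have "lpath (map f P)" using o(1) inj by (subst lpath_map) (auto simp: adj_def)
  then have "lpath ?Q" by simp
  moreover have "hd ?Q = (e, y)" "last ?Q = (e, y + 1)"
    using o ne by (simp_all add: hd_rev last_rev last_map hd_map f_def)
  moreover have "p \<in> set xs \<or> snd p \<in> {y, y + 1} \<and> x < fst p \<and> fst p \<le> e \<or>
        snd p \<in> {y - 1, y + 2} \<and> x < fst p \<and> fst p \<le> x + 2 \<and> (x, snd p) \<in> set xs" if "p \<in> set ?Q" for p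
  proof -
    have "f p \<in> set P" using that mem by simp
    from sub[OF this] show ?thesis unfolding mem by (auto simp: f_def)
  qed
  moreover have "q \<in> set ?Q \<or> snd q \<in> {y - 1, y + 2}" if "q \<in> set xs" for q
  proof -
    have "f q \<in> set (map f xs)" using that by simp
    from sup[OF this] show ?thesis using mem[of q P] by auto
  qed
  moreover have "unopen (\<not> r) c ?Q = map f (unopen r c P)"
  proof -
    have tr: "trim a b (map f zs) = map f (trim a b zs)" for a b zs
      by (simp add: trim_def take_map drop_map)
    have "length (if r then rev P else P) \<ge> 12" using o(4) len by simp
    then have "trim 4 5 (if r then rev P else P) \<noteq> []" by (simp add: trim_def)
    moreover
    have "f p - (1, 0) = f (p - (1, 0))" for p by (simp add: f_def prod_eq_iff)
    from this[of "hd (trim 4 5 P)"] this[of "hd (trim 4 5 (rev P))"] calculation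
    show ?thesis by (auto simp: unopen_def Let_def tr hd_map rev_map)
  qed
  then have "dih xs (unopen (\<not> r) c ?Q)" using dih_map[OF rc(2), of f, unfolded mff] by simp
  ultimately have "opened xs x y e ?Q" unfolding opened_def using o rc(1) by auto
  then show ?thesis by blast
qed

lemma ex_opened:
  assumes "lpolygon xs" "\<And>p. p \<in> set xs \<Longrightarrow> snd p \<in> {y, y + 1} \<Longrightarrow> fst p \<le> x"
    and "(x, y) \<in> set xs \<or> (x, y + 1) \<in> set xs"
  shows "\<exists>e P. opened xs x y e P"
proof (cases "(x, y) \<in> set xs")
  case True
  then show ?thesis using assms open_vertical_edge open_lower by blast
next
  case False
  \<comment> \<open>After reflection \<open>(x, y)\<close> is occupied and \<open>(x, y + 1)\<close>
    is not, so there is no upward edge at \<open>(x, y)\<close>.\<close>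
  define f :: "pt \<Rightarrow> pt" where "f = (\<lambda>p. (fst p, 2 * y + 1 - snd p))"
  have "inj f" by (auto simp: f_def inj_on_def prod_eq_iff)
  then have "lpolygon (map f xs)" using assms(1)
    by (subst lpolygon_map) (auto simp: f_def adj_def)
  moreover have "fst p \<le> x" if "p \<in> set (map f xs)" "snd p \<in> {y, y + 1}" for p
    using that assms(2) by (auto simp: f_def)
  moreover have "(x, y) \<in> set (map f xs)"
    using False assms(3) by (auto simp: f_def image_iff intro!: bexI[of _ "(x, y + 1)"])
  moreover have "(x, y + 1) \<notin> set (map f xs)"
    using False by (auto simp: f_def image_iff)
  then have "\<not> cedge (map f xs) (x, y) (x, y + 1)"
    using cedge_mem by blast
  ultimately have "\<exists>e P. opened (map f xs) x y e P" by (rule open_lower)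
  then show ?thesis using opened_reflect assms(1) unfolding f_def lpolygon_def by blast
qed

section \<open>Joining two polygons\<close>

definition mirror :: "pt list \<Rightarrow> pt list" where
  "mirror = map (\<lambda>p. (- fst p, snd p))"

text \<open>A neck \<open>(i, k)\<close> of \<open>xs\<close> is a place where \<open>xs\<close> splits into the vertices with index in
  \<open>{i..<k}\<close>, which contain the top vertex, and the remaining ones, which contain the bottom vertex
  \<open>xs ! 0\<close>. The first part lies to the right of the second one in every row, and the two edges
  between the parts are opposite sides of a unit square.\<close>

definition necks :: "pt list \<Rightarrow> (nat \<times> nat) set" where
  "necks xs = {(i, k). 2 \<le> i \<and> i < k \<and> k < length xs \<and>
     xs ! i = xs ! (i - 1) + (1, 0) \<and> xs ! (k - 1) = xs ! k + (1, 0) \<and>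
     (xs ! k = xs ! (i - 1) + (0, 1) \<or> xs ! k = xs ! (i - 1) - (0, 1)) \<and>
     (\<forall>a<length xs. \<forall>b. (a < i \<or> k \<le> a) \<longrightarrow> i \<le> b \<longrightarrow> b < k \<longrightarrow>
        snd (xs ! a) = snd (xs ! b) \<longrightarrow> fst (xs ! a) < fst (xs ! b)) \<and>
     (\<exists>t. i < t \<and> t < k - 1 \<and> (\<forall>a<length xs. low (xs ! a) (xs ! t)))}"

definition left_part :: "pt list \<Rightarrow> nat \<times> nat \<Rightarrow> pt list" where
  "left_part xs = (\<lambda>(i, k). drop k xs @ take i xs)"

definition right_part :: "pt list \<Rightarrow> nat \<times> nat \<Rightarrow> pt list" where
  "right_part xs = (\<lambda>(i, k). drop i (take k xs))"

section \<open>Discrete continuity of the row coordinate\<close>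

lemma path_misses_row:
  assumes "successively adj xs" "\<And>p. p \<in> set xs \<Longrightarrow> snd p \<noteq> s"
  shows "(\<forall>p\<in>set xs. snd p < s) \<or> (\<forall>p\<in>set xs. snd p > s)"
  using assms
proof (induction xs rule: induct_list012)
  case (3 x y zs)
  have "adj x y" "snd x \<noteq> s" "snd y \<noteq> s" using "3.prems" by auto
  then have "snd x < s \<longleftrightarrow> snd y < s" by (auto simp: adj_def)
  moreover have "(\<forall>p\<in>set (y # zs). snd p < s) \<or> (\<forall>p\<in>set (y # zs). snd p > s)"
    using 3 by auto
  ultimately show ?case using \<open>snd x \<noteq> s\<close> \<open>snd y \<noteq> s\<close> by auto
qed auto

lemma path_meets_row:
  assumes "successively adj xs" "p \<in> set xs" "q \<in> set xs" "snd p \<le> s" "s \<le> snd q"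
  shows "\<exists>r\<in>set xs. snd r = s"
  using path_misses_row[OF assms(1), of s] assms by fastforce

lemma ex_high:
  assumes "finite S" "S \<noteq> {}"
  shows "\<exists>p\<in>S. \<forall>q\<in>S. low q p"
  using assms
proof (induction rule: finite_ne_induct)
  case (insert a F)
  then obtain p where "p \<in> F" "\<forall>q\<in>F. low q p" by blast
  then show ?case by (cases "low a p") (auto simp: low_def)+
qed (auto simp: low_def)

lemma unopen_rev: "unopen (\<not> r) c (rev P) = unopen r c P"
  by (simp add: unopen_def)

lemma unopen_translate:
  assumes "12 \<le> length P"
  shows "unopen r c (translate w P) = translate w (unopen r c P)"
proof -
  have tr: "trim a b (map f zs) = map f (trim a b zs)" for a b zs and f :: "pt \<Rightarrow> pt"
    by (simp add: trim_def take_map drop_map)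
  have ne: "trim 4 5 P \<noteq> []" "trim 4 5 (rev P) \<noteq> []" using assms by (simp_all add: trim_def)
  have "rev (translate w P) = translate w (rev P)" by (simp add: rev_map)
  then show ?thesis using ne by (auto simp: unopen_def Let_def tr hd_map add_diff_eq)
qed

text \<open>The distance to be kept is measured between vertices whose rows differ by at most one, and not
  only within rows. At a closest such pair there are two adjacent rows that are free between
  the polygons, and the two surgeries do not interfere.\<close>

lemma exists_join:
  assumes A: "xs \<in> polygons j" and B: "ys \<in> polygons k"
    and s: "3 \<le> s" "s \<le> Max (snd ` set xs)" "Max (snd ` set xs) + 3 \<le> s + Max (snd ` set ys)"
  shows "\<exists>zs\<in>polygons (j + k + 16). \<exists>nk\<in>necks zs.
     (\<exists>r. \<exists>c<3. dih xs (unopen r c (left_part zs nk))) \<and>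
     (\<exists>a r. \<exists>c<3. dih (translate (a, s) ys) (mirror (unopen r c (mirror (right_part zs nk)))))"
proof -
  note xs = polygonsD[OF A] and ys = polygonsD[OF B]
  define h h' where "h = Max (snd ` set xs)" and "h' = Max (snd ` set ys)"
  define Q where "Q = translate (0, s) ys"
  have xs_low: "0 \<le> snd p \<and> snd p \<le> h \<and> low 0 p" if "p \<in> set xs" for p
  proof -
    have "low 0 p" using that xs(3,4) by (auto simp: min_first_def)
    moreover have "snd p \<le> h" using that by (simp add: h_def)
    ultimately show ?thesis by (auto simp: low_def)
  qed
  have ys_low: "0 \<le> snd p \<and> snd p \<le> h'" if "p \<in> set ys" for p
  proof -
    have "low 0 p" using that ys(3,4) by (auto simp: min_first_def)
    moreover have "snd p \<le> h'" using that by (simp add: h'_def)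
    ultimately show ?thesis by (auto simp: low_def)
  qed
  have Q_low: "s \<le> snd p \<and> snd p \<le> s + h'" if p: "p \<in> set Q" for p
  proof -
    obtain q where "q \<in> set ys" "p = (0, s) + q" using p by (auto simp: Q_def)
    then show ?thesis using ys_low[of q] by simp
  qed
  have "h \<in> snd ` set xs" "h' \<in> snd ` set ys"
    unfolding h_def h'_def using xs ys by (intro Max_in; simp)+
  then obtain p1 p2 where p1: "p1 \<in> set xs" "snd p1 = h" and p2: "p2 \<in> set ys" "snd p2 = h'" by auto
  have zero: "0 \<in> set xs" "0 \<in> set ys" using hd_in_set[of xs] hd_in_set[of ys] xs(3,5) ys(3,5) by auto
  have sQ: "(0, s) \<in> set Q" using imageI[OF zero(2), of "(+) (0, s)"] by (simp add: Q_def)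
  obtain p0 where p0: "p0 \<in> set xs" "snd p0 = s"
    using path_meets_row[of xs 0 p1 s] xs zero p1 s by (auto simp: lpath_def h_def)
  define D where "D = {(a, b). a \<in> set xs \<and> b \<in> set Q \<and> \<bar>snd a - snd b\<bar> \<le> 1}"
  have "finite D" by (rule finite_subset[of _ "set xs \<times> set Q"]) (auto simp: D_def)
  moreover have "(p0, (0, s)) \<in> D" using p0 sQ by (simp add: D_def)
  ultimately obtain m where m: "is_arg_min (\<lambda>(a, b). fst b - fst a) (\<lambda>z. z \<in> D) m"
    using ex_is_arg_min_if_finite[of D "\<lambda>(a, b). fst b - fst a"] by blast
  obtain a b where ab': "m = (a, b)" by (cases m)
  have ab: "(a, b) \<in> D" using m unfolding is_arg_min_linorder ab' by simp
  have min: "fst b - fst a \<le> fst b' - fst a'" if "(a', b') \<in> D" for a' b'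
  proof -
    have "\<forall>z. z \<in> D \<longrightarrow> (case (a, b) of (a, b) \<Rightarrow> fst b - fst a) \<le> (case z of (a, b) \<Rightarrow> fst b - fst a)"
      using m unfolding is_arg_min_linorder ab' by blast
    from this[rule_format, OF that] show ?thesis by simp
  qed
  \<comment> \<open>Both rows \<open>y\<close> and \<open>y + 1\<close> are within distance one of
    the rows of \<open>a\<close> and of \<open>b\<close>. Minimality therefore keeps the first
    polygon to columns up to \<open>x\<close> and the second one to columns from \<open>x'\<close>
    in both of these rows.\<close>
  define x x' y where "x = fst a" and "x' = fst b" and "y = min (snd a) (snd b)"
  have a: "a \<in> set xs" and b: "b \<in> set Q" and near: "\<bar>snd a - snd b\<bar> \<le> 1" using ab by (auto simp: D_def)
  have gap: "x' - x \<le> fst b' - fst a'" if "a' \<in> set xs" "b' \<in> set Q" "\<bar>snd a' - snd b'\<bar> \<le> 1" for a' b'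
    using min[of a' b'] that by (simp add: D_def x_def x'_def)
  have y: "s - 1 \<le> y" "y \<le> h" "snd a \<in> {y, y + 1}" "snd b \<in> {y, y + 1}"
    using near xs_low[OF a] Q_low[OF b] by (auto simp: y_def)

  have "fst p \<le> x" if "p \<in> set xs" "snd p \<in> {y, y + 1}" for p
    using gap[OF that(1) b] that(2) y(4) by (auto simp: x'_def)
  moreover have "(x, y) \<in> set xs \<or> (x, y + 1) \<in> set xs"
  proof -
    have "(x, snd a) \<in> set xs" using a by (simp add: x_def)
    then show ?thesis using y(3) by auto
  qed
  ultimately obtain e P where P: "opened xs x y e P" using ex_opened[OF xs(1), of y x] by blast

  define Qm where "Qm = mirror Q"
  have mem_Qm: "p \<in> set Qm \<longleftrightarrow> (- fst p, snd p) \<in> set Q" for p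
    by (force simp: Qm_def mirror_def image_iff)
  have "lpolygon Q" using ys by (simp add: Q_def)
  then have "lpolygon Qm" unfolding Qm_def mirror_def
    by (subst lpolygon_map) (auto simp: adj_def inj_on_def)
  moreover have "fst p \<le> - x'" if "p \<in> set Qm" "snd p \<in> {y, y + 1}" for p
    using gap[of a "(- fst p, snd p)"] that y(3) a by (auto simp: mem_Qm x_def)
  moreover have "(- x', y) \<in> set Qm \<or> (- x', y + 1) \<in> set Qm"
  proof -
    have "(x', snd b) \<in> set Q" using b by (simp add: x'_def)
    then show ?thesis using y(4) by (auto simp: mem_Qm)
  qed
  ultimately obtain e' P' where P': "opened Qm (- x') y e' P'"
    using ex_opened[of Qm y "- x'"] by blast

  \<comment> \<open>The second half is \<open>P'\<close> mirrored back and shifted so that its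
    strands end in column \<open>e + 1\<close>, next to the ends of \<open>P\<close>.\<close>
  define T where "T = e + 1 + e'"
  define g :: "pt \<Rightarrow> pt" where "g = (\<lambda>p. (T - fst p, snd p))"
  define R where "R = rev (map g P')"
  have e: "x + 3 \<le> e" "- x' + 3 \<le> e'" and PP: "lpath P" "hd P = (e, y)" "last P = (e, y + 1)" "length P = j + 8"
    and PP': "lpath P'" "hd P' = (e', y)" "last P' = (e', y + 1)" "length P' = k + 8"
    using P P' xs ys by (auto simp: opened_def Qm_def mirror_def Q_def)
  have P_sub: "p \<in> set xs \<or> snd p \<in> {y, y + 1} \<and> x < fst p \<and> fst p \<le> e \<or>
        snd p \<in> {y - 1, y + 2} \<and> x < fst p \<and> fst p \<le> x + 2 \<and> (x, snd p) \<in> set xs" if "p \<in> set P" for p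
    using P that unfolding opened_def by blast
  have P_sup: "q \<in> set P \<or> snd q \<in> {y - 1, y + 2}" if "q \<in> set xs" for q
    using P that unfolding opened_def by blast
  have mem_R: "p \<in> set R \<longleftrightarrow> (T - fst p, snd p) \<in> set P'" for p
    by (force simp: R_def g_def image_iff)
  have R_sub: "(fst p - T, snd p) \<in> set Q \<or> snd p \<in> {y, y + 1} \<and> e + 1 \<le> fst p \<or>
        snd p \<in> {y - 1, y + 2} \<and> x' + T - 2 \<le> fst p \<and> (x', snd p) \<in> set Q" if "p \<in> set R" for p
  proof -
    have *: "(T - fst p, snd p) \<in> set P'" using that mem_R by simp
    have "\<forall>q\<in>set P'. q \<in> set Qm \<or> snd q \<in> {y, y + 1} \<and> - x' < fst q \<and> fst q \<le> e' \<or>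
        snd q \<in> {y - 1, y + 2} \<and> - x' < fst q \<and> fst q \<le> - x' + 2 \<and> (- x', snd q) \<in> set Qm"
      using P' unfolding opened_def by blast
    from bspec[OF this *] show ?thesis by (auto simp: mem_Qm T_def)
  qed
  have R_sup: "(fst q + T, snd q) \<in> set R \<or> snd q \<in> {y - 1, y + 2}" if "q \<in> set Q" for q
  proof -
    have "\<forall>q\<in>set Qm. q \<in> set P' \<or> snd q \<in> {y - 1, y + 2}" using P' unfolding opened_def by blast
    moreover have "(- fst q, snd q) \<in> set Qm" using that by (simp add: mem_Qm)
    ultimately show ?thesis by (auto simp: mem_R)
  qed
  \<comment> \<open>The closest pair is now at least 7 columns apart, so the detours in the rows
    \<open>y - 1\<close> and \<open>y + 2\<close>, at most two columns wide on either side, cannot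
    meet.\<close>
  have wide: "x' + T - x \<ge> 7" using e by (simp add: T_def)
  have clear_x: "fst p \<le> x" if "p \<in> set xs" "snd p \<in> {y, y + 1}" for p
    using gap[OF that(1) b] that(2) y(4) by (auto simp: x'_def)
  have clear_x': "x' \<le> fst p" if "p \<in> set Q" "snd p \<in> {y, y + 1}" for p
    using gap[OF a that(1)] that(2) y(3) by (auto simp: x_def)
  have sep: "fst p < fst q" if p: "p \<in> set P" and q: "q \<in> set R" and pq: "snd p = snd q" for p q
  proof -
    from P_sub[OF p] consider "p \<in> set xs" | "snd p \<in> {y, y + 1}" "fst p \<le> e"
      | "snd p \<in> {y - 1, y + 2}" "fst p \<le> x + 2" "(x, snd p) \<in> set xs" by blast
    then show ?thesis
    proof cases
      case 1
      from R_sub[OF q] show ?thesis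
        using gap[OF 1, of "(fst q - T, snd q)"] gap[OF 1, of "(x', snd q)"] clear_x[OF 1] pq wide e by auto
    next
      case 2
      from R_sub[OF q] show ?thesis
        using clear_x'[of "(fst q - T, snd q)"] 2 pq wide e by (auto simp: T_def)
    next
      case 3
      from R_sub[OF q] show ?thesis
        using gap[OF 3(3), of "(fst q - T, snd q)"] 3 pq wide by auto
    qed
  qed
  have "lpath (map g P')" using PP'(1)
    by (subst lpath_map) (auto simp: g_def adj_def inj_on_def)
  then have lR: "lpath R" by (simp add: R_def)
  have P'ne: "P' \<noteq> []" using PP' by auto
  have R_ends: "hd R = (e + 1, y + 1)" "last R = (e + 1, y)" "length R = k + 8"
    using PP' P'ne by (auto simp: R_def hd_rev last_rev last_map hd_map g_def T_def)
  have ne: "P \<noteq> []" "R \<noteq> []" using PP R_ends by auto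
  have disj: "set P \<inter> set R = {}" using sep by fastforce
  have poly: "lpolygon (P @ R)"
    using PP lR R_ends ne disj by (auto simp: lpolygon_def lpath_append_iff adj_def)

  \<comment> \<open>Because of \<open>3 \<le> s\<close> the surgery takes place strictly above row
    0. The origin survives in \<open>P\<close> and remains the lowest vertex.\<close>
  have y1: "y - 1 \<ge> 1" using y s by simp
  have "0 \<in> set P" using P_sup[OF zero(1)] y1 by auto
  then obtain A2 A1' where A12: "P = A2 @ 0 # A1'" by (meson split_list)
  define A1 where "A1 = 0 # A1'"
  have P_eq: "P = A2 @ A1" using A12 A1_def by simp
  have "A1' \<noteq> []" using PP(3) A12 y1 by (auto simp: zero_prod_def)
  then have lenA1: "length A1 \<ge> 2" by (cases A1') (auto simp: A1_def)
  have A2: "A2 \<noteq> []" using PP(2) A12 y1 by (auto simp: zero_prod_def)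
  \<comment> \<open>Starting at the origin wraps \<open>P\<close> around the end of the list;
    \<open>left_part\<close> puts its two pieces together again.\<close>
  define zs where "zs = A1 @ R @ A2"
  define nk where "nk = (length A1, length A1 + length R)"
  have "zs = rotate (length A2) (P @ R)" unfolding zs_def P_eq
    using rotate_append[of A2 "A1 @ R"] by simp
  then have pz: "lpolygon zs" using poly by simp
  have hz: "hd zs = 0" by (simp add: zs_def A1_def)
  have set_zs: "set zs = set P \<union> set R" by (auto simp: zs_def P_eq)
  have low_zs: "low 0 p" if "p \<in> set zs" for p
  proof -
    have "p \<in> set xs \<or> snd p > 0"
      using that P_sub[of p] R_sub[of p] Q_low[of "(fst p - T, snd p)"] y1 s by (auto simp: set_zs)
    then show ?thesis using xs_low[of p] by (auto simp: low_def)
  qed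
  have "zs \<in> polygons (j + k + 16)"
    using pz hz low_zs PP R_ends by (auto simp: polygons_def min_first_def zs_def P_eq)
  moreover have "nk \<in> necks zs"
  proof -
    have nth1: "zs ! n \<in> set P" if "n < length zs" "n < length A1 \<or> length A1 + length R \<le> n" for n
      using that by (auto simp: zs_def P_eq nth_append)
    have nth2: "zs ! n \<in> set R" if "length A1 \<le> n" "n < length A1 + length R" for n
      using that by (auto simp: zs_def nth_append)
    have l1: "zs ! (length A1 - 1) = (e, y + 1)"
      using PP(3) lenA1 last_conv_nth[of A1] by (cases "A1 = []") (auto simp: zs_def P_eq nth_append)
    have l2: "zs ! length A1 = (e + 1, y + 1)"
      using R_ends ne by (simp add: zs_def nth_append hd_conv_nth)
    have l3: "zs ! (length A1 + length R - 1) = (e + 1, y)"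
      using R_ends ne by (auto simp: zs_def nth_append last_conv_nth Suc_leI)
    have l4: "zs ! (length A1 + length R) = (e, y)"
      using PP(2) A2 by (simp add: zs_def P_eq nth_append hd_conv_nth)
    obtain tp where tp: "tp \<in> set zs" "\<forall>q\<in>set zs. low q tp"
      using ex_high[of "set zs"] pz by (fastforce simp: lpolygon_def)
    have "(fst p2, s + h') \<in> set Q" using imageI[OF p2(1), of "(+) (0, s)"] p2(2) by (cases p2) (simp add: Q_def)
    from R_sup[OF this] have "(fst p2 + T, s + h') \<in> set zs"
      using y s by (auto simp: set_zs h_def h'_def)
    \<comment> \<open>The top row of the shifted second polygon lies above row \<open>y + 2\<close>,
      so the surgery leaves it alone, and above the whole of \<open>P\<close>. Hence the top vertex
      lies on \<open>R\<close>, and not at an end of it.\<close>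
    then have tph: "snd tp \<ge> h + 3" using tp(2) s by (fastforce simp: low_def h_def h'_def)
    have "tp \<notin> set P" using P_sub[of tp] xs_low[of tp] tph y by auto
    then have "tp \<in> set R" using tp set_zs by auto
    then obtain n where n: "n < length R" "R ! n = tp" by (auto simp: in_set_conv_nth)
    define t where "t = length A1 + n"
    have t: "zs ! t = tp" using n by (simp add: t_def zs_def nth_append)
    have "t \<noteq> length A1" "t \<noteq> length A1 + length R - 1"
      using l2 l3 t tph y by auto
    then have "length A1 < t \<and> t < length A1 + length R - 1" using n by (auto simp: t_def)
    moreover have "\<forall>n<length zs. low (zs ! n) (zs ! t)" using tp t by simp
    ultimately have top: "\<exists>t. length A1 < t \<and> t < length A1 + length R - 1 \<and> (\<forall>n<length zs. low (zs ! n) (zs ! t))"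
      by blast
    have "length A1 + length R < length zs" using A2 by (simp add: zs_def)
    then show ?thesis
      unfolding necks_def nk_def using lenA1 ne sep nth1 nth2 l1 l2 l3 l4 top by auto
  qed
  moreover have "left_part zs nk = P" by (simp add: left_part_def nk_def zs_def P_eq)
  moreover have "right_part zs nk = R" by (simp add: right_part_def nk_def zs_def)
  moreover have "\<exists>r. \<exists>c<3. dih xs (unopen r c P)" using P unfolding opened_def by blast
  moreover have "\<exists>a r. \<exists>c<3. dih (translate (a, s) ys) (mirror (unopen r c (mirror R)))"
  proof -
    obtain r c where rc: "c < 3" "dih Qm (unopen r c P')" using P' unfolding opened_def by blast
    have m: "mirror R = rev (translate (- T, 0) P')"
      by (simp add: mirror_def R_def g_def rev_map prod_eq_iff)
    have "unopen (\<not> r) c (mirror R) = translate (- T, 0) (unopen r c P')"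
      unfolding m unopen_rev using PP'(4) ys(8) by (intro unopen_translate) simp
    moreover have "mirror (translate (- T, 0) Qm) = translate (T, s) ys"
      by (simp add: mirror_def Qm_def Q_def prod_eq_iff)
    ultimately have "dih (translate (T, s) ys) (mirror (unopen (\<not> r) c (mirror R)))"
      using dih_map[OF dih_map[OF rc(2), of "(+) (- T, 0)"], of "\<lambda>p. (- fst p, snd p)"]
      by (simp add: mirror_def)
    then show ?thesis using rc(1) by blast
  qed
  ultimately show ?thesis by metis
qed

section \<open>Exchanging strands at necks\<close>

text \<open>\<open>swapped us ls S vs ws\<close>: the strands \<open>us\<close> and \<open>ls\<close> exchange their tails at every pair of
  vertices in \<open>S\<close>; both new strands pass through both vertices of the pair.\<close>

inductive swapped :: "pt list \<Rightarrow> pt list \<Rightarrow> (pt \<times> pt) set \<Rightarrow> pt list \<Rightarrow> pt list \<Rightarrow> bool" where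
  none: "swapped us ls {} us ls"
| swap: "us \<noteq> [] \<Longrightarrow> ls \<noteq> [] \<Longrightarrow> (b, d) \<notin> S \<Longrightarrow> swapped (b # us') (d # ls') S vs ws \<Longrightarrow>
    swapped (us @ b # us') (ls @ d # ls') (insert (b, d) S) (us @ b # ws) (ls @ d # vs)"

lemma swapped_set:
  "swapped us ls S vs ws \<Longrightarrow> set vs \<union> set ws \<subseteq> set us \<union> set ls \<and> finite S \<and>
     S \<subseteq> set us \<times> set ls"
proof (induction rule: swapped.induct)
  case (swap us ls b d S us' ls' vs ws)
  then have "set vs \<subseteq> set (b # us') \<union> set (d # ls')" "set ws \<subseteq> set (b # us') \<union> set (d # ls')"
    "S \<subseteq> set (b # us') \<times> set (d # ls')" "finite S" by blast+
  then show ?case by (simp add: subset_iff) blast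
qed simp

lemma swapped_hd:
  assumes "swapped us ls S vs ws" "us \<noteq> []" "ls \<noteq> []"
  shows "vs \<noteq> [] \<and> ws \<noteq> [] \<and> hd vs = hd us \<and> hd ws = hd ls"
  using assms by (cases rule: swapped.cases) (auto simp: hd_append)

text \<open>After crossing from \<open>b\<close> to \<open>d\<close> a new strand must not return to
  \<open>b\<close>. This holds because the next exchange has nonempty pieces before it and thus
  happens strictly later on both strands.\<close>

lemma swapped_hd_notin:
  assumes "swapped us ls S vs ws" "distinct (us @ ls)" "us \<noteq> []" "ls \<noteq> []"
  shows "hd us \<notin> set ws \<and> hd ls \<notin> set vs"
  using assms(1)
proof cases
  case none
  then show ?thesis using assms by (cases us; cases ls) auto
next
  case (swap us1 ls1 b d S1 us' ls' vs1 ws1)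
  then have "set vs1 \<union> set ws1 \<subseteq> set (b # us') \<union> set (d # ls')" using swapped_set by blast
  then show ?thesis using swap assms by (cases us1; cases ls1) auto
qed

text \<open>At an exchange each new strand visits both \<open>b\<close> and \<open>d\<close>, which
  gives one additional vertex on each of them.\<close>

lemma swapped_length:
  "swapped us ls S vs ws \<Longrightarrow> length vs + length ws = length us + length ls + 2 * card S"
proof (induction rule: swapped.induct)
  case (swap us ls b d S us' ls' vs ws)
  then have "finite S" using swapped_set by blast
  then show ?case using swap by simp
qed simp

lemma swapped_distinct:
  "swapped us ls S vs ws \<Longrightarrow> distinct (us @ ls) \<Longrightarrow> distinct vs \<and> distinct ws"
proof (induction rule: swapped.induct)
  case (swap us ls b d S us' ls' vs ws)
  have sub: "set vs \<union> set ws \<subseteq> set (b # us') \<union> set (d # ls')" using swap swapped_set by blast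
  have "hd (b # us') \<notin> set ws \<and> hd (d # ls') \<notin> set vs"
    using swap.hyps swap.prems by (intro swapped_hd_notin) auto
  then show ?case using swap.IH swap.prems sub by auto
qed simp

lemma swapped_adj:
  "swapped us ls S vs ws \<Longrightarrow> successively adj (us @ [r]) \<Longrightarrow> successively adj (ls @ [r]) \<Longrightarrow>
     \<forall>(b, d)\<in>S. adj b d \<Longrightarrow> successively adj (vs @ [r]) \<and> successively adj (ws @ [r])"
proof (induction rule: swapped.induct)
  case (swap us ls b d S us' ls' vs ws)
  have ne: "vs \<noteq> [] \<and> ws \<noteq> [] \<and> hd vs = b \<and> hd ws = d" using swapped_hd[OF swap.hyps(4)] by simp
  have 1: "successively adj (us @ [b])" "successively adj ((b # us') @ [r])"
    using swap.prems(1) by (auto simp: successively_append_iff)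
  have 2: "successively adj (ls @ [d])" "successively adj ((d # ls') @ [r])"
    using swap.prems(2) by (auto simp: successively_append_iff)
  have IH: "successively adj (vs @ [r])" "successively adj (ws @ [r])"
    using swap.IH 1 2 swap.prems(3) by auto
  have bd: "adj b d" "adj d b" using swap.prems(3) adj_sym by auto
  have "successively adj ((us @ [b]) @ (ws @ [r]))"
    unfolding successively_append_iff[of _ "us @ [b]"] using 1 IH ne bd by auto
  moreover have "successively adj ((ls @ [d]) @ (vs @ [r]))"
    unfolding successively_append_iff[of _ "ls @ [d]"] using 2 IH ne bd by auto
  ultimately show ?case by simp
qed simp

lemma append_unique:
  assumes "us @ b # ws = us' @ b' # ws'" "set us \<inter> X = {}" "set us' \<inter> X = {}" "b \<in> X" "b' \<in> X"
  shows "us = us' \<and> b = b' \<and> ws = ws'"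
proof -
  have 1: "takeWhile (\<lambda>z. z \<notin> X) (us @ b # ws) = us"
    using assms(2,4) by (subst takeWhile_append2) auto
  have 2: "takeWhile (\<lambda>z. z \<notin> X) (us' @ b' # ws') = us'"
    using assms(3,5) by (subst takeWhile_append2) auto
  have "us = us'" using 1 2 unfolding assms(1) by (rule subst)
  then show ?thesis using assms(1) by simp
qed

text \<open>The first vertex of \<open>vs\<close> that also lies on \<open>ws\<close> marks the first exchange.\<close>

lemma swapped_inj:
  assumes "swapped us ls S vs ws" "swapped us' ls' S' vs ws"
    and "distinct (us @ ls)" "distinct (us' @ ls')"
  shows "us = us' \<and> ls = ls' \<and> S = S'"
  using assms
proof (induction arbitrary: us' ls' S' rule: swapped.induct)
  case (none us ls)
  from none(1) show ?case
  proof cases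
    case (swap us1 ls1 b d S1 us2 ls2 vs1 ws1)
    then have "vs1 \<noteq> []" "hd vs1 = b" using swapped_hd[OF swap(9)] by auto
    then have "b \<in> set vs1" using hd_in_set[of vs1] by auto
    then show ?thesis using none swap by auto
  qed simp
next
  case (swap us ls b d S us2 ls2 vs ws)
  note outer = swap.hyps swap.prems and IH = swap.IH
  have h: "vs \<noteq> []" "ws \<noteq> []" "hd vs = b" "hd ws = d" using swapped_hd[OF swap.hyps(4)] by auto
  have bv: "b \<in> set vs" "d \<in> set ws" using h hd_in_set[of vs] hd_in_set[of ws] by auto
  have sub: "set vs \<union> set ws \<subseteq> set (b # us2) \<union> set (d # ls2)" using swap.hyps(4) swapped_set by blast
  have dist: "distinct ((us @ b # us2) @ ls @ d # ls2)" using swap.prems by blast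
  from swap.prems(1) show ?case
  proof cases
    case none
    then have "distinct ((us @ b # ws) @ ls @ d # vs)" using outer(7) by simp
    then show ?thesis using bv by auto
  next
    case (swap us1 ls1 b1 d1 S1 us3 ls3 vs1 ws1)
    note inner = this
    have h1: "vs1 \<noteq> []" "ws1 \<noteq> []" "hd vs1 = b1" "hd ws1 = d1" using swapped_hd[OF inner(9)] by auto
    have bv1: "b1 \<in> set vs1" "d1 \<in> set ws1" using h1 hd_in_set[of vs1] hd_in_set[of ws1] by auto
    have sub1: "set vs1 \<union> set ws1 \<subseteq> set (b1 # us3) \<union> set (d1 # ls3)" using inner(9) swapped_set by blast
    have dist1: "distinct ((us1 @ b1 # us3) @ ls1 @ d1 # ls3)" using outer(7) inner(1,2) by simp
    have eqV: "us @ b # ws = us1 @ b1 # ws1" and eqW: "ls @ d # vs = ls1 @ d1 # vs1"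
      using inner(4,5) by simp_all
    have 1: "us = us1 \<and> b = b1 \<and> ws = ws1"
    proof (rule append_unique[OF eqV])
      show "set us \<inter> set (ls @ d # vs) = {}" using sub dist by auto
      show "set us1 \<inter> set (ls @ d # vs) = {}" unfolding eqW using sub1 dist1 by auto
      show "b \<in> set (ls @ d # vs)" using bv by simp
      show "b1 \<in> set (ls @ d # vs)" unfolding eqW using bv1 by simp
    qed
    have 2: "ls = ls1 \<and> d = d1 \<and> vs = vs1"
    proof (rule append_unique[OF eqW])
      show "set ls \<inter> set (us @ b # ws) = {}" using sub dist by auto
      show "set ls1 \<inter> set (us @ b # ws) = {}" unfolding eqV using sub1 dist1 by auto
      show "d \<in> set (us @ b # ws)" using bv by simp
      show "d1 \<in> set (us @ b # ws)" unfolding eqV using bv1 by simp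
    qed
    have "swapped (b # us3) (d # ls3) S1 vs ws" using inner(9) 1 2 by simp
    moreover have "distinct ((b # us2) @ d # ls2)" "distinct ((b # us3) @ d # ls3)"
      using dist dist1 1 2 by auto
    ultimately have "b # us2 = b # us3 \<and> d # ls2 = d # ls3 \<and> S = S1" by (rule IH)
    then show ?thesis using 1 2 inner(1-3) by simp
  qed
qed

section \<open>Nesting of necks\<close>

lemma paths_rows_separated:
  assumes "successively adj us" "successively adj ls" "\<forall>p\<in>set us. \<forall>q\<in>set ls. snd p \<noteq> snd q"
    and "p \<in> set us" "p' \<in> set us" "q \<in> set ls" "q' \<in> set ls" "snd p < snd q"
  shows "snd p' < snd q'"
proof -
  have "\<forall>r\<in>set us. snd r < snd q"
    using path_misses_row[OF assms(1), of "snd q"] assms(3,4,6,8) by (meson order_less_asym)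
  then have "snd p' < snd q" using assms(5) by blast
  then have "\<forall>r\<in>set ls. snd r > snd p'"
    using path_misses_row[OF assms(2), of "snd p'"] assms(3,5,6) by (metis order_less_asym)
  then show ?thesis using assms(7) by blast
qed

lemma successively_take_drop: "successively P xs \<Longrightarrow> successively P (drop i (take k xs))"
  by (metis append_take_drop_id successively_append_iff)

lemma set_drop_take:
  assumes "k \<le> length xs"
  shows "p \<in> set (drop i (take k xs)) \<longleftrightarrow> (\<exists>a. i \<le> a \<and> a < k \<and> p = xs ! a)"
proof
  assume "p \<in> set (drop i (take k xs))"
  then obtain b where "b < k - i" "p = xs ! (i + b)" using assms by (auto simp: in_set_conv_nth)
  then show "\<exists>a. i \<le> a \<and> a < k \<and> p = xs ! a" by (intro exI[of _ "i + b"]) auto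
next
  assume "\<exists>a. i \<le> a \<and> a < k \<and> p = xs ! a"
  then obtain a where "i \<le> a" "a < k" "p = xs ! a" by blast
  then show "p \<in> set (drop i (take k xs))" using assms
    by (auto simp: in_set_conv_nth intro!: exI[of _ "a - i"])
qed

lemma necksD:
  assumes "(i, k) \<in> necks xs"
  shows "2 \<le> i" "i < k" "k < length xs"
    "snd (xs ! i) = snd (xs ! (i - 1))" "fst (xs ! i) = fst (xs ! (i - 1)) + 1"
    "snd (xs ! (k - 1)) = snd (xs ! k)" "fst (xs ! (k - 1)) = fst (xs ! k) + 1"
    "fst (xs ! k) = fst (xs ! (i - 1))"
    "\<bar>snd (xs ! k) - snd (xs ! (i - 1))\<bar> = 1"
    "\<And>a b. a < length xs \<Longrightarrow> a < i \<or> k \<le> a \<Longrightarrow> i \<le> b \<Longrightarrow> b < k \<Longrightarrow> snd (xs ! a) = snd (xs ! b) \<Longrightarrow>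
       fst (xs ! a) < fst (xs ! b)"
  using assms unfolding necks_def by auto

text \<open>The definition of \<open>necks\<close> only provides some top vertex inside the neck. It
  is the same for all necks, since \<open>low\<close> is antisymmetric.\<close>

lemma necks_top:
  assumes "(i, k) \<in> necks xs" "distinct xs" "t < length xs" "\<forall>a<length xs. low (xs ! a) (xs ! t)"
  shows "i < t" "t < k - 1"
proof -
  obtain t' where t': "i < t'" "t' < k - 1" "\<forall>a<length xs. low (xs ! a) (xs ! t')"
    using assms(1) unfolding necks_def by blast
  have "k < length xs" using assms(1) unfolding necks_def by blast
  then have "t' < length xs" using t' by simp
  then have "xs ! t = xs ! t'" using assms(3,4) t'(3) low_antisym by blast
  then have "t = t'" using assms(2,3) \<open>t' < length xs\<close> by (simp add: nth_eq_iff_index_eq)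
  then show "i < t" "t < k - 1" using t' by auto
qed

text \<open>Otherwise the segments between the two necks would lie in disjoint sets of rows, since in a
  common row each neck forces the opposite order of their vertices.\<close>

lemma necks_nested:
  assumes xs: "lpath xs" and 1: "(i, k) \<in> necks xs" and 2: "(i', k') \<in> necks xs"
    and le: "i \<le> i'" "k \<le> k'"
  shows "i = i' \<and> k = k'"
proof (rule ccontr)
  assume ne: "\<not> (i = i' \<and> k = k')"
  note n1 = necksD[OF 1] and n2 = necksD[OF 2]
  have d: "distinct xs" and s: "successively adj xs" using xs by (auto simp: lpath_def)
  obtain t where t: "t < length xs" "\<forall>a<length xs. low (xs ! a) (xs ! t)"
  proof -
    obtain t where "t < k - 1" "\<forall>a<length xs. low (xs ! a) (xs ! t)" using 1 unfolding necks_def by blast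
    then show thesis using n1(3) by (intro that[of t]) auto
  qed
  have t1: "i < t" "t < k - 1" and t2: "i' < t" "t < k' - 1"
    using necks_top[OF 1 d t] necks_top[OF 2 d t] by auto
  let ?U = "drop i (take i' xs)" and ?L = "drop k (take k' xs)"
  have U: "p \<in> set ?U \<longleftrightarrow> (\<exists>a. i \<le> a \<and> a < i' \<and> p = xs ! a)" for p
    using n2(2,3) by (intro set_drop_take) simp
  have L: "p \<in> set ?L \<longleftrightarrow> (\<exists>a. k \<le> a \<and> a < k' \<and> p = xs ! a)" for p
    using n2(3) by (intro set_drop_take) simp
  have memU: "xs ! i \<in> set ?U" "xs ! (i' - 1) \<in> set ?U" if "i < i'"
    using that by (simp_all only: U) (rule exI[of _ i], simp, rule exI[of _ "i' - 1"], simp)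
  have memL: "xs ! k \<in> set ?L" "xs ! (k' - 1) \<in> set ?L" if "k < k'"
    using that by (simp_all only: L) (rule exI[of _ k], simp, rule exI[of _ "k' - 1"], simp)
  have sU: "successively adj ?U" and sL: "successively adj ?L" using s successively_take_drop by auto
  consider "i < i'" "k < k'" | "i = i'" "k < k'" | "i < i'" "k = k'" using le ne by linarith
  then show False
  proof cases
    case 1
    have "snd (xs ! a) \<noteq> snd (xs ! b)" if "i \<le> a" "a < i'" "k \<le> b" "b < k'" for a b
    proof
      assume eq: "snd (xs ! a) = snd (xs ! b)"
      have "fst (xs ! b) < fst (xs ! a)" using n1(10)[of b a] that t1 t2 n2(3) eq by linarith
      moreover have "fst (xs ! a) < fst (xs ! b)" using n2(10)[of a b] that t1 t2 n2(3) eq by linarith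
      ultimately show False by simp
    qed
    then have disj: "\<forall>p\<in>set ?U. \<forall>q\<in>set ?L. snd p \<noteq> snd q" unfolding Ball_def U L by blast
    then have disj': "\<forall>q\<in>set ?L. \<forall>p\<in>set ?U. snd q \<noteq> snd p" by (intro ballI) (metis (no_types))
    note mem = memU[OF 1(1)] memL[OF 1(2)]
    \<comment> \<open>At each neck the two rows are adjacent. As all rows of one segment lie below
      all rows of the other, both necks occupy the same pair of rows.\<close>
    have rows: "snd (xs ! i) = snd (xs ! (i' - 1)) \<and> snd (xs ! k) = snd (xs ! (k' - 1))"
    proof (cases "snd (xs ! i) < snd (xs ! k)")
      case True
      note sep = paths_rows_separated[OF sU sL disj mem(1) _ mem(3) _ True]
      from sep[OF mem(1) mem(4)] sep[OF mem(2) mem(3)] sep[OF mem(2) mem(4)] n1(4,6,9) n2(4,6,9) True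
      show ?thesis by linarith
    next
      case False
      then have F: "snd (xs ! k) < snd (xs ! i)" using n1(4,9) by linarith
      note sep = paths_rows_separated[OF sL sU disj' mem(3) _ mem(1) _ F]
      from sep[OF mem(4) mem(1)] sep[OF mem(3) mem(2)] sep[OF mem(4) mem(2)] n1(4,6,9) n2(4,6,9) F
      show ?thesis by linarith
    qed
    \<comment> \<open>In one row neck 2 puts \<open>i\<close> to the left of \<open>i'\<close>; in
      the other row neck 1 puts \<open>k' - 1\<close> to the left of \<open>k - 1\<close>. But the
      two right-hand vertices of each neck share a column.\<close>
    have "fst (xs ! i) < fst (xs ! i')"
      using n2(10)[of i i'] 1(1) t1 t2 n2(3,4) rows by linarith
    moreover have "fst (xs ! (k' - 1)) < fst (xs ! (k - 1))"
      using n1(10)[of "k' - 1" "k - 1"] 1(2) t1 n2(3) n1(6) rows by linarith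
    ultimately show False using n1(5,7,8) n2(5,7,8) by linarith
  next
    case 2
    have "xs ! k \<noteq> xs ! k'" using 2 d n2(3) by (simp add: nth_eq_iff_index_eq)
    then have opp: "snd (xs ! k) \<noteq> snd (xs ! k')" using n1(8) n2(8) unfolding 2(1) by (metis prod_eqI)
    note mem = memL[OF 2(2)]
    \<comment> \<open>The two necks share their first edge and lie on opposite sides of it, so the
      segment between \<open>k\<close> and \<open>k'\<close> crosses its row. The crossing vertex
      would have to be strictly between the adjacent columns of \<open>i - 1\<close> and
      \<open>i\<close>.\<close>
    obtain r where r: "r \<in> set ?L" "snd r = snd (xs ! (i - 1))"
    proof (cases "snd (xs ! k) < snd (xs ! k')")
      case True
      then have "snd (xs ! k) \<le> snd (xs ! (i - 1))" "snd (xs ! (i - 1)) \<le> snd (xs ! (k' - 1))"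
        using opp n1(9) n2(6,9) unfolding 2(1) by linarith+
      from path_meets_row[OF sL mem this] that show ?thesis by blast
    next
      case False
      then have "snd (xs ! (k' - 1)) \<le> snd (xs ! (i - 1))" "snd (xs ! (i - 1)) \<le> snd (xs ! k)"
        using opp n1(9) n2(6,9) unfolding 2(1) by linarith+
      from path_meets_row[OF sL mem(2,1) this] that show ?thesis by blast
    qed
    then obtain b where b: "k \<le> b" "b < k'" "snd (xs ! b) = snd (xs ! (i - 1))" using L[of r] by auto
    have "fst (xs ! b) < fst (xs ! i)" using b n1(2,4) n2(3) by (intro n1(10)) simp_all
    moreover have "fst (xs ! (i - 1)) < fst (xs ! b)"
      using b n1(1-3) n2(3) 2(1) by (intro n2(10)) simp_all
    ultimately show False using n1(5) by linarith
  next
    case 3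
    have "xs ! (i - 1) \<noteq> xs ! (i' - 1)" using 3 d n1(1-3) n2(1-3) by (simp add: nth_eq_iff_index_eq)
    then have opp: "snd (xs ! (i - 1)) \<noteq> snd (xs ! (i' - 1))" using n1(8) n2(8) unfolding 3(2) by (metis prod_eqI)
    note mem = memU[OF 3(1)]
    \<comment> \<open>The same argument with the shared edge at \<open>k\<close>: the segment from
      \<open>i\<close> to \<open>i' - 1\<close> crosses the row of that edge and would have to do so
      between two adjacent columns.\<close>
    obtain r where r: "r \<in> set ?U" "snd r = snd (xs ! k)"
    proof (cases "snd (xs ! i) < snd (xs ! (i' - 1))")
      case True
      then have "snd (xs ! i) \<le> snd (xs ! k)" "snd (xs ! k) \<le> snd (xs ! (i' - 1))"
        using opp n1(4,9) n2(9) unfolding 3(2)[symmetric] by linarith+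
      from path_meets_row[OF sU mem this] that show ?thesis by blast
    next
      case False
      then have "snd (xs ! (i' - 1)) \<le> snd (xs ! k)" "snd (xs ! k) \<le> snd (xs ! i)"
        using opp n1(4,9) n2(9) unfolding 3(2)[symmetric] by linarith+
      from path_meets_row[OF sU mem(2,1) this] that show ?thesis by blast
    qed
    then obtain a where a: "i \<le> a" "a < i'" "snd (xs ! a) = snd (xs ! k)" using U[of r] by auto
    have "fst (xs ! k) < fst (xs ! a)" using a t1 t2 n1(3) by (intro n1(10)) simp_all
    moreover have "fst (xs ! a) < fst (xs ! (k' - 1))"
      using a t1 t2 n2(3,6) 3(2) by (intro n2(10)) simp_all
    ultimately show False using n2(7) 3(2) by simp
  qed
qed

lemma finite_necks [simp]: "finite (necks xs)"
  by (rule finite_subset[of _ "{..<length xs} \<times> {..<length xs}"]) (auto simp: necks_def)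

lemma card_necks_le: "card (necks xs) \<le> (length xs)\<^sup>2"
proof -
  have "card (necks xs) \<le> card ({..<length xs} \<times> {..<length xs})"
    by (rule card_mono) (auto simp: necks_def)
  then show ?thesis by (simp add: card_cartesian_product power2_eq_square)
qed

section \<open>The encoding of a polygon with marked necks\<close>

text \<open>The right-hand side of the unit square of a neck. Its two vertices are neighbours, and
  they lie on different strands because the top vertex comes between them.\<close>

definition gates :: "pt list \<Rightarrow> (nat \<times> nat) set \<Rightarrow> (pt \<times> pt) set" where
  "gates xs S = (\<lambda>(i, k). (xs ! i, xs ! (k - 1))) ` S"

lemma gates_inj:
  assumes "distinct xs" "S \<subseteq> necks xs" "S' \<subseteq> necks xs" "gates xs S = gates xs S'"
  shows "S = S'"
proof -
  have "inj_on (\<lambda>(i, k). (xs ! i, xs ! (k - 1))) (necks xs)"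
  proof (rule inj_onI, clarsimp)
    fix i k i' k' assume n: "(i, k) \<in> necks xs" "(i', k') \<in> necks xs"
      and "xs ! i = xs ! i'" "xs ! (k - Suc 0) = xs ! (k' - Suc 0)"
    moreover note necksD(2,3)[OF n(1)] necksD(2,3)[OF n(2)]
    ultimately show "i = i' \<and> k = k'" using assms(1) by (auto simp: nth_eq_iff_index_eq)
  qed
  then show ?thesis using assms(2-4) unfolding gates_def by (simp add: inj_on_image_eq_iff)
qed

text \<open>Induction from the outermost neck inwards. The bounds \<open>p\<close> and
  \<open>q\<close> vary because, after the first exchange at \<open>(i, k)\<close>, the remaining
  necks lie strictly between \<open>i\<close> and \<open>k\<close>; this makes the pieces before
  every exchange nonempty.\<close>

lemma exists_swapped:
  assumes xs: "lpath xs" and t: "t < length xs" "\<forall>a<length xs. low (xs ! a) (xs ! t)"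
    and S: "finite S" "S \<subseteq> necks xs" and pq: "\<And>i k. (i, k) \<in> S \<Longrightarrow> p < i \<and> k < q" "q \<le> length xs"
  shows "\<exists>vs ws. swapped (drop p (take t xs)) (rev (drop (Suc t) (take q xs))) (gates xs S) vs ws"
  using S pq
proof (induction "card S" arbitrary: S p q)
  case 0
  then have "S = {}" by simp
  then show ?case using swapped.none by (auto simp: gates_def)
next
  case (Suc m)
  have d: "distinct xs" using xs by (simp add: lpath_def)
  obtain i k where ik: "(i, k) \<in> S" and min: "\<And>i' k'. (i', k') \<in> S \<Longrightarrow> i \<le> i'"
  proof -
    have "S \<noteq> {}" using Suc.hyps(2) by auto
    then have "Min (fst ` S) \<in> fst ` S" using Suc.prems(1) by (intro Min_in) auto
    then obtain z where z: "z \<in> S" "Min (fst ` S) = fst z" by blast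
    have "fst z \<le> i'" if "(i', k') \<in> S" for i' k'
      unfolding z(2)[symmetric] using that Suc.prems(1) by (intro Min_le) force+
    then show thesis using that[of "fst z" "snd z"] z(1) by auto
  qed
  let ?S = "S - {(i, k)}"
  have N: "(i, k) \<in> necks xs" using ik Suc.prems by blast
  \<comment> \<open>By \<open>necks_nested\<close> the neck with the smallest \<open>i\<close> has
    the largest \<open>k\<close>, and both comparisons are strict.\<close>
  have ord: "i < i' \<and> k' < k" if "(i', k') \<in> ?S" for i' k'
  proof -
    have N': "(i', k') \<in> necks xs" and "i \<le> i'" "(i', k') \<noteq> (i, k)" using that Suc.prems min by auto
    then have "\<not> k \<le> k'" using necks_nested[OF xs N N'] by auto
    moreover have "i \<noteq> i'" using necks_nested[OF xs N' N] \<open>\<not> k \<le> k'\<close> \<open>(i', k') \<noteq> (i, k)\<close> by auto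
    ultimately show ?thesis using \<open>i \<le> i'\<close> by simp
  qed
  have tk: "i < t" "t < k - 1" using necks_top[OF N d t] .
  have kl: "k \<le> length xs" using necksD(3)[OF N] by simp
  have "\<exists>vs ws. swapped (drop i (take t xs)) (rev (drop (Suc t) (take k xs))) (gates xs ?S) vs ws"
    using Suc.prems Suc.hyps(2) ord kl ik by (intro Suc.hyps(1)) auto
  moreover have "drop i (take t xs) = xs ! i # drop (Suc i) (take t xs)"
    using tk t by (subst Cons_nth_drop_Suc[symmetric]) auto
  moreover have "rev (drop (Suc t) (take k xs)) = xs ! (k - 1) # rev (drop (Suc t) (take (k - 1) xs))"
  proof -
    have "take k xs = take (k - 1) xs @ [xs ! (k - 1)]"
      using tk kl take_Suc_conv_app_nth[of "k - 1" xs] by simp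
    then show ?thesis using tk kl by simp
  qed
  ultimately obtain vs ws where
    sw: "swapped (xs ! i # drop (Suc i) (take t xs)) (xs ! (k - 1) # rev (drop (Suc t) (take (k - 1) xs))) (gates xs ?S) vs ws"
    and e1: "drop i (take t xs) = xs ! i # drop (Suc i) (take t xs)"
    and e2: "rev (drop (Suc t) (take k xs)) = xs ! (k - 1) # rev (drop (Suc t) (take (k - 1) xs))"
    by auto
  have "(xs ! i, xs ! (k - 1)) \<notin> gates xs ?S"
  proof
    assume "(xs ! i, xs ! (k - 1)) \<in> gates xs ?S"
    then obtain i' k' where "(i', k') \<in> ?S" "xs ! i = xs ! i'" by (auto simp: gates_def)
    moreover from this have "i' < length xs" using necksD(2,3)[of i' k' xs] Suc.prems(2) by auto
    ultimately show False using d ord[of i' k'] kl tk by (simp add: nth_eq_iff_index_eq)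
  qed
  moreover have pk: "p < i" "k < q" using Suc.prems(3) ik by auto
  then have "drop p (take i xs) \<noteq> []" "rev (drop k (take q xs)) \<noteq> []" using tk t Suc.prems(4) by auto
  ultimately have "swapped (drop p (take i xs) @ drop i (take t xs)) (rev (drop k (take q xs)) @ rev (drop (Suc t) (take k xs)))
      (insert (xs ! i, xs ! (k - 1)) (gates xs ?S)) (drop p (take i xs) @ xs ! i # ws) (rev (drop k (take q xs)) @ xs ! (k - 1) # vs)"
    unfolding e1 e2 using sw by (intro swapped.swap)
  moreover have "drop p (take i xs) @ drop i (take t xs) = drop p (take t xs)"
  proof -
    have "take t xs = take i xs @ drop i (take t xs)" using tk
      by (metis append_take_drop_id less_imp_le min.absorb1 take_take)
    then have "drop p (take t xs) = drop p (take i xs @ drop i (take t xs))" by simp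
    then show ?thesis using pk tk t by simp
  qed
  moreover have "rev (drop k (take q xs)) @ rev (drop (Suc t) (take k xs)) = rev (drop (Suc t) (take q xs))"
  proof -
    have "take q xs = take k xs @ drop k (take q xs)" using pk
      by (metis append_take_drop_id less_imp_le min.absorb1 take_take)
    then have "drop (Suc t) (take q xs) = drop (Suc t) (take k xs @ drop k (take q xs))" by simp
    then show ?thesis using pk tk kl by simp
  qed
  moreover have "insert (xs ! i, xs ! (k - 1)) (gates xs ?S) = gates xs S"
    using ik by (auto simp: gates_def)
  ultimately show ?case by auto
qed

lemma swapped_hd_append:
  assumes "swapped us ls S vs ws"
  shows "hd (vs @ [r]) = hd (us @ [r]) \<and> hd (ws @ [r]) = hd (ls @ [r])"
  using assms
proof cases
  case (swap us1 ls1 b d S1 us2 ls2 vs1 ws1)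
  then show ?thesis by (cases us1; cases ls1) auto
qed simp

text \<open>Both strands include the bottom vertex 0 and the top vertex \<open>r\<close>. The number
  stored in \<open>w\<close> is the length of the first strand and tells where the stacked bridge
  has to be cut.\<close>

definition strand_pair :: "pt list \<times> (nat \<times> nat) set \<Rightarrow> nat \<times> pt list \<Rightarrow> bool" where
  "strand_pair z w \<longleftrightarrow> (case z of (xs, S) \<Rightarrow> \<exists>us ls r vs ws.
     xs = 0 # us @ [r] @ rev ls \<and> swapped us ls (gates xs S) vs ws \<and>
     w = (length vs + 2, stack (0 # vs @ [r]) (0 # ws @ [r])))"

lemma strand_pair_inj:
  assumes "strand_pair (xs, S) w" "strand_pair (xs', S') w"
    and "distinct xs" "distinct xs'" "S \<subseteq> necks xs" "S' \<subseteq> necks xs'"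
  shows "(xs, S) = (xs', S')"
proof -
  obtain us ls r vs ws where 1: "xs = 0 # us @ [r] @ rev ls" "swapped us ls (gates xs S) vs ws"
    "w = (length vs + 2, stack (0 # vs @ [r]) (0 # ws @ [r]))"
    using assms(1) unfolding strand_pair_def by auto
  obtain us' ls' r' vs' ws' where 2: "xs' = 0 # us' @ [r'] @ rev ls'" "swapped us' ls' (gates xs' S') vs' ws'"
    "w = (length vs' + 2, stack (0 # vs' @ [r']) (0 # ws' @ [r']))"
    using assms(2) unfolding strand_pair_def by auto
  have len: "length vs = length vs'"
    and st: "stack (0 # vs @ [r]) (0 # ws @ [r]) = stack (0 # vs' @ [r']) (0 # ws' @ [r'])"
    using 1(3) 2(3) by auto
  have "0 # vs @ [r] = 0 # vs' @ [r'] \<and> 0 # ws @ [r] = 0 # ws' @ [r']"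
    using stack_inj[OF st] len by simp
  then have e: "vs = vs'" "ws = ws'" "r = r'" by auto
  have "distinct (us @ ls)" "distinct (us' @ ls')" using assms(3,4) 1(1) 2(1) by auto
  then have u: "us = us' \<and> ls = ls' \<and> gates xs S = gates xs' S'"
    using swapped_inj[of us ls "gates xs S" vs ws us' ls' "gates xs' S'"] 1(2) 2(2) e by simp
  then have "xs = xs'" using 1(1) 2(1) e by simp
  then show ?thesis using gates_inj[of xs S S'] u assms by simp
qed

lemma exists_strand_pair:
  assumes X: "xs \<in> polygons n" and S: "S \<subseteq> necks xs"
  shows "\<exists>w\<in>{..<n + 2 * card S + 2} \<times> bridges (Suc (n + 2 * card S)). strand_pair (xs, S) w"
proof -
  note xs = polygonsD[OF X]
  have S': "finite S" using S finite_necks finite_subset by blast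
  obtain p where p: "p \<in> set xs" "\<forall>q\<in>set xs. low q p" using ex_high[of "set xs"] xs(5) by auto
  then obtain t where t: "t < n" "xs ! t = p" using xs(2) by (auto simp: in_set_conv_nth)
  have top: "\<forall>a<length xs. low (xs ! a) (xs ! t)" using p t by simp
  have bot: "low 0 q" if "q \<in> set xs" for q using xs(3,4) that by (simp add: min_first_def)
  have t0: "t \<noteq> 0"
  proof
    assume "t = 0"
    then have "p = 0" using t xs(3,5) by (simp add: hd_conv_nth)
    then have "q = 0" if "q \<in> set xs" for q using that p(2) bot[OF that] low_antisym[of q 0] by simp
    then have "set xs \<subseteq> {0}" by (simp add: subset_iff)
    then have "card (set xs) \<le> card {0 :: pt}" by (intro card_mono) simp_all
    then show False using xs(2,6,8) by (simp add: distinct_card)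
  qed
  define us where "us = drop 1 (take t xs)"
  define ls where "ls = rev (drop (Suc t) xs)"
  have split: "xs = 0 # us @ [p] @ rev ls"
  proof -
    have "xs = take t xs @ p # drop (Suc t) xs" using t xs(2) id_take_nth_drop[of t xs] by simp
    moreover have "take t xs = 0 # us" using t0 xs(3,5) unfolding us_def by (cases xs; cases t) auto
    ultimately show ?thesis by (simp add: ls_def)
  qed
  have "\<exists>vs ws. swapped (drop 1 (take t xs)) (rev (drop (Suc t) (take (length xs) xs))) (gates xs S) vs ws"
  proof (rule exists_swapped[OF xs(7) _ top S' S])
    show "t < length xs" using t xs by simp
    show "1 < i \<and> k < length xs" if "(i, k) \<in> S" for i k
      using S that necksD(1,3)[of i k xs] by auto
  qed simp
  then obtain vs ws where sw: "swapped us ls (gates xs S) vs ws" unfolding us_def ls_def by auto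
  have d: "distinct (0 # us @ [p] @ rev ls)" "successively adj (0 # us @ [p] @ rev ls)"
    using xs(7) unfolding split[symmetric] by (auto simp: lpath_def)
  have gadj: "\<forall>(b, d)\<in>gates xs S. adj b d"
  proof -
    have "adj (xs ! i) (xs ! (k - 1))" if "(i, k) \<in> S" for i k
    proof -
      have "(i, k) \<in> necks xs" using S that by blast
      from necksD(4-9)[OF this] show ?thesis unfolding adj_def by linarith
    qed
    then show ?thesis by (auto simp: gates_def)
  qed
  have "successively adj ((0 # us @ [p]) @ rev ls)" "successively adj ((0 # us) @ [p] @ rev ls)"
    using d(2) by simp_all
  then have sl: "successively adj (0 # us @ [p])" "successively adj ([p] @ rev ls)"
    unfolding successively_append_iff by blast+
  from sl(1) have a1: "successively adj (us @ [p])" "adj 0 (hd (us @ [p]))"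
    unfolding successively_Cons by simp_all
  have "rev ([p] @ rev ls) = ls @ [p]" by simp
  then have a2: "successively adj (ls @ [p])"
    using sl(2) by (metis successively_rev successively_adj_converse)
  have "adj (last xs) 0" using xs(1,3) by (simp add: lpolygon_def)
  moreover have "last xs = hd (ls @ [p])" using arg_cong[OF split, of last] by (cases ls) simp_all
  ultimately have a3: "adj 0 (hd (ls @ [p]))" using adj_sym by simp
  note hds = swapped_hd_append[OF sw, of p]
  have succ: "successively adj (vs @ [p])" "successively adj (ws @ [p])"
    using swapped_adj[OF sw a1(1) a2 gadj] by auto
  have sv: "successively adj (0 # vs @ [p])"
    using succ(1) a1(2) hds unfolding successively_Cons by simp
  have sw': "successively adj (0 # ws @ [p])"
    using succ(2) a3 hds unfolding successively_Cons by simp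
  have sub: "set vs \<union> set ws \<subseteq> set us \<union> set ls" using swapped_set[OF sw] by blast
  have "distinct (us @ ls)" "0 \<notin> set us \<union> set ls" "p \<notin> set us \<union> set ls" "p \<noteq> 0" using d(1) by auto
  moreover from this have "0 \<notin> set vs" "0 \<notin> set ws" "p \<notin> set vs" "p \<notin> set ws" using sub by blast+
  ultimately have dd: "distinct (0 # vs @ [p])" "distinct (0 # ws @ [p])"
    using swapped_distinct[OF sw] by simp_all
  have rows: "0 \<le> snd q \<and> snd q \<le> snd p" if "q \<in> set xs" for q
    using bot[OF that] p(2) that by (auto simp: low_def)
  have sub': "set (0 # vs @ [p]) \<subseteq> set xs" "set (0 # ws @ [p]) \<subseteq> set xs"
  proof -
    have "set xs = insert 0 (insert p (set us \<union> set ls))"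
      using arg_cong[OF split, of set] by auto
    then show "set (0 # vs @ [p]) \<subseteq> set xs" "set (0 # ws @ [p]) \<subseteq> set xs"
      using sub by (simp_all) blast+
  qed
  \<comment> \<open>Both new strands run from the lowest row to the highest row of the polygon,
    hence they are bridges.\<close>
  have "0 # vs @ [p] \<in> bridges (length vs + 1)" "0 # ws @ [p] \<in> bridges (length ws + 1)"
    using sv sw' dd rows sub'[THEN subsetD] by (simp_all add: bridges_def saw_lists_def lpath_def)
  then have st: "stack (0 # vs @ [p]) (0 # ws @ [p]) \<in> bridges (Suc ((length vs + 1) + (length ws + 1)))"
    by (rule stack_bridge)
  have cg: "card (gates xs S) = card S"
  proof -
    have "inj_on (\<lambda>(i, k). (xs ! i, xs ! (k - 1))) S"
    proof (rule inj_onI)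
      fix z z' assume z: "z \<in> S" "z' \<in> S"
        and e: "(case z of (i, k) \<Rightarrow> (xs ! i, xs ! (k - 1))) = (case z' of (i, k) \<Rightarrow> (xs ! i, xs ! (k - 1)))"
      then have "gates xs {z} = gates xs {z'}" by (simp add: gates_def)
      then have "{z} = {z'}" using gates_inj[of xs "{z}" "{z'}"] xs(6) S z by auto
      then show "z = z'" by simp
    qed
    then show ?thesis unfolding gates_def by (rule card_image)
  qed
  \<comment> \<open>The 2 accounts for the bottom and the top vertex, which belong to neither
    \<open>us\<close> nor \<open>ls\<close>.\<close>
  have "length us + length ls + 2 = n" using xs(2) unfolding split by simp
  then have len: "length vs + length ws + 2 = n + 2 * card S"
    using swapped_length[OF sw] cg by simp
  then have e: "(length vs + 1) + (length ws + 1) = n + 2 * card S" by simp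
  have "(length vs + 2, stack (0 # vs @ [p]) (0 # ws @ [p]))
      \<in> {..<n + 2 * card S + 2} \<times> bridges (Suc (n + 2 * card S))"
    using st[unfolded e] len by simp
  moreover have "strand_pair (xs, S) (length vs + 2, stack (0 # vs @ [p]) (0 # ws @ [p]))"
    unfolding strand_pair_def using split sw by blast
  ultimately show ?thesis by blast
qed

section \<open>Counting polygons with many necks\<close>

lemma card_marked_polygons:
  "real (card (SIGMA xs:polygons n. {S. S \<subseteq> necks xs \<and> card S = m}))
     \<le> real (n + 2 * m + 2) * connective ^ (n + 2 * m + 2)"
proof -
  have "card (SIGMA xs:polygons n. {S. S \<subseteq> necks xs \<and> card S = m})
      \<le> card ({..<n + 2 * m + 2} \<times> bridges (Suc (n + 2 * m)))"
  proof (rule card_le_if_inj_on_rel[where r = strand_pair])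
    show "\<exists>w. w \<in> {..<n + 2 * m + 2} \<times> bridges (Suc (n + 2 * m)) \<and> strand_pair z w"
      if mem: "z \<in> (SIGMA xs:polygons n. {S. S \<subseteq> necks xs \<and> card S = m})" for z
    proof -
      obtain xs S where z: "z = (xs, S)" "xs \<in> polygons n" "S \<subseteq> necks xs" "card S = m"
        using mem by (cases z) auto
      from exists_strand_pair[OF z(2,3)] show ?thesis unfolding z(1,4) Bex_def .
    qed
    show "z = z'" if z: "z \<in> (SIGMA xs:polygons n. {S. S \<subseteq> necks xs \<and> card S = m})"
      and z': "z' \<in> (SIGMA xs:polygons n. {S. S \<subseteq> necks xs \<and> card S = m})"
      and w: "strand_pair z w" "strand_pair z' w" for z z' w
    proof -
      obtain xs S where 1: "z = (xs, S)" "xs \<in> polygons n" "S \<subseteq> necks xs" using z by (cases z) auto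
      obtain xs' S' where 2: "z' = (xs', S')" "xs' \<in> polygons n" "S' \<subseteq> necks xs'" using z' by (cases z') auto
      show ?thesis unfolding 1(1) 2(1)
        using strand_pair_inj[of xs S w xs' S'] w polygonsD(6)[OF 1(2)] polygonsD(6)[OF 2(2)] 1 2 by simp
    qed
  qed simp
  then have "real (card (SIGMA xs:polygons n. {S. S \<subseteq> necks xs \<and> card S = m}))
      \<le> real (card ({..<n + 2 * m + 2} \<times> bridges (Suc (n + 2 * m))))" by (rule of_nat_mono)
  also have "\<dots> = real (n + 2 * m + 2) * real (card (bridges (Suc (n + 2 * m))))"
    by (simp only: card_cartesian_product card_lessThan of_nat_mult)
  also have "\<dots> \<le> real (n + 2 * m + 2) * connective ^ (n + 2 * m + 2)"
    using card_bridges_le[of "Suc (n + 2 * m)"] by (intro mult_left_mono) simp_all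
  finally show ?thesis .
qed

lemma card_polygons_le: "real (card (polygons n)) \<le> real (n + 2) * connective ^ (n + 2)"
proof -
  have "{S. S \<subseteq> necks xs \<and> card S = 0} = {{}}" for xs
    using finite_subset[OF _ finite_necks] by auto
  then have "card (SIGMA xs:polygons n. {S. S \<subseteq> necks xs \<and> card S = 0}) = card (polygons n)"
    by (simp add: card_cartesian_product)
  then show ?thesis using card_marked_polygons[of n 0] by simp
qed

text \<open>A polygon with at least \<open>R * m\<close> necks has at least \<open>R ^ m\<close>
  subsets of \<open>m\<close> necks. Marking such a subset costs only a factor
  \<open>connective ^ (2 * m)\<close> in the previous count, and \<open>R\<close> exceeds
  \<open>connective\<^sup>2\<close> by a factor 2.\<close>

lemma card_many_necks:
  assumes "real R \<ge> 2 * connective\<^sup>2" "m > 0"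
  shows "real (card {xs \<in> polygons n. R * m \<le> card (necks xs)})
           \<le> real (n + 2 * m + 2) * connective ^ (n + 2) / 2 ^ m"
proof -
  let ?Y = "{xs \<in> polygons n. R * m \<le> card (necks xs)}"
  have c: "connective \<ge> 1" by (rule connective_ge_1)
  have "1 \<le> connective\<^sup>2" using c by (rule one_le_power)
  then have R: "R \<ge> 1" using assms(1) by (cases R) auto
  have "(2 * connective\<^sup>2) ^ m \<le> real R ^ m" using assms(1) by (intro power_mono) simp_all
  also have "\<dots> \<le> real (R * m choose m)"
    using binomial_ge_n_over_k_pow_k[of m "R * m"] assms(2) R by simp
  finally have 1: "2 ^ m * connective ^ (2 * m) \<le> real (R * m choose m)"
    by (simp add: power_mult_distrib power_mult)
  have "card ?Y * (R * m choose m) = (\<Sum>xs\<in>?Y. R * m choose m)" by simp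
  also have "\<dots> \<le> (\<Sum>xs\<in>?Y. card (necks xs) choose m)"
    by (intro sum_mono binomial_right_mono) simp
  also have "\<dots> \<le> (\<Sum>xs\<in>polygons n. card (necks xs) choose m)"
    by (intro sum_mono2) auto
  also have "\<dots> = card (SIGMA xs:polygons n. {S. S \<subseteq> necks xs \<and> card S = m})"
    by (simp add: card_SigmaI n_subsets finite_subset[OF _ finite_Pow_iff[THEN iffD2, OF finite_necks]])
  finally have "real (card ?Y * (R * m choose m)) \<le> real (card (SIGMA xs:polygons n. {S. S \<subseteq> necks xs \<and> card S = m}))"
    by (rule of_nat_mono)
  then have "real (card ?Y) * real (R * m choose m) \<le> real (n + 2 * m + 2) * connective ^ (n + 2 * m + 2)"
    using card_marked_polygons[of n m] unfolding of_nat_mult by (rule order_trans)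
  moreover have "real (card ?Y) * (2 ^ m * connective ^ (2 * m)) \<le> real (card ?Y) * real (R * m choose m)"
    using 1 by (intro mult_left_mono) simp_all
  ultimately have "real (card ?Y) * 2 ^ m * connective ^ (2 * m) \<le> real (n + 2 * m + 2) * connective ^ (n + 2) * connective ^ (2 * m)"
    by (simp add: power_add algebra_simps)
  then have "real (card ?Y) * 2 ^ m \<le> real (n + 2 * m + 2) * connective ^ (n + 2)"
    using c by (simp only: mult_le_cancel_right) (use zero_less_power[of connective "2 * m"] in linarith)
  then show ?thesis by (simp add: pos_le_divide_eq)
qed

section \<open>The convolution inequality\<close>

lemma canon_dih:
  assumes "xs \<in> polygons n" "dih (translate v xs) zs"
  shows "canon zs = xs \<or> canon (rev zs) = xs"
proof -
  from assms(2) consider i where "zs = rotate i (translate v xs)" | i where "zs = rotate i (rev (translate v xs))"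
    unfolding dih_def by blast
  then show ?thesis
  proof cases
    case 1
    then show ?thesis using canon_rotate_translate[OF assms(1)] by (simp add: rotate_map)
  next
    case 2
    then obtain j where "rev zs = rotate j (rev (rev (translate v xs)))" using ex_rev_rotate by blast
    then have "rev zs = translate v (rotate j xs)" by (simp add: rotate_map)
    then show ?thesis using canon_rotate_translate[OF assms(1)] by simp
  qed
qed

text \<open>The decoder for \<open>exists_join\<close>. A label holds the two arguments of
  \<open>unopen\<close> and a flag for the orientation; the offset is the lowest row of the second
  piece. Only the range matters, so the values on unsuitable arguments are irrelevant.\<close>

definition split_at :: "(pt list \<times> (nat \<times> nat)) \<times> (bool \<times> nat \<times> bool) \<times> (bool \<times> nat \<times> bool) \<Rightarrow>
    (nat \<times> nat) \<times> (pt list \<times> pt list) \<times> int" where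
  "split_at = (\<lambda>((zs, nk), (r, c, q), (r', c', q')).
     let ls = unopen r c (left_part zs nk); rs = mirror (unopen r' c' (mirror (right_part zs nk)));
         xs = canon (if q then rev ls else ls); ys = canon (if q' then rev rs else rs)
     in ((length xs, length ys), (xs, ys), Min (snd ` set rs)))"

definition offsets :: "pt list \<Rightarrow> pt list \<Rightarrow> int set" where
  "offsets xs ys = {s. 3 \<le> s \<and> s \<le> Max (snd ` set xs) \<and>
     Max (snd ` set xs) + 3 \<le> s + Max (snd ` set ys)}"

definition labels :: "(bool \<times> nat \<times> bool) set" where
  "labels = UNIV \<times> {..<3} \<times> UNIV"

lemma card_labels: "card labels = 12" "finite labels"
  by (simp_all add: labels_def card_cartesian_product card_UNIV_bool)

lemma split_at_surj:
  assumes "xs \<in> polygons j" "ys \<in> polygons k" "s \<in> offsets xs ys"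
  shows "((j, k), (xs, ys), s) \<in> split_at ` ((SIGMA zs:polygons (j + k + 16). necks zs) \<times> labels \<times> labels)"
proof -
  obtain zs nk a r c r' c' where z: "zs \<in> polygons (j + k + 16)" "nk \<in> necks zs"
    "c < 3" "dih xs (unopen r c (left_part zs nk))" "c' < 3"
    "dih (translate (a, s) ys) (mirror (unopen r' c' (mirror (right_part zs nk))))"
    using exists_join[OF assms(1,2), of s] assms(3) unfolding offsets_def by blast
  define ls rs where "ls = unopen r c (left_part zs nk)"
    and "rs = mirror (unopen r' c' (mirror (right_part zs nk)))"
  have "translate 0 xs = xs" by simp
  then have "canon ls = xs \<or> canon (rev ls) = xs"
    using canon_dih[OF assms(1), of 0 ls] z(4) by (simp add: ls_def)
  then obtain o1 where o1: "xs = canon (if o1 then rev ls else ls)" by (metis (full_types))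
  have "canon rs = ys \<or> canon (rev rs) = ys"
    using canon_dih[OF assms(2), of "(a, s)" rs] z(6) by (simp add: rs_def)
  then obtain o2 where o2: "ys = canon (if o2 then rev rs else rs)" by (metis (full_types))
  note ys = polygonsD[OF assms(2)] and xs = polygonsD[OF assms(1)]
  have "set rs = set (translate (a, s) ys)" using dih_set[OF z(6)] by (simp add: rs_def)
  then have rows: "snd ` set rs = (\<lambda>p. s + snd p) ` set ys" by (simp add: image_image)
  have "Min (snd ` set rs) = s"
  proof (rule Min_eqI)
    have "0 \<in> set ys" using hd_in_set[of ys] ys(3,5) by simp
    then show "s \<in> snd ` set rs" unfolding rows by (rule rev_image_eqI) simp
    have "0 \<le> snd p" if "p \<in> set ys" for p
      using ys(3,4) that by (auto simp: min_first_def low_def)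
    then show "s \<le> r" if "r \<in> snd ` set rs" for r using that unfolding rows by auto
  qed simp
  then have "split_at ((zs, nk), (r, c, o1), (r', c', o2)) = ((j, k), (xs, ys), s)"
    using o1 o2 xs(2) ys(2) unfolding split_at_def ls_def rs_def by (simp add: Let_def)
  moreover have "((zs, nk), (r, c, o1), (r', c', o2)) \<in> (SIGMA zs:polygons (j + k + 16). necks zs) \<times> labels \<times> labels"
    using z(1,2,3,5) by (simp add: labels_def)
  ultimately show ?thesis by (rule rev_image_eqI[OF _ sym, rotated])
qed

text \<open>Both heights are at least \<open>sqrt N - 1\<close>, and the number of offsets is the
  smaller height minus 2. The bound 36 turns \<open>sqrt N - 3\<close> into
  \<open>sqrt N / 2\<close>.\<close>

lemma card_offsets:
  fixes N :: nat
  assumes "xs \<in> tall_polygons j" "ys \<in> tall_polygons k" "N \<le> j" "N \<le> k" "36 \<le> N"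
  shows "finite (offsets xs ys)" "sqrt N / 2 \<le> real (card (offsets xs ys))"
proof -
  define h h' where "h = Max (snd ` set xs)" and "h' = Max (snd ` set ys)"
  have eq: "offsets xs ys = {max 3 (h + 3 - h')..h}" by (auto simp: offsets_def h_def h'_def)
  then show "finite (offsets xs ys)" by simp
  have hh: "0 \<le> Max (snd ` set zs)" if "zs \<in> tall_polygons i" for zs i
  proof -
    have "zs \<in> polygons i" using that by (simp add: tall_polygons_def)
    then have "0 \<in> snd ` set zs" using polygonsD(3,5) hd_in_set[of zs] by (metis image_eqI snd_zero)
    then show ?thesis by (intro Max_ge) simp_all
  qed
  have "sqrt N \<le> real_of_int h + 1" "sqrt N \<le> real_of_int h' + 1"
    using tall_height[OF assms(1)] tall_height[OF assms(2)] hh[OF assms(1)] hh[OF assms(2)] assms(3,4)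
    unfolding h_def h'_def by (intro real_le_lsqrt; simp)+
  moreover have "6 \<le> sqrt N" using assms(5) by (intro real_le_rsqrt) simp
  moreover have "real (card (offsets xs ys)) = real_of_int (min (h - 2) (h' - 2))"
    if "h \<ge> 5" "h' \<ge> 5" using that unfolding eq by (simp add: min_def max_def)
  moreover have "h \<ge> 5" "h' \<ge> 5" using calculation(1-3) by linarith+
  ultimately show "sqrt N / 2 \<le> real (card (offsets xs ys))" by (simp add: min_def)
qed

text \<open>Double counting of pairs of tall polygons with an offset. Above, each is decoded from a
  polygon with a neck and \<open>12 * 12 = 144\<close> labels; below, offsets contribute
  \<open>sqrt N / 2\<close> and the restriction to tall polygons a factor 4. Together these give
  \<open>144 * 8 = 1152\<close>.\<close>

lemma sum_necks_ge:
  fixes N :: nat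
  assumes "36 \<le> N" "finite I" "\<And>j k. (j, k) \<in> I \<Longrightarrow> N \<le> j \<and> N \<le> k \<and> j + k + 16 = n"
  shows "sqrt N * (\<Sum>(j, k)\<in>I. real (card (polygons j)) * real (card (polygons k)))
           \<le> 1152 * real (\<Sum>zs\<in>polygons n. card (necks zs))"
proof -
  define X where "X = (SIGMA jk:I. SIGMA (xs, ys):tall_polygons (fst jk) \<times> tall_polygons (snd jk). offsets xs ys)"
  let ?Y = "(SIGMA zs:polygons n. necks zs) \<times> labels \<times> labels"
  have finY: "finite ?Y" by (simp add: card_labels)
  have "X \<subseteq> split_at ` ?Y"
  proof
    fix z assume "z \<in> X"
    then obtain j k xs ys s where z: "z = ((j, k), (xs, ys), s)" "(j, k) \<in> I"
      "xs \<in> tall_polygons j" "ys \<in> tall_polygons k" "s \<in> offsets xs ys" unfolding X_def by auto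
    then have "xs \<in> polygons j" "ys \<in> polygons k" by (simp_all add: tall_polygons_def)
    from split_at_surj[OF this z(5)] show "z \<in> split_at ` ?Y" using assms(3)[OF z(2)] z(1) by simp
  qed
  then have "card X \<le> card (split_at ` ?Y)" using finY by (intro card_mono) simp_all
  also have "\<dots> \<le> card ?Y" using finY by (rule card_image_le)
  also have "\<dots> = (\<Sum>zs\<in>polygons n. card (necks zs)) * 144"
    by (simp add: card_cartesian_product card_labels)
  finally have up: "real (card X) \<le> 144 * real (\<Sum>zs\<in>polygons n. card (necks zs))" by linarith
  have fin: "finite (offsets xs ys)" and ge: "sqrt N / 2 \<le> real (card (offsets xs ys))"
    if "(j, k) \<in> I" "xs \<in> tall_polygons j" "ys \<in> tall_polygons k" for j k xs ys
    using card_offsets[OF that(2,3) _ _ assms(1)] assms(3)[OF that(1)] by auto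
  have "real (card X) = (\<Sum>(j, k)\<in>I. \<Sum>(xs, ys)\<in>tall_polygons j \<times> tall_polygons k. real (card (offsets xs ys)))"
  proof -
    have "card X = (\<Sum>jk\<in>I. card (SIGMA (xs, ys):tall_polygons (fst jk) \<times> tall_polygons (snd jk). offsets xs ys))"
      unfolding X_def using assms(2) fin by (intro card_SigmaI) (auto intro!: finite_SigmaI)
    also have "\<dots> = (\<Sum>jk\<in>I. \<Sum>xy\<in>tall_polygons (fst jk) \<times> tall_polygons (snd jk). card (offsets (fst xy) (snd xy)))"
    proof (rule sum.cong[OF refl])
      fix jk assume "jk \<in> I"
      then show "card (SIGMA (xs, ys):tall_polygons (fst jk) \<times> tall_polygons (snd jk). offsets xs ys)
        = (\<Sum>xy\<in>tall_polygons (fst jk) \<times> tall_polygons (snd jk). card (offsets (fst xy) (snd xy)))"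
        using fin[of "fst jk" "snd jk"] by (subst card_SigmaI) (auto simp: case_prod_unfold)
    qed
    finally show ?thesis by (simp add: case_prod_unfold)
  qed
  also have "\<dots> \<ge> (\<Sum>(j, k)\<in>I. \<Sum>(xs, ys)\<in>tall_polygons j \<times> tall_polygons k. sqrt N / 2)"
  proof (rule sum_mono)
    fix jk assume "jk \<in> I"
    then show "(case jk of (j, k) \<Rightarrow> \<Sum>(xs, ys)\<in>tall_polygons j \<times> tall_polygons k. sqrt N / 2)
      \<le> (case jk of (j, k) \<Rightarrow> \<Sum>(xs, ys)\<in>tall_polygons j \<times> tall_polygons k. real (card (offsets xs ys)))"
      using ge[of "fst jk" "snd jk"] by (cases jk) (auto intro!: sum_mono simp del: sum_constant)
  qed
  also have "(\<Sum>(j, k)\<in>I. \<Sum>(xs, ys)\<in>tall_polygons j \<times> tall_polygons k. sqrt N / 2)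
      = (\<Sum>(j, k)\<in>I. sqrt N / 2 * (real (card (tall_polygons j)) * real (card (tall_polygons k))))"
    by (simp add: case_prod_unfold card_cartesian_product mult.commute)
  also have "\<dots> \<ge> (\<Sum>(j, k)\<in>I. sqrt N / 8 * (real (card (polygons j)) * real (card (polygons k))))"
  proof (rule sum_mono, clarify)
    fix j k
    have "real (card (polygons i)) / 2 \<le> real (card (tall_polygons i))" for i
      using card_polygons_le_tall[of i] by linarith
    then have "real (card (polygons j)) / 2 * (real (card (polygons k)) / 2)
        \<le> real (card (tall_polygons j)) * real (card (tall_polygons k))"
      by (intro mult_mono) simp_all
    then have "sqrt N / 2 * (real (card (polygons j)) / 2 * (real (card (polygons k)) / 2))
      \<le> sqrt N / 2 * (real (card (tall_polygons j)) * real (card (tall_polygons k)))"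
      by (intro mult_left_mono) simp_all
    then show "sqrt N / 8 * (real (card (polygons j)) * real (card (polygons k)))
        \<le> sqrt N / 2 * (real (card (tall_polygons j)) * real (card (tall_polygons k)))"
      by simp
  qed
  finally have "(\<Sum>(j, k)\<in>I. sqrt N / 8 * (real (card (polygons j)) * real (card (polygons k)))) \<le> real (card X)" .
  moreover have "(\<Sum>(j, k)\<in>I. sqrt N / 8 * (real (card (polygons j)) * real (card (polygons k))))
      = sqrt N * (\<Sum>(j, k)\<in>I. real (card (polygons j)) * real (card (polygons k))) / 8"
    by (simp add: case_prod_unfold sum_distrib_left sum_divide_distrib)
  ultimately show ?thesis using up by linarith
qed

section \<open>Normalised polygon counts\<close>

definition pdens :: "nat \<Rightarrow> real" where
  "pdens n = real (card (polygons n)) / connective ^ n"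

lemma pdens_nonneg: "0 \<le> pdens n"
  using connective_ge_1 by (simp add: pdens_def)

lemma pdens_le: "pdens n \<le> real (n + 2) * connective\<^sup>2"
  using card_polygons_le[of n] connective_ge_1
  by (simp add: pdens_def divide_le_eq power_add power2_eq_square algebra_simps)

text \<open>Polygons with fewer than \<open>R * m\<close> necks are counted with that bound. The
  others are rare by \<open>card_many_necks\<close> and have at most \<open>n\<^sup>2\<close> necks
  each.\<close>

lemma sum_necks_le:
  assumes "real R \<ge> 2 * connective\<^sup>2" "m > 0"
  shows "real (\<Sum>zs\<in>polygons n. card (necks zs))
     \<le> real (R * m) * real (card (polygons n)) + (real n)\<^sup>2 * (real (n + 2 * m + 2) * connective ^ (n + 2) / 2 ^ m)"
proof -
  let ?Y = "{xs \<in> polygons n. R * m \<le> card (necks xs)}"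
  have "(\<Sum>zs\<in>polygons n. card (necks zs)) \<le> (\<Sum>zs\<in>polygons n. R * m + (if R * m \<le> card (necks zs) then n\<^sup>2 else 0))"
  proof (rule sum_mono)
    fix zs assume "zs \<in> polygons n"
    then have "card (necks zs) \<le> n\<^sup>2" using card_necks_le[of zs] polygonsD(2) by simp
    then show "card (necks zs) \<le> R * m + (if R * m \<le> card (necks zs) then n\<^sup>2 else 0)" by simp
  qed
  also have "\<dots> = card (polygons n) * (R * m) + card ?Y * n\<^sup>2"
    by (simp add: sum.distrib sum.If_cases Int_def)
  finally have "real (\<Sum>zs\<in>polygons n. card (necks zs)) \<le> real (card (polygons n) * (R * m) + card ?Y * n\<^sup>2)"
    by (rule of_nat_mono)
  also have "\<dots> = real (R * m) * real (card (polygons n)) + (real n)\<^sup>2 * real (card ?Y)"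
    by (simp add: algebra_simps)
  also have "\<dots> \<le> real (R * m) * real (card (polygons n)) + (real n)\<^sup>2 * (real (n + 2 * m + 2) * connective ^ (n + 2) / 2 ^ m)"
    using card_many_necks[OF assms, of n] by (intro add_left_mono mult_left_mono) simp_all
  finally show ?thesis .
qed

text \<open>The two bounds on the total number of necks, divided by \<open>connective ^ n\<close>.
  The 16 additional vertices of a join give the factor \<open>connective ^ 16\<close>, which is
  absorbed into \<open>C\<close>.\<close>

lemma pdens_convolution:
  "\<exists>C>0. \<forall>N m n I. 36 \<le> N \<longrightarrow> 0 < m \<longrightarrow> finite I \<longrightarrow> (\<forall>(j, k)\<in>I. N \<le> j \<and> N \<le> k \<and> j + k + 16 = n) \<longrightarrow>
     sqrt (real N) * (\<Sum>(j, k)\<in>I. pdens j * pdens k)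
       \<le> C * (real m * pdens n + (real n)\<^sup>2 * real (n + 2 * m + 2) / 2 ^ m)"
proof -
  have c: "connective \<ge> 1" by (rule connective_ge_1)
  obtain R where R: "real R \<ge> 2 * connective\<^sup>2" using real_arch_simple by blast
  define C where "C = 1152 * connective ^ 16 * (real R + connective\<^sup>2)"
  have factor: "a * (b * x + b * y) = a * b * (x + y)" for a b x y :: real
    by (simp add: algebra_simps)
  have "C > 0" using c by (simp add: C_def add_nonneg_pos)
  moreover have "sqrt (real N) * (\<Sum>(j, k)\<in>I. pdens j * pdens k)
       \<le> C * (real m * pdens n + (real n)\<^sup>2 * real (n + 2 * m + 2) / 2 ^ m)"
    if N: "36 \<le> N" and m: "0 < m" and I: "finite I" "\<forall>(j, k)\<in>I. N \<le> j \<and> N \<le> k \<and> j + k + 16 = n" for N m n I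
  proof -
    define p where "p i = real (card (polygons i))" for i
    have "(\<Sum>(j, k)\<in>I. pdens j * pdens k) = (\<Sum>(j, k)\<in>I. p j * p k * (connective ^ 16 / connective ^ n))"
    proof (rule sum.cong[OF refl], clarify)
      fix j k assume "(j, k) \<in> I"
      then have "n = j + k + 16" using I by auto
      then show "pdens j * pdens k = p j * p k * (connective ^ 16 / connective ^ n)"
        using c by (simp add: pdens_def p_def power_add)
    qed
    also have "\<dots> = (\<Sum>(j, k)\<in>I. p j * p k) * (connective ^ 16 / connective ^ n)"
      by (simp only: sum_distrib_right case_prod_unfold)
    finally have "sqrt (real N) * (\<Sum>(j, k)\<in>I. pdens j * pdens k)
        = (sqrt (real N) * (\<Sum>(j, k)\<in>I. p j * p k)) * (connective ^ 16 / connective ^ n)" by simp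
    also have "\<dots> \<le> (1152 * (real (R * m) * p n + (real n)\<^sup>2 * (real (n + 2 * m + 2) * connective ^ (n + 2) / 2 ^ m)))
        * (connective ^ 16 / connective ^ n)"
    proof (rule mult_right_mono)
      have "sqrt (real N) * (\<Sum>(j, k)\<in>I. p j * p k) \<le> 1152 * real (\<Sum>zs\<in>polygons n. card (necks zs))"
        unfolding p_def using I by (intro sum_necks_ge[OF N]) auto
      also have "1152 * real (\<Sum>zs\<in>polygons n. card (necks zs))
          \<le> 1152 * (real (R * m) * p n + (real n)\<^sup>2 * (real (n + 2 * m + 2) * connective ^ (n + 2) / 2 ^ m))"
        unfolding p_def by (rule mult_left_mono[OF sum_necks_le[OF R m]]) simp
      finally show "sqrt (real N) * (\<Sum>(j, k)\<in>I. p j * p k)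
          \<le> 1152 * (real (R * m) * p n + (real n)\<^sup>2 * (real (n + 2 * m + 2) * connective ^ (n + 2) / 2 ^ m))" .
    qed (use c in simp)
    also have "\<dots> = 1152 * connective ^ 16 * (real R * (real m * pdens n)
        + connective\<^sup>2 * ((real n)\<^sup>2 * real (n + 2 * m + 2) / 2 ^ m))"
      using c by (simp add: pdens_def p_def power_add power2_eq_square field_simps)
    also have "\<dots> \<le> 1152 * connective ^ 16 * ((real R + connective\<^sup>2) * (real m * pdens n)
        + (real R + connective\<^sup>2) * ((real n)\<^sup>2 * real (n + 2 * m + 2) / 2 ^ m))"
      using c pdens_nonneg[of n] by (intro mult_left_mono add_mono mult_right_mono) simp_all
    also have "\<dots> = C * (real m * pdens n + (real n)\<^sup>2 * real (n + 2 * m + 2) / 2 ^ m)"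
      unfolding C_def by (rule factor)
    finally show ?thesis .
  qed
  ultimately show ?thesis by blast
qed

section \<open>Densities\<close>

text \<open>The threshold is a power of the common scale \<open>M\<close> and not of
  \<open>m\<close>, so that it is the same for all lengths in \<open>S\<close>. Since only the order
  of magnitude counts, \<open>\<delta>\<close> may shrink from one level to the next.\<close>

definition dense_level :: "real \<Rightarrow> bool" where
  "dense_level \<kappa> \<longleftrightarrow> (\<exists>\<delta>. 0 < \<delta> \<and> \<delta> \<le> 1 \<and> (\<exists>\<^sub>F M in sequentially. \<exists>S. finite S \<and>
     (\<forall>m\<in>S. \<delta> * real M \<le> real m \<and> real m \<le> real M / \<delta> \<and> real M powr (\<kappa> - 3 / 2) \<le> pdens m) \<and>
     \<delta> * real M \<le> real (card S)))"

definition sum_reps :: "nat set \<Rightarrow> nat \<Rightarrow> (nat \<times> nat) set" where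
  "sum_reps S n = {(j, k). j \<in> S \<and> k \<in> S \<and> j + k + 16 = n}"

lemma finite_sum_reps: "finite S \<Longrightarrow> finite (sum_reps S n)"
  by (rule finite_subset[of _ "S \<times> S"]) (auto simp: sum_reps_def)

text \<open>There are \<open>card S * card S\<close> pairs and at most
  \<open>4 * M / \<delta>\<close> possible sums. With the threshold
  \<open>\<delta> ^ 3 / 8 * M\<close> the unpopular sums account for at most half of the pairs, and
  a popular sum for at most \<open>card S\<close> of them.\<close>

lemma card_popular_sums:
  assumes "finite S" "\<And>m. m \<in> S \<Longrightarrow> real m \<le> M / \<delta>" "\<delta> * M \<le> real (card S)" "0 < \<delta>" "\<delta> \<le> 1" "16 \<le> M"
  defines "T \<equiv> {n. \<delta> ^ 3 / 8 * M \<le> real (card (sum_reps S n))}"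
  shows "finite T" "\<delta> / 2 * M \<le> real (card T)" "\<And>n. n \<in> T \<Longrightarrow> real n \<le> 3 * M / \<delta>"
proof -
  define B where "B = nat \<lfloor>3 * M / \<delta>\<rfloor>"
  define s where "s = real (card S)"
  have pos: "0 < \<delta> ^ 3 / 8 * M" "0 < \<delta> * M" using assms by simp_all
  have Md: "M \<le> M / \<delta>" using assms by (simp add: le_divide_eq mult_left_le)
  have bound: "real n \<le> 3 * M / \<delta>" if "(j, k) \<in> sum_reps S n" for j k n
  proof -
    have "real n \<le> M / \<delta> + M / \<delta> + 16" using that assms(2)[of j] assms(2)[of k] by (auto simp: sum_reps_def)
    then show ?thesis using Md assms(6) by simp
  qed
  show le: "real n \<le> 3 * M / \<delta>" if "n \<in> T" for n
  proof -
    have "sum_reps S n \<noteq> {}" using that pos by (auto simp: T_def)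
    then show ?thesis using bound by fast
  qed
  have "T \<subseteq> {..B}" using le unfolding B_def by (fastforce simp: le_nat_floor)
  then show fin: "finite T" using finite_subset by blast
  have "S \<times> S \<subseteq> (\<Union>n\<in>{..B}. sum_reps S n)"
  proof clarify
    fix j k assume "j \<in> S" "k \<in> S"
    then have "(j, k) \<in> sum_reps S (j + k + 16)" by (simp add: sum_reps_def)
    moreover from this have "j + k + 16 \<le> B" using bound unfolding B_def by (intro le_nat_floor) blast
    ultimately show "(j, k) \<in> (\<Union>n\<in>{..B}. sum_reps S n)" by blast
  qed
  then have "card (S \<times> S) \<le> card (\<Union>n\<in>{..B}. sum_reps S n)"
    using finite_sum_reps[OF assms(1)] by (intro card_mono) auto
  also have "\<dots> \<le> (\<Sum>n\<le>B. card (sum_reps S n))" by (rule card_UN_le) simp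
  finally have "real (card S * card S) \<le> (\<Sum>n\<le>B. real (card (sum_reps S n)))"
    unfolding card_cartesian_product of_nat_sum[symmetric] by (rule of_nat_mono)
  also have "\<dots> \<le> (\<Sum>n\<le>B. (if n \<in> T then s else 0) + \<delta> ^ 3 / 8 * M)"
  proof (rule sum_mono)
    fix n
    \<comment> \<open>A representation is determined by its first entry.\<close>
    have "card (sum_reps S n) \<le> card S"
      by (rule card_inj_on_le[of fst]) (auto simp: sum_reps_def inj_on_def assms(1))
    then show "real (card (sum_reps S n)) \<le> (if n \<in> T then s else 0) + \<delta> ^ 3 / 8 * M"
      using pos by (auto simp: T_def s_def)
  qed
  also have "\<dots> = real (card T) * s + real (B + 1) * (\<delta> ^ 3 / 8 * M)"
    using \<open>T \<subseteq> {..B}\<close> by (simp add: sum.distrib sum.If_cases Int_absorb1)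
  also have "\<dots> \<le> real (card T) * s + (4 * M / \<delta>) * (\<delta> ^ 3 / 8 * M)"
  proof -
    have "real B \<le> 3 * M / \<delta>" unfolding B_def using assms by (intro of_nat_floor) simp
    then have "real (B + 1) \<le> 4 * M / \<delta>" using Md assms(6) by simp
    then show ?thesis using pos(1) by (intro add_left_mono mult_right_mono) simp_all
  qed
  also have "(4 * M / \<delta>) * (\<delta> ^ 3 / 8 * M) = (\<delta> * M) * (\<delta> * M) / 2"
    using assms(4) by (simp add: power3_eq_cube field_simps)
  also have "real (card T) * s + (\<delta> * M) * (\<delta> * M) / 2 \<le> real (card T) * s + (\<delta> * M) * s / 2"
    using pos(2) assms(3) by (intro add_left_mono divide_right_mono mult_left_mono) (simp_all add: s_def)
  finally have "s * s \<le> (real (card T) + \<delta> * M / 2) * s" by (simp add: s_def algebra_simps)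
  then have "s \<le> real (card T) + \<delta> * M / 2" using pos(2) assms(3) by (simp add: s_def)
  then show "\<delta> / 2 * M \<le> real (card T)" using assms(3) by (simp add: s_def)
qed

text \<open>At a popular sum the convolution has of order \<open>M\<close> terms of size
  \<open>M powr (2 * \<kappa> - 3)\<close>. With the factor \<open>sqrt M\<close> this gives
  \<open>M powr (2 * \<kappa> - 3 / 2)\<close> up to a logarithm, and the new exponent
  \<open>5 / 4 * \<kappa>\<close> leaves room for the logarithm and the constants.\<close>

lemma dense_level_step:
  assumes "dense_level \<kappa>" "\<kappa> > 0"
  shows "dense_level (5 / 4 * \<kappa>)"
proof -
  obtain \<delta> where \<delta>: "0 < \<delta>" "\<delta> \<le> 1" and freq: "\<exists>\<^sub>F M in sequentially. \<exists>S. finite S \<and>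
     (\<forall>m\<in>S. \<delta> * real M \<le> real m \<and> real m \<le> real M / \<delta> \<and> real M powr (\<kappa> - 3 / 2) \<le> pdens m) \<and>
     \<delta> * real M \<le> real (card S)"
    using assms(1) unfolding dense_level_def by blast
  obtain C where C: "C > 0" and conv: "\<And>N m n I. 36 \<le> N \<Longrightarrow> 0 < m \<Longrightarrow> finite I \<Longrightarrow>
     (\<forall>(j, k)\<in>I. N \<le> j \<and> N \<le> k \<and> j + k + 16 = n) \<Longrightarrow>
     sqrt (real N) * (\<Sum>(j, k)\<in>I. pdens j * pdens k)
       \<le> C * (real m * pdens n + (real n)\<^sup>2 * real (n + 2 * m + 2) / 2 ^ m)"
    using pdens_convolution by blast
  \<comment> \<open>\<open>A\<close> is the constant of the error term and \<open>E\<close> that of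
    the main term in the computation for a popular sum below.\<close>
  define A where "A = 9 / \<delta> ^ 2 * (3 / \<delta> + 4)"
  define E where "E = sqrt \<delta> * (\<delta> ^ 3 / 8) / C"
  have cancel: "t / (t * t) = 1 / t" for t :: real by simp
  have AE: "A > 0" "E > 0" using \<delta> C by (simp_all add: A_def E_def add_pos_pos)
  have "eventually (\<lambda>M. (6 * log 2 (real M) + 1) * real M powr (5 / 4 * \<kappa> - 3 / 2)
      \<le> E * real M powr (2 * \<kappa> - 3 / 2) - A * real M powr (-3)) sequentially"
    using AE assms(2) by real_asymp
  moreover have "eventually (\<lambda>M. 6 * log 2 (real M) + 1 \<le> real M) sequentially" by real_asymp
  moreover have "eventually (\<lambda>M. 36 \<le> \<delta> * real M) sequentially" using \<delta> by real_asymp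
  ultimately have ev: "eventually (\<lambda>M. (6 * log 2 (real M) + 1) * real M powr (5 / 4 * \<kappa> - 3 / 2)
      \<le> E * real M powr (2 * \<kappa> - 3 / 2) - A * real M powr (-3) \<and>
      6 * log 2 (real M) + 1 \<le> real M \<and> 36 \<le> \<delta> * real M) sequentially"
    by eventually_elim blast
  \<comment> \<open>Popular sums are bounded by \<open>3 * M / \<delta>\<close>, and there are at
    least \<open>\<delta> / 2 * M\<close> of them; \<open>\<delta> / 3\<close> serves both.\<close>
  define \<delta>' where "\<delta>' = \<delta> / 3"
  have "\<exists>\<^sub>F M in sequentially. \<exists>S. finite S \<and>
     (\<forall>m\<in>S. \<delta>' * real M \<le> real m \<and> real m \<le> real M / \<delta>' \<and> real M powr (5 / 4 * \<kappa> - 3 / 2) \<le> pdens m) \<and>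
     \<delta>' * real M \<le> real (card S)"
    using frequently_eventually_conj[OF freq ev]
  proof (rule frequently_elim1, elim conjE exE)
    fix M :: nat and S
    assume S: "finite S" and SM: "\<forall>m\<in>S. \<delta> * real M \<le> real m \<and> real m \<le> real M / \<delta> \<and> real M powr (\<kappa> - 3 / 2) \<le> pdens m"
      and cS: "\<delta> * real M \<le> real (card S)"
      and M1: "(6 * log 2 (real M) + 1) * real M powr (5 / 4 * \<kappa> - 3 / 2)
        \<le> E * real M powr (2 * \<kappa> - 3 / 2) - A * real M powr (-3)"
      and M2: "6 * log 2 (real M) + 1 \<le> real M" and M3: "36 \<le> \<delta> * real M"
    have M36: "36 \<le> real M" using M3 \<delta> mult_right_mono[of \<delta> 1 "real M"] by simp
    define T where "T = {n. \<delta> ^ 3 / 8 * real M \<le> real (card (sum_reps S n))}"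
    note pop = card_popular_sums[of S "real M" \<delta>, folded T_def]
    have T: "finite T" "\<delta> / 2 * real M \<le> real (card T)" "\<And>n. n \<in> T \<Longrightarrow> real n \<le> 3 * real M / \<delta>"
      using pop S SM cS \<delta> M36 by auto
    \<comment> \<open>Logarithmically many necks suffice: \<open>2 ^ m \<ge> M ^ 6\<close> brings
      the error term, which is cubic in \<open>M\<close>, down to order
      \<open>M powr (-3)\<close>.\<close>
    define m where "m = nat \<lceil>6 * log 2 (real M)\<rceil>"
    have l0: "0 < log 2 (real M)" using M36 by simp
    have m: "0 < m" "6 * log 2 (real M) \<le> real m" "real m \<le> 6 * log 2 (real M) + 1"
    proof -
      show "6 * log 2 (real M) \<le> real m" unfolding m_def by (rule real_nat_ceiling_ge)
      then show "0 < m" using l0 by (cases m) simp_all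
      have "real m = real_of_int \<lceil>6 * log 2 (real M)\<rceil>" using l0 by (simp add: m_def)
      then show "real m \<le> 6 * log 2 (real M) + 1" using ceiling_correct[of "6 * log 2 (real M)"] by linarith
    qed
    have "2 powr (log 2 (real M) * 6) = (2 powr log 2 (real M)) powr 6" by (rule powr_powr[symmetric])
    also have "2 powr log 2 (real M) = real M" using M36 by simp
    also have "real M powr 6 = real M ^ 6" by simp
    finally have "real M ^ 6 = 2 powr (6 * log 2 (real M))" by (simp add: mult.commute)
    also have "\<dots> \<le> 2 powr real m" using m(2) by (intro powr_mono) simp_all
    also have "\<dots> = 2 ^ m" by (simp add: powr_realpow)
    finally have pow: "real M ^ 6 \<le> 2 ^ m" .
    define N where "N = nat \<lceil>\<delta> * real M\<rceil>"
    have N: "\<delta> * real M \<le> real N" unfolding N_def by (rule real_nat_ceiling_ge)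
    then have "36 \<le> real N" using M3 by linarith
    then have N36: "36 \<le> N" by simp
    have Nle: "N \<le> j" if "j \<in> S" for j
      using SM that by (simp add: N_def nat_le_iff ceiling_le_iff)
    have "real M powr (5 / 4 * \<kappa> - 3 / 2) \<le> pdens n" if n: "n \<in> T" for n
    proof -
      let ?I = "sum_reps S n"
      have "sqrt (\<delta> * real M) * (\<delta> ^ 3 / 8 * real M * real M powr (2 * \<kappa> - 3))
          \<le> sqrt (real N) * (\<Sum>(j, k)\<in>?I. pdens j * pdens k)"
      proof (rule mult_mono)
        show "sqrt (\<delta> * real M) \<le> sqrt (real N)" using N by simp
        have "real M powr (2 * \<kappa> - 3) = real M powr (\<kappa> - 3 / 2) * real M powr (\<kappa> - 3 / 2)"
          by (simp flip: powr_add)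
        also have "\<dots> \<le> pdens j * pdens k" if "(j, k) \<in> ?I" for j k
          using that SM by (intro mult_mono) (auto simp: sum_reps_def pdens_nonneg)
        finally have "(\<Sum>(j, k)\<in>?I. real M powr (2 * \<kappa> - 3)) \<le> (\<Sum>(j, k)\<in>?I. pdens j * pdens k)"
          by (intro sum_mono) auto
        moreover have "(\<Sum>(j, k)\<in>?I. real M powr (2 * \<kappa> - 3)) = real (card ?I) * real M powr (2 * \<kappa> - 3)"
          by (simp add: case_prod_unfold)
        moreover have "\<delta> ^ 3 / 8 * real M * real M powr (2 * \<kappa> - 3) \<le> real (card ?I) * real M powr (2 * \<kappa> - 3)"
          using n by (intro mult_right_mono) (simp_all add: T_def)
        ultimately show "\<delta> ^ 3 / 8 * real M * real M powr (2 * \<kappa> - 3) \<le> (\<Sum>(j, k)\<in>?I. pdens j * pdens k)"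
          by linarith
      qed (use \<delta> in auto)
      also have "\<dots> \<le> C * (real m * pdens n + (real n)\<^sup>2 * real (n + 2 * m + 2) / 2 ^ m)"
        using finite_sum_reps[OF S] Nle N36 m(1) by (intro conv) (auto simp: sum_reps_def)
      finally have main: "sqrt (\<delta> * real M) * (\<delta> ^ 3 / 8 * real M * real M powr (2 * \<kappa> - 3)) / C
          \<le> real m * pdens n + (real n)\<^sup>2 * real (n + 2 * m + 2) / 2 ^ m"
        by (subst pos_divide_le_eq[OF C], subst mult.commute[of _ C])
      have "sqrt (\<delta> * real M) * (\<delta> ^ 3 / 8 * real M * real M powr (2 * \<kappa> - 3)) / C
          = E * (real M powr (1 / 2) * real M powr 1 * real M powr (2 * \<kappa> - 3))"
        using M36 by (simp add: E_def real_sqrt_mult powr_half_sqrt)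
      also have "\<dots> = E * real M powr (2 * \<kappa> - 3 / 2)"
        by (simp only: powr_add[symmetric]) (simp add: field_simps)
      finally have lhs: "sqrt (\<delta> * real M) * (\<delta> ^ 3 / 8 * real M * real M powr (2 * \<kappa> - 3)) / C
          = E * real M powr (2 * \<kappa> - 3 / 2)" .
      have "(real n)\<^sup>2 * real (n + 2 * m + 2) / 2 ^ m \<le> (3 * real M / \<delta>)\<^sup>2 * ((3 / \<delta> + 4) * real M) / real M ^ 6"
      proof (rule frac_le)
        have "real m \<le> real M" using m M2 by linarith
        then have "real (n + 2 * m + 2) \<le> (3 / \<delta> + 4) * real M"
          using T(3)[OF n] M36 by (simp add: algebra_simps)
        then show "(real n)\<^sup>2 * real (n + 2 * m + 2) \<le> (3 * real M / \<delta>)\<^sup>2 * ((3 / \<delta> + 4) * real M)"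
          using T(3)[OF n] by (intro mult_mono power_mono) auto
      qed (use pow M36 \<delta> in auto)
      also have "\<dots> = A * (real M ^ 3 / real M ^ 6)"
        by (simp add: A_def power_divide power_mult_distrib power2_eq_square power3_eq_cube)
      also have "real M ^ 6 = real M ^ 3 * real M ^ 3" by (simp flip: power_add)
      also have "real M ^ 3 / (real M ^ 3 * real M ^ 3) = 1 / real M ^ 3" by (rule cancel)
      also have "1 / real M ^ 3 = real M powr (-3)"
        using M36 by (simp add: powr_minus inverse_eq_divide)
      finally have "E * real M powr (2 * \<kappa> - 3 / 2) - A * real M powr (-3) \<le> real m * pdens n"
        using main lhs by linarith
      then have "(6 * log 2 (real M) + 1) * real M powr (5 / 4 * \<kappa> - 3 / 2) \<le> real m * pdens n"
        using M1 by linarith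
      also have "\<dots> \<le> (6 * log 2 (real M) + 1) * pdens n"
        using m(3) pdens_nonneg by (intro mult_right_mono)
      finally show ?thesis using l0 by simp
    qed
    moreover have "\<delta>' * real M \<le> real n \<and> real n \<le> real M / \<delta>'" if n: "n \<in> T" for n
    proof -
      have "0 < \<delta> ^ 3 / 8 * real M" using M36 \<delta>(1) by simp
      then have "sum_reps S n \<noteq> {}" using n by (auto simp: T_def)
      then obtain j where "j \<in> S" "j \<le> n" by (auto simp: sum_reps_def)
      then have "\<delta> * real M \<le> real n" using SM by fastforce
      then show ?thesis using T(3)[OF n] M3 by (simp add: \<delta>'_def mult.commute)
    qed
    moreover have "\<delta>' * real M \<le> real (card T)" using T(2) M3 by (simp add: \<delta>'_def)
    ultimately show "\<exists>S. finite S \<and>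
     (\<forall>m\<in>S. \<delta>' * real M \<le> real m \<and> real m \<le> real M / \<delta>' \<and> real M powr (5 / 4 * \<kappa> - 3 / 2) \<le> pdens m) \<and>
     \<delta>' * real M \<le> real (card S)" using T(1) by blast
  qed
  then show ?thesis unfolding dense_level_def using \<delta> by (intro exI[of _ \<delta>']) (auto simp: \<delta>'_def)
qed

text \<open>At this level the densities would be at least \<open>M powr (3 / 2)\<close>, while
  \<open>pdens_le\<close> allows only linear growth.\<close>

lemma not_dense_level_3:
  assumes "\<kappa> \<ge> 3"
  shows "\<not> dense_level \<kappa>"
proof
  assume "dense_level \<kappa>"
  then obtain \<delta> where \<delta>: "0 < \<delta>" "\<delta> \<le> 1" and freq: "\<exists>\<^sub>F M in sequentially. \<exists>S. finite S \<and>
     (\<forall>m\<in>S. \<delta> * real M \<le> real m \<and> real m \<le> real M / \<delta> \<and> real M powr (\<kappa> - 3 / 2) \<le> pdens m) \<and>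
     \<delta> * real M \<le> real (card S)"
    unfolding dense_level_def by blast
  define c where "c = connective\<^sup>2"
  have c: "c > 0" using connective_ge_1 by (simp add: c_def)
  have "eventually (\<lambda>M. (real M / \<delta> + 2) * c < real M powr (3 / 2)) sequentially"
    using \<delta> c by real_asymp
  moreover have "eventually (\<lambda>M. M > 0) sequentially" by (rule eventually_gt_at_top)
  ultimately have "\<exists>\<^sub>F M in sequentially. False"
    using freq
  proof (elim frequently_rev_mp, eventually_elim, safe)
    fix M :: nat and S
    assume M: "(real M / \<delta> + 2) * c < real M powr (3 / 2)" "0 < M"
      and S: "finite S" "\<forall>m\<in>S. \<delta> * real M \<le> real m \<and> real m \<le> real M / \<delta> \<and> real M powr (\<kappa> - 3 / 2) \<le> pdens m"
      "\<delta> * real M \<le> real (card S)"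
    have "card S \<noteq> 0" using S(3) mult_pos_pos[OF \<delta>(1), of "real M"] M(2) by (intro notI) simp
    then obtain m where "m \<in> S" by (metis card.empty ex_in_conv)
    then have m: "real m \<le> real M / \<delta>" "real M powr (\<kappa> - 3 / 2) \<le> pdens m" using S by auto
    have "real M powr (3 / 2) \<le> real M powr (\<kappa> - 3 / 2)" using M(2) assms by (intro powr_mono) simp_all
    also have "\<dots> \<le> real (m + 2) * c" using m(2) pdens_le[of m] by (simp add: c_def)
    also have "\<dots> \<le> (real M / \<delta> + 2) * c" using m(1) c by (intro mult_right_mono) simp_all
    finally show False using M(1) by simp
  qed
  then show False by simp
qed

lemma not_dense_level:
  assumes "\<kappa> > 0"
  shows "\<not> dense_level \<kappa>"
proof
  assume d: "dense_level \<kappa>"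
  have "dense_level ((5 / 4) ^ i * \<kappa>)" for i
  proof (induction i)
    case (Suc i)
    then show ?case using dense_level_step[OF Suc] assms by (simp add: mult.assoc)
  qed (use d in simp)
  moreover obtain i where "3 / \<kappa> < (5 / 4 :: real) ^ i" using real_arch_pow[of "5 / 4"] by auto
  then have "3 \<le> (5 / 4) ^ i * \<kappa>" using assms by (simp add: divide_less_eq)
  ultimately show False using not_dense_level_3 by blast
qed

section \<open>Lengths with a large closing probability\<close>

definition bad_lengths :: "real \<Rightarrow> nat set" where
  "bad_lengths \<epsilon> = {n. odd n \<and> real n powr (- 1 / 2 + \<epsilon>) <
     measure_pmf.prob (saw_law n :: (nat \<Rightarrow> int ^ 2) pmf) {\<gamma>. closes n \<gamma>}}"

text \<open>The hypothesis \<open>\<epsilon> \<le> 1 / 2\<close> makes the exponent nonpositive, so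
  the lower bound at \<open>n\<close> can be replaced by the one at the end \<open>2 * x\<close> of
  the range.\<close>

lemma bad_lengths_pdens:
  assumes "n \<in> bad_lengths \<epsilon>" "n \<ge> 3" "real n \<le> 2 * x" "\<epsilon> \<le> 1 / 2"
  shows "(2 * x) powr (- 1 / 2 + \<epsilon>) / ((2 * x + 1) * connective) \<le> pdens (Suc n)"
proof -
  have c: "connective \<ge> 1" by (rule connective_ge_1)
  have "(2 * x) powr (- 1 / 2 + \<epsilon>) \<le> real n powr (- 1 / 2 + \<epsilon>)"
    using assms by (intro powr_mono2') auto
  also have "\<dots> \<le> real (Suc n) * real (card (polygons (Suc n))) / connective ^ n"
    using assms(1) prob_closes_le[OF assms(2)] by (simp add: bad_lengths_def)
  also have "\<dots> = real (Suc n) * connective * pdens (Suc n)"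
    using c by (simp add: pdens_def)
  also have "\<dots> \<le> ((2 * x + 1) * connective) * pdens (Suc n)"
    using assms(3) c pdens_nonneg by (intro mult_right_mono) simp_all
  finally show ?thesis using assms(2,3) c by (subst pos_divide_le_eq) (simp_all add: mult.commute add_pos_pos)
qed

text \<open>If the limit were not 0, the bad lengths would form a positive proportion at infinitely
  many scales. Shifted by one they are lengths of polygons with large density, which gives
  \<open>dense_level (\<epsilon> / 2)\<close>.\<close>

lemma bad_lengths_null:
  assumes "0 < \<epsilon>" "\<epsilon> < 1 / 2"
  shows "(\<lambda>N. real (card (bad_lengths \<epsilon> \<inter> {0..2 * N})) / real N) \<longlonglongrightarrow> 0"
proof (rule ccontr)
  let ?f = "\<lambda>N. real (card (bad_lengths \<epsilon> \<inter> {0..2 * N})) / real N"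
  assume "\<not> ?f \<longlonglongrightarrow> 0"
  then obtain d where d: "d > 0" "\<exists>\<^sub>F N in sequentially. d \<le> ?f N"
    unfolding tendsto_iff not_eventually[symmetric]
    by (auto simp: not_eventually not_less)
  \<comment> \<open>The bound \<open>d / 4\<close> leaves enough bad lengths after those below
    \<open>\<delta> * N\<close> are discarded; \<open>1 / 3\<close> is used for
    \<open>m \<le> 2 * N + 1 \<le> N / \<delta>\<close>.\<close>
  define \<delta> where "\<delta> = min (d / 4) (1 / 3)"
  have \<delta>: "0 < \<delta>" "\<delta> \<le> 1" "\<delta> \<le> 1 / 3" "\<delta> \<le> d / 4" using d(1) by (auto simp: \<delta>_def)
  have c: "connective \<ge> 1" by (rule connective_ge_1)
  \<comment> \<open>The right-hand side is of order \<open>N powr (\<epsilon> - 3 / 2)\<close>;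
    giving away \<open>\<epsilon> / 2\<close> absorbs the constants.\<close>
  have "eventually (\<lambda>N. real N powr (\<epsilon> / 2 - 3 / 2)
      \<le> (2 * real N) powr (- 1 / 2 + \<epsilon>) / ((2 * real N + 1) * connective)) sequentially"
    using assms c by real_asymp
  moreover have "eventually (\<lambda>N. 3 \<le> \<delta> * real N) sequentially" using \<delta> by real_asymp
  ultimately have ev: "eventually (\<lambda>N. real N powr (\<epsilon> / 2 - 3 / 2)
      \<le> (2 * real N) powr (- 1 / 2 + \<epsilon>) / ((2 * real N + 1) * connective) \<and> 3 \<le> \<delta> * real N) sequentially"
    by eventually_elim blast
  have "\<exists>\<^sub>F N in sequentially. \<exists>S. finite S \<and>
     (\<forall>m\<in>S. \<delta> * real N \<le> real m \<and> real m \<le> real N / \<delta> \<and> real N powr (\<epsilon> / 2 - 3 / 2) \<le> pdens m) \<and>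
     \<delta> * real N \<le> real (card S)"
    using frequently_eventually_conj[OF d(2) ev]
  proof (rule frequently_elim1, elim conjE)
    fix N :: nat
    assume dN: "d \<le> ?f N" and N1: "real N powr (\<epsilon> / 2 - 3 / 2)
        \<le> (2 * real N) powr (- 1 / 2 + \<epsilon>) / ((2 * real N + 1) * connective)"
      and N2: "3 \<le> \<delta> * real N"
    have N: "0 < real N" using N2 \<delta> by (cases N) auto
    let ?B = "bad_lengths \<epsilon> \<inter> {0..2 * N}"
    define S0 where "S0 = {n \<in> ?B. \<delta> * real N \<le> real n}"
    define K where "K = nat \<lfloor>\<delta> * real N\<rfloor>"
    have K: "real K \<le> \<delta> * real N" unfolding K_def using N2 by (intro of_nat_floor) simp
    have "?B \<subseteq> S0 \<union> {..K}"
    proof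
      fix n assume "n \<in> ?B"
      then show "n \<in> S0 \<union> {..K}" using N2 by (cases "\<delta> * real N \<le> real n") (auto simp: S0_def K_def le_nat_floor)
    qed
    then have "card ?B \<le> card (S0 \<union> {..K})" by (intro card_mono) (auto simp: S0_def)
    also have "\<dots> \<le> card S0 + (K + 1)" using card_Un_le[of S0 "{..K}"] by simp
    finally have "real (card ?B) \<le> real (card S0) + \<delta> * real N + 1" using K by linarith
    moreover have "d * real N \<le> real (card ?B)" using dN N by (simp add: pos_le_divide_eq)
    moreover have "4 * (\<delta> * real N) \<le> d * real N" using \<delta>(4) N by simp
    ultimately have cS: "\<delta> * real N \<le> real (card S0)" using N2 by linarith
    define S where "S = Suc ` S0"
    have "card S = card S0" unfolding S_def by (intro card_image) simp
    moreover have "finite S" by (simp add: S_def S0_def)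
    moreover have "\<delta> * real N \<le> real m \<and> real m \<le> real N / \<delta> \<and> real N powr (\<epsilon> / 2 - 3 / 2) \<le> pdens m"
      if "m \<in> S" for m
    proof -
      from that obtain n where n: "m = Suc n" "n \<in> bad_lengths \<epsilon>" "n \<le> 2 * N" "\<delta> * real N \<le> real n"
        by (auto simp: S_def S0_def)
      have n3: "n \<ge> 3" using n(4) N2 by linarith
      have n2: "real n \<le> 2 * real N" using n(3) by linarith
      have "real N powr (\<epsilon> / 2 - 3 / 2) \<le> pdens m"
        using N1 bad_lengths_pdens[OF n(2) n3 n2 less_imp_le[OF assms(2)]] unfolding n(1) by (rule order_trans)
      moreover have "\<delta> * real m \<le> real N"
      proof -
        have "real m \<le> 3 * real N" using n(1) n2 n3 by linarith
        then have "\<delta> * real m \<le> 1 / 3 * (3 * real N)" using \<delta> by (intro mult_mono) simp_all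
        then show ?thesis by simp
      qed
      ultimately show ?thesis using n(1,4) \<delta>(1) by (simp add: pos_le_divide_eq mult.commute)
    qed
    ultimately show "\<exists>S. finite S \<and>
     (\<forall>m\<in>S. \<delta> * real N \<le> real m \<and> real m \<le> real N / \<delta> \<and> real N powr (\<epsilon> / 2 - 3 / 2) \<le> pdens m) \<and>
     \<delta> * real N \<le> real (card S)" using cS by (intro exI[of _ S]) simp
  qed
  then have "dense_level (\<epsilon> / 2)" unfolding dense_level_def using \<delta> by blast
  then show False using not_dense_level[of "\<epsilon> / 2"] assms(1) by simp
qed

lemma card_odd_atMost: "card {n \<in> {0..2 * N}. odd n} = N"
proof -
  have "{n \<in> {0..2 * N}. odd n} = (\<lambda>i. 2 * i + 1) ` {..<N}"
    by (auto elim!: oddE intro!: image_eqI)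
  then show ?thesis by (simp add: card_image inj_on_def)
qed

theorem corollary1p6:
  fixes \<epsilon> :: real
  assumes "\<epsilon> > 0"
  shows "has_limiting_density
    {n :: nat. odd n \<and>
       measure_pmf.prob (saw_law n :: (nat \<Rightarrow> int ^ 2) pmf) {\<gamma>. closes n \<gamma>}
         \<le> real n powr (- 1 / 2 + \<epsilon>)} 1"
proof -
  let ?G = "{n :: nat. odd n \<and> measure_pmf.prob (saw_law n :: (nat \<Rightarrow> int ^ 2) pmf) {\<gamma>. closes n \<gamma>}
         \<le> real n powr (- 1 / 2 + \<epsilon>)}"
  \<comment> \<open>\<open>bad_lengths_null\<close> needs an exponent below \<open>1 / 2\<close>.
    For \<open>n \<ge> 1\<close> the bound with the smaller exponent implies the one with
    \<open>\<epsilon>\<close>.\<close>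
  define e where "e = min \<epsilon> (1 / 4)"
  have e: "0 < e" "e < 1 / 2" "e \<le> \<epsilon>" using assms by (auto simp: e_def)
  have share: "1 - a / x \<le> b / x" if "x \<le> a + b" "0 < x" for a b x :: real
    using divide_right_mono[OF that(1), of x] that(2) by (simp add: add_divide_distrib)
  have part: "1 - real (card (bad_lengths e \<inter> {0..2 * N})) / real N \<le> real (card (?G \<inter> {0..2 * N})) / real N"
    "real (card (?G \<inter> {0..2 * N})) / real N \<le> 1" if "N > 0" for N
  proof -
    let ?O = "{n \<in> {0..2 * N}. odd n}"
    \<comment> \<open>Each of the \<open>N\<close> odd numbers up to \<open>2 * N\<close> is bad for
      \<open>e\<close> or good for \<open>\<epsilon>\<close>, so the good ones have a share of at
      least one minus that of the bad ones.\<close>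
    have "?O \<subseteq> (bad_lengths e \<inter> {0..2 * N}) \<union> (?G \<inter> {0..2 * N})"
    proof
      fix n assume n: "n \<in> ?O"
      then have "n \<ge> 1" by (cases n) auto
      then have "real n powr (- 1 / 2 + e) \<le> real n powr (- 1 / 2 + \<epsilon>)"
        using e(3) by (intro powr_mono) simp_all
      then show "n \<in> (bad_lengths e \<inter> {0..2 * N}) \<union> (?G \<inter> {0..2 * N})"
        using n by (auto simp: bad_lengths_def)
    qed
    then have "card ?O \<le> card ((bad_lengths e \<inter> {0..2 * N}) \<union> (?G \<inter> {0..2 * N}))"
      by (intro card_mono) auto
    also have "\<dots> \<le> card (bad_lengths e \<inter> {0..2 * N}) + card (?G \<inter> {0..2 * N})" by (rule card_Un_le)
    finally have "real N \<le> real (card (bad_lengths e \<inter> {0..2 * N})) + real (card (?G \<inter> {0..2 * N}))"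
      unfolding card_odd_atMost by linarith
    then show "1 - real (card (bad_lengths e \<inter> {0..2 * N})) / real N \<le> real (card (?G \<inter> {0..2 * N})) / real N"
      using that by (intro share) simp_all
    have "card (?G \<inter> {0..2 * N}) \<le> card ?O" by (intro card_mono) auto
    then show "real (card (?G \<inter> {0..2 * N})) / real N \<le> 1"
      using that unfolding card_odd_atMost by simp
  qed
  have "(\<lambda>N. real (card (?G \<inter> {0..2 * N})) / real N) \<longlonglongrightarrow> 1"
  proof (rule tendsto_sandwich)
    show "(\<lambda>N. 1 - real (card (bad_lengths e \<inter> {0..2 * N})) / real N) \<longlonglongrightarrow> 1"
      using tendsto_diff[OF tendsto_const bad_lengths_null[OF e(1,2)], of 1] by simp
    show "\<forall>\<^sub>F N in sequentially. 1 - real (card (bad_lengths e \<inter> {0..2 * N})) / real N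
        \<le> real (card (?G \<inter> {0..2 * N})) / real N"
      using eventually_gt_at_top[of 0] by eventually_elim (rule part(1))
    show "\<forall>\<^sub>F N in sequentially. real (card (?G \<inter> {0..2 * N})) / real N \<le> 1"
      using eventually_gt_at_top[of 0] by eventually_elim (rule part(2))
  qed (rule tendsto_const)
  then have lim: "(\<lambda>N. ereal (real (card (?G \<inter> {0..2 * N})) / real N)) \<longlonglongrightarrow> ereal 1"
    by (rule tendsto_ereal)
  show ?thesis
    unfolding has_limiting_density_def limsup_density_def liminf_density_def
    using lim_imp_Limsup[OF sequentially_bot lim] lim_imp_Liminf[OF sequentially_bot lim] by blast
qed

end
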